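(* Let $(M,g)=(B\times_f F,\ g_B+f^2g_F)$ be a warped product manifold with $m_1=\dim B$, let $(\overline{M},\overline{g})=(\overline{M}(c),\phi,\xi,\eta,\overline{g})$ be a Kenmotsu space form of constant $\phi$-sectional curvature $c$, and let $\psi:(M,g)\to(\overline{M},\overline{g})$ be an isometric immersion. Assume that $(M,g)$ is a 2-dimensional totally geodesic submanifold of $(\overline{M},\overline{g})$ with $\xi\in\Gamma(TM)$. Then $$m_1\cdot(-1)\ \le\ \frac{\triangle f}{f}\ \le\ m_1\cdot(-1).$$
   Context: $(B,g_B)$ and $(F,g_F)$ are Riemannian manifolds (of positive dimension), $f:B\to\mathbb{R}^+$ is a smooth positive function (the warping function), and $B\times_f F$ is the product $B\times F$ with the metric $g=g_B+f^2g_F$; $f$ is also regarded as a function on $M$ via the projection to $B$. The Laplacian is $\triangle f=\sum_i\big((\nabla_{v_i}v_i)f-v_i^2f\big)$ for a local orthonormal frame $\{v_i\}$ of $TM$, where $\nabla$ is the Levi-Civita connection of $M$ (note the sign). Totally geodesic means that the second fundamental form of the immersion vanishes identically; $\xi\in\Gamma(TM)$ means $\xi$ is tangent to $M$ along $M$. A Kenmotsu manifold is an almost contact metric manifold $(\overline{M},\phi,\xi,\eta,\overline{g})$ (so $\phi^2=-\mathrm{id}+\eta\otimes\xi$, $\eta(\xi)=1$, $\overline{g}(\phi X,\phi Y)=\overline{g}(X,Y)-\eta(X)\eta(Y)$) with $(\overline{\nabla}_X\phi)Y=\overline{g}(\phi X,Y)\xi-\eta(Y)\phi X$. It is a Kenmotsu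 space form of constant $\phi$-sectional curvature $c$ when all planes spanned by $X,\phi X$ with $X\perp\xi$ have sectional curvature $c$; its curvature tensor is $$\overline{R}(X,Y)Z=\tfrac{c-3}{4}\big(\overline{g}(Y,Z)X-\overline{g}(X,Z)Y\big)+\tfrac{c+1}{4}\big(\eta(X)\eta(Z)Y-\eta(Y)\eta(Z)X+\eta(Y)\overline{g}(X,Z)\xi-\eta(X)\overline{g}(Y,Z)\xi+\overline{g}(\phi Y,Z)\phi X-\overline{g}(\phi X,Z)\phi Y-2\overline{g}(\phi X,Y)\phi Z\big).$$
   Formalization: The Laplacian of f is taken on the base (B, g_B) with its own Levi-Civita connection, not with a frame of TM on the whole warped product M; with the latter the claim fails, e.g. f = e^t on the hyperbolic plane in hyperbolic 3-space gives -2 instead of -1. *)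

theory Defs
  imports "HOL-Analysis.Analysis"
begin

section \<open>Smooth manifolds\<close>

(* S is always an open set in what follows, so the unrestricted filter at x is the right one. *)
fun Ck_on :: "nat \<Rightarrow> 'e::euclidean_space set \<Rightarrow> ('e \<Rightarrow> 'r::real_normed_vector) \<Rightarrow> bool" where
  "Ck_on 0 S f \<longleftrightarrow> continuous_on S f"
| "Ck_on (Suc k) S f \<longleftrightarrow> (\<forall>x\<in>S. f differentiable (at x)) \<and>
     (\<forall>v. Ck_on k S (\<lambda>x. frechet_derivative f (at x) v))"

definition smooth_on :: "'e::euclidean_space set \<Rightarrow> ('e \<Rightarrow> 'r::real_normed_vector) \<Rightarrow> bool" where
  "smooth_on S f \<longleftrightarrow> (\<forall>k. Ck_on k S f)"

type_synonym ('a, 'e) chart = "'a set \<times> ('a \<Rightarrow> 'e)"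

definition is_chart :: "('a::topological_space, 'e::euclidean_space) chart \<Rightarrow> bool" where
  "is_chart = (\<lambda>(U, \<phi>). open U \<and> open (\<phi> ` U) \<and> homeomorphism U (\<phi> ` U) \<phi> (inv_into U \<phi>))"

(* A manifold is a whole type with its topology together with an atlas, so the point set is
   automatically nonempty.  The dimension is DIM('e), which is at least 1.  Nothing below depends
   on whether the atlas is maximal. *)
definition smooth_atlas ::
    "('a::{t2_space, second_countable_topology}, 'e::euclidean_space) chart set \<Rightarrow> bool" where
  "smooth_atlas A \<longleftrightarrow> (\<forall>c\<in>A. is_chart c) \<and> (\<Union>(fst ` A) = UNIV) \<and>
     (\<forall>(U, \<phi>)\<in>A. \<forall>(V, \<theta>)\<in>A. smooth_on (\<phi> ` (U \<inter> V)) (\<theta> \<circ> inv_into U \<phi>))"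

definition prod_atlas :: "('a, 'd) chart set \<Rightarrow> ('b, 'e) chart set \<Rightarrow> ('a \<times> 'b, 'd \<times> 'e) chart set" where
  "prod_atlas A B = {(U \<times> V, map_prod \<phi> \<theta>) | U \<phi> V \<theta>. (U, \<phi>) \<in> A \<and> (V, \<theta>) \<in> B}"

(* Functions and fields are total, but only their values on the open set W matter. *)
definition smooth_fun_on :: "('a, 'e::euclidean_space) chart set \<Rightarrow> 'a set \<Rightarrow> ('a \<Rightarrow> real) \<Rightarrow> bool" where
  "smooth_fun_on A W h \<longleftrightarrow> (\<forall>(U, \<phi>)\<in>A. smooth_on (\<phi> ` (U \<inter> W)) (h \<circ> inv_into U \<phi>))"

definition smooth_near ::
    "('a::topological_space, 'e::euclidean_space) chart set \<Rightarrow> 'a \<Rightarrow> ('a \<Rightarrow> real) \<Rightarrow> bool" where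
  "smooth_near A p h \<longleftrightarrow> (\<exists>W. open W \<and> p \<in> W \<and> smooth_fun_on A W h)"

definition smooth_map ::
    "('a::topological_space, 'd::euclidean_space) chart set \<Rightarrow>
     ('b::topological_space, 'e::euclidean_space) chart set \<Rightarrow> ('a \<Rightarrow> 'b) \<Rightarrow> bool" where
  "smooth_map A B \<psi> \<longleftrightarrow> continuous_on UNIV \<psi> \<and>
     (\<forall>(U, \<phi>)\<in>A. \<forall>(V, \<theta>)\<in>B. smooth_on (\<phi> ` (U \<inter> \<psi> -` V)) (\<theta> \<circ> \<psi> \<circ> inv_into U \<phi>))"

section \<open>Tangent vectors and vector fields\<close>

(* Tangent vectors at p are derivations on functions that are smooth near p.  They are set to 0 on
   all other functions, so that equality of tangent vectors is equality of HOL functions.  That a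
   derivation depends only on germs follows from the product rule, because the functions are total:
   if h vanishes on a neighbourhood W of p, then h = k * h for the indicator k of the complement
   of W, which is smooth near p. *)
type_synonym 'a tangent = "('a \<Rightarrow> real) \<Rightarrow> real"
type_synonym 'a field = "'a \<Rightarrow> 'a tangent"

definition tplus :: "'a tangent \<Rightarrow> 'a tangent \<Rightarrow> 'a tangent" (infixl "+\<^sub>t" 65) where
  "v +\<^sub>t w = (\<lambda>h. v h + w h)"

definition tminus :: "'a tangent \<Rightarrow> 'a tangent \<Rightarrow> 'a tangent" (infixl "-\<^sub>t" 65) where
  "v -\<^sub>t w = (\<lambda>h. v h - w h)"

definition tscale :: "real \<Rightarrow> 'a tangent \<Rightarrow> 'a tangent" (infixr "*\<^sub>t" 75) where
  "a *\<^sub>t v = (\<lambda>h. a * v h)"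

definition tzero :: "'a tangent" where
  "tzero = (\<lambda>h. 0)"

definition tangent_space ::
    "('a::topological_space, 'e::euclidean_space) chart set \<Rightarrow> 'a \<Rightarrow> 'a tangent set" where
  "tangent_space A p = {v.
     (\<forall>h k. smooth_near A p h \<longrightarrow> smooth_near A p k \<longrightarrow>
        v (\<lambda>x. h x + k x) = v h + v k \<and> v (\<lambda>x. h x * k x) = h p * v k + k p * v h) \<and>
     (\<forall>a h. smooth_near A p h \<longrightarrow> v (\<lambda>x. a * h x) = a * v h) \<and>
     (\<forall>h. \<not> smooth_near A p h \<longrightarrow> v h = 0)}"

definition vector_field_on ::
    "('a::topological_space, 'e::euclidean_space) chart set \<Rightarrow> 'a set \<Rightarrow> 'a field \<Rightarrow> bool" where
  "vector_field_on A W X \<longleftrightarrow> (\<forall>p\<in>W. X p \<in> tangent_space A p) \<and>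
     (\<forall>V h. open V \<longrightarrow> smooth_fun_on A V h \<longrightarrow> smooth_fun_on A (W \<inter> V) (\<lambda>p. X p h))"

(* smooth sections over W of the pullback of the tangent bundle of the target along \<psi> *)
definition field_along_on ::
    "('a::topological_space, 'd::euclidean_space) chart set \<Rightarrow>
     ('b::topological_space, 'e::euclidean_space) chart set \<Rightarrow>
     ('a \<Rightarrow> 'b) \<Rightarrow> 'a set \<Rightarrow> ('a \<Rightarrow> 'b tangent) \<Rightarrow> bool" where
  "field_along_on A B \<psi> W Z \<longleftrightarrow> (\<forall>p\<in>W. Z p \<in> tangent_space B (\<psi> p)) \<and>
     (\<forall>V h. open V \<longrightarrow> smooth_fun_on B V h \<longrightarrow> smooth_fun_on A (W \<inter> \<psi> -` V) (\<lambda>p. Z p h))"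

definition push ::
    "('b::topological_space, 'e::euclidean_space) chart set \<Rightarrow> ('a \<Rightarrow> 'b) \<Rightarrow> 'a \<Rightarrow> 'a tangent \<Rightarrow> 'b tangent" where
  "push B \<psi> p v = (\<lambda>h. if smooth_near B (\<psi> p) h then v (h \<circ> \<psi>) else 0)"

(* The guard keeps the bracket 0 on functions that are not smooth near p. *)
definition lie_bracket ::
    "('a::topological_space, 'e::euclidean_space) chart set \<Rightarrow> 'a field \<Rightarrow> 'a field \<Rightarrow> 'a field" where
  "lie_bracket A X Y p = (\<lambda>h. if smooth_near A p h
     then X p (\<lambda>q. Y q h) - Y p (\<lambda>q. X q h) else 0)"

section \<open>Riemannian geometry\<close>

type_synonym 'a metric = "'a \<Rightarrow> 'a tangent \<Rightarrow> 'a tangent \<Rightarrow> real"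

definition linear_form ::
    "('a::topological_space, 'e::euclidean_space) chart set \<Rightarrow> 'a \<Rightarrow> ('a tangent \<Rightarrow> real) \<Rightarrow> bool" where
  "linear_form A p L \<longleftrightarrow> (\<forall>v\<in>tangent_space A p. \<forall>w\<in>tangent_space A p. \<forall>a b.
     L (a *\<^sub>t v +\<^sub>t b *\<^sub>t w) = a * L v + b * L w)"

definition linear_to_tangent ::
    "('a::topological_space, 'd::euclidean_space) chart set \<Rightarrow> 'a \<Rightarrow>
     ('b::topological_space, 'e::euclidean_space) chart set \<Rightarrow> 'b \<Rightarrow> ('a tangent \<Rightarrow> 'b tangent) \<Rightarrow> bool" where
  "linear_to_tangent A p B q L \<longleftrightarrow> L ` tangent_space A p \<subseteq> tangent_space B q \<and>
     (\<forall>v\<in>tangent_space A p. \<forall>w\<in>tangent_space A p. \<forall>a b.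
        L (a *\<^sub>t v +\<^sub>t b *\<^sub>t w) = a *\<^sub>t L v +\<^sub>t b *\<^sub>t L w)"

definition riemannian_metric ::
    "('a::topological_space, 'e::euclidean_space) chart set \<Rightarrow> 'a metric \<Rightarrow> bool" where
  "riemannian_metric A g \<longleftrightarrow>
     (\<forall>p. \<forall>v\<in>tangent_space A p.
        linear_form A p (g p v) \<and> (\<forall>w\<in>tangent_space A p. g p v w = g p w v) \<and>
        (v \<noteq> tzero \<longrightarrow> g p v v > 0)) \<and>
     (\<forall>W X Y. open W \<longrightarrow> vector_field_on A W X \<longrightarrow> vector_field_on A W Y \<longrightarrow>
        smooth_fun_on A W (\<lambda>p. g p (X p) (Y p)))"

definition riemannian_manifold ::
    "('a::{t2_space, second_countable_topology}, 'e::euclidean_space) chart set \<Rightarrow> 'a metric \<Rightarrow> bool" where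
  "riemannian_manifold A g \<longleftrightarrow> smooth_atlas A \<and> riemannian_metric A g"

(* A connection is written nab p v Y: the derivative at p of Y in the direction of the tangent
   vector v, for Y defined and smooth on some open neighbourhood of p.  Locality in Y follows from
   the product rule as for tangent vectors. *)
type_synonym 'a connection = "'a \<Rightarrow> 'a tangent \<Rightarrow> 'a field \<Rightarrow> 'a tangent"

definition affine_connection ::
    "('a::topological_space, 'e::euclidean_space) chart set \<Rightarrow> 'a connection \<Rightarrow> bool" where
  "affine_connection A nab \<longleftrightarrow> (\<forall>W Y. open W \<longrightarrow> vector_field_on A W Y \<longrightarrow>
     (\<forall>p\<in>W. linear_to_tangent A p A p (\<lambda>v. nab p v Y)) \<and>
     (\<forall>Z. vector_field_on A W Z \<longrightarrow> (\<forall>p\<in>W. \<forall>v\<in>tangent_space A p.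
        nab p v (\<lambda>q. Y q +\<^sub>t Z q) = nab p v Y +\<^sub>t nab p v Z)) \<and>
     (\<forall>h. smooth_fun_on A W h \<longrightarrow> (\<forall>p\<in>W. \<forall>v\<in>tangent_space A p.
        nab p v (\<lambda>q. h q *\<^sub>t Y q) = v h *\<^sub>t Y p +\<^sub>t h p *\<^sub>t nab p v Y)) \<and>
     (\<forall>X. vector_field_on A W X \<longrightarrow> vector_field_on A W (\<lambda>p. nab p (X p) Y)))"

definition levi_civita ::
    "('a::topological_space, 'e::euclidean_space) chart set \<Rightarrow> 'a metric \<Rightarrow> 'a connection \<Rightarrow> bool" where
  "levi_civita A g nab \<longleftrightarrow> affine_connection A nab \<and>
     (\<forall>W X Y. open W \<longrightarrow> vector_field_on A W X \<longrightarrow> vector_field_on A W Y \<longrightarrow> (\<forall>p\<in>W.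
        (\<forall>v\<in>tangent_space A p.
           v (\<lambda>q. g q (X q) (Y q)) = g p (nab p v X) (Y p) + g p (X p) (nab p v Y)) \<and>
        nab p (X p) Y -\<^sub>t nab p (Y p) X = lie_bracket A X Y p))"

definition curvature ::
    "('a::topological_space, 'e::euclidean_space) chart set \<Rightarrow> 'a connection \<Rightarrow>
     'a field \<Rightarrow> 'a field \<Rightarrow> 'a field \<Rightarrow> 'a field" where
  "curvature A nab X Y Z p =
     nab p (X p) (\<lambda>q. nab q (Y q) Z) -\<^sub>t nab p (Y p) (\<lambda>q. nab q (X q) Z)
       -\<^sub>t nab p (lie_bracket A X Y p) Z"

definition sectional_curvature ::
    "('a::topological_space, 'e::euclidean_space) chart set \<Rightarrow> 'a metric \<Rightarrow> 'a connection \<Rightarrow>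
     'a field \<Rightarrow> 'a field \<Rightarrow> 'a \<Rightarrow> real" where
  "sectional_curvature A g nab X Y p =
     g p (curvature A nab X Y Y p) (X p) /
     (g p (X p) (X p) * g p (Y p) (Y p) - (g p (X p) (Y p))\<^sup>2)"

definition orthonormal_frame_on ::
    "('a::topological_space, 'e::euclidean_space) chart set \<Rightarrow> 'a metric \<Rightarrow> 'a set \<Rightarrow>
     (nat \<Rightarrow> 'a field) \<Rightarrow> bool" where
  "orthonormal_frame_on A g W E \<longleftrightarrow>
     (\<forall>i<DIM('e). vector_field_on A W (E i)) \<and>
     (\<forall>p\<in>W. (\<forall>i<DIM('e). \<forall>j<DIM('e). g p (E i p) (E j p) = (if i = j then 1 else 0)) \<and>
        (\<forall>v\<in>tangent_space A p. \<exists>a. v = (\<lambda>h. \<Sum>i<DIM('e). a i * E i p h)))"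

(* Minus the trace of the Hessian.  The value does not depend on the chosen frame. *)
definition laplacian ::
    "('a::topological_space, 'e::euclidean_space) chart set \<Rightarrow> 'a metric \<Rightarrow> 'a connection \<Rightarrow>
     ('a \<Rightarrow> real) \<Rightarrow> 'a \<Rightarrow> real" where
  "laplacian A g nab h p =
     (let E = (SOME E. \<exists>W. open W \<and> p \<in> W \<and> orthonormal_frame_on A g W E)
      in \<Sum>i<DIM('e). nab p (E i p) (E i) h - E i p (\<lambda>q. E i q h))"

definition warped_metric ::
    "('b::topological_space, 'd::euclidean_space) chart set \<Rightarrow> 'b metric \<Rightarrow>
     ('f::topological_space, 'e::euclidean_space) chart set \<Rightarrow> 'f metric \<Rightarrow>
     ('b \<Rightarrow> real) \<Rightarrow> ('b \<times> 'f) metric" where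
  "warped_metric AB gB AF gF f p v w =
     gB (fst p) (push AB fst p v) (push AB fst p w) +
     (f (fst p))\<^sup>2 * gF (snd p) (push AF snd p v) (push AF snd p w)"

section \<open>Isometric immersions\<close>

definition isometric_immersion ::
    "('a::topological_space, 'd::euclidean_space) chart set \<Rightarrow> 'a metric \<Rightarrow>
     ('b::topological_space, 'e::euclidean_space) chart set \<Rightarrow> 'b metric \<Rightarrow> ('a \<Rightarrow> 'b) \<Rightarrow> bool" where
  "isometric_immersion A g B g' \<psi> \<longleftrightarrow> smooth_map A B \<psi> \<and>
     (\<forall>p. inj_on (push B \<psi> p) (tangent_space A p) \<and>
        (\<forall>v\<in>tangent_space A p. \<forall>w\<in>tangent_space A p.
           g' (\<psi> p) (push B \<psi> p v) (push B \<psi> p w) = g p v w))"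

(* The connection induced by nab on fields along \<psi>, characterised by its linearity, the product
   rule, and the last clause: on a field Y \<circ> \<psi> coming from the target it is nab in the direction of
   the pushed forward vector.  It exists and is unique; for an immersion it makes precise the
   derivative of Y along the submanifold, with no choice of extensions. *)
definition pullback_connection ::
    "('a::topological_space, 'd::euclidean_space) chart set \<Rightarrow>
     ('b::topological_space, 'e::euclidean_space) chart set \<Rightarrow> ('a \<Rightarrow> 'b) \<Rightarrow> 'b connection \<Rightarrow>
     ('a \<Rightarrow> 'a tangent \<Rightarrow> ('a \<Rightarrow> 'b tangent) \<Rightarrow> 'b tangent) \<Rightarrow> bool" where
  "pullback_connection A B \<psi> nab D \<longleftrightarrow>
     (\<forall>W Z. open W \<longrightarrow> field_along_on A B \<psi> W Z \<longrightarrow>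
        (\<forall>p\<in>W. linear_to_tangent A p B (\<psi> p) (\<lambda>v. D p v Z)) \<and>
        (\<forall>Z'. field_along_on A B \<psi> W Z' \<longrightarrow> (\<forall>p\<in>W. \<forall>v\<in>tangent_space A p.
           D p v (\<lambda>q. Z q +\<^sub>t Z' q) = D p v Z +\<^sub>t D p v Z')) \<and>
        (\<forall>h. smooth_fun_on A W h \<longrightarrow> (\<forall>p\<in>W. \<forall>v\<in>tangent_space A p.
           D p v (\<lambda>q. h q *\<^sub>t Z q) = v h *\<^sub>t Z p +\<^sub>t h p *\<^sub>t D p v Z)) \<and>
        (\<forall>X. vector_field_on A W X \<longrightarrow> field_along_on A B \<psi> W (\<lambda>p. D p (X p) Z))) \<and>
     (\<forall>V Y. open V \<longrightarrow> vector_field_on B V Y \<longrightarrow> (\<forall>p. \<psi> p \<in> V \<longrightarrow> (\<forall>v\<in>tangent_space A p.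
        D p v (Y \<circ> \<psi>) = nab (\<psi> p) (push B \<psi> p v) Y)))"

(* The Gauss formula: D is the connection along \<psi> induced by the Levi-Civita connection of the
   ambient manifold, nab the Levi-Civita connection of the immersed one. *)
definition second_fundamental_form ::
    "('b::topological_space, 'e::euclidean_space) chart set \<Rightarrow> ('a \<Rightarrow> 'b) \<Rightarrow> 'a connection \<Rightarrow>
     ('a \<Rightarrow> 'a tangent \<Rightarrow> ('a \<Rightarrow> 'b tangent) \<Rightarrow> 'b tangent) \<Rightarrow>
     'a field \<Rightarrow> 'a field \<Rightarrow> 'a \<Rightarrow> 'b tangent" where
  "second_fundamental_form B \<psi> nab D X Y p =
     D p (X p) (\<lambda>q. push B \<psi> q (Y q)) -\<^sub>t push B \<psi> p (nab p (X p) Y)"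

definition totally_geodesic ::
    "('a::topological_space, 'd::euclidean_space) chart set \<Rightarrow>
     ('b::topological_space, 'e::euclidean_space) chart set \<Rightarrow> ('a \<Rightarrow> 'b) \<Rightarrow> 'a connection \<Rightarrow>
     ('a \<Rightarrow> 'a tangent \<Rightarrow> ('a \<Rightarrow> 'b tangent) \<Rightarrow> 'b tangent) \<Rightarrow> bool" where
  "totally_geodesic A B \<psi> nab D \<longleftrightarrow>
     (\<forall>W X Y. open W \<longrightarrow> vector_field_on A W X \<longrightarrow> vector_field_on A W Y \<longrightarrow>
        (\<forall>p\<in>W. second_fundamental_form B \<psi> nab D X Y p = tzero))"

section \<open>Kenmotsu space forms\<close>

definition almost_contact_metric ::
    "('a::{t2_space, second_countable_topology}, 'e::euclidean_space) chart set \<Rightarrow>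
     ('a \<Rightarrow> 'a tangent \<Rightarrow> 'a tangent) \<Rightarrow> 'a field \<Rightarrow> ('a \<Rightarrow> 'a tangent \<Rightarrow> real) \<Rightarrow> 'a metric \<Rightarrow> bool" where
  "almost_contact_metric A \<phi> \<xi> \<eta> g \<longleftrightarrow> riemannian_manifold A g \<and>
     vector_field_on A UNIV \<xi> \<and>
     (\<forall>p. linear_to_tangent A p A p (\<phi> p) \<and> linear_form A p (\<eta> p)) \<and>
     (\<forall>W X. open W \<longrightarrow> vector_field_on A W X \<longrightarrow>
        vector_field_on A W (\<lambda>p. \<phi> p (X p)) \<and> smooth_fun_on A W (\<lambda>p. \<eta> p (X p))) \<and>
     (\<forall>p. \<eta> p (\<xi> p) = 1 \<and> (\<forall>v\<in>tangent_space A p.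
        \<phi> p (\<phi> p v) = \<eta> p v *\<^sub>t \<xi> p -\<^sub>t v \<and>
        (\<forall>w\<in>tangent_space A p. g p (\<phi> p v) (\<phi> p w) = g p v w - \<eta> p v * \<eta> p w)))"

definition kenmotsu ::
    "('a::{t2_space, second_countable_topology}, 'e::euclidean_space) chart set \<Rightarrow>
     ('a \<Rightarrow> 'a tangent \<Rightarrow> 'a tangent) \<Rightarrow> 'a field \<Rightarrow> ('a \<Rightarrow> 'a tangent \<Rightarrow> real) \<Rightarrow> 'a metric \<Rightarrow>
     'a connection \<Rightarrow> bool" where
  "kenmotsu A \<phi> \<xi> \<eta> g nab \<longleftrightarrow> almost_contact_metric A \<phi> \<xi> \<eta> g \<and> levi_civita A g nab \<and>
     (\<forall>W X Y. open W \<longrightarrow> vector_field_on A W X \<longrightarrow> vector_field_on A W Y \<longrightarrow> (\<forall>p\<in>W.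
        nab p (X p) (\<lambda>q. \<phi> q (Y q)) -\<^sub>t \<phi> p (nab p (X p) Y)
          = g p (\<phi> p (X p)) (Y p) *\<^sub>t \<xi> p -\<^sub>t \<eta> p (Y p) *\<^sub>t \<phi> p (X p)))"

definition kenmotsu_space_form ::
    "('a::{t2_space, second_countable_topology}, 'e::euclidean_space) chart set \<Rightarrow>
     ('a \<Rightarrow> 'a tangent \<Rightarrow> 'a tangent) \<Rightarrow> 'a field \<Rightarrow> ('a \<Rightarrow> 'a tangent \<Rightarrow> real) \<Rightarrow> 'a metric \<Rightarrow>
     'a connection \<Rightarrow> real \<Rightarrow> bool" where
  "kenmotsu_space_form A \<phi> \<xi> \<eta> g nab c \<longleftrightarrow> kenmotsu A \<phi> \<xi> \<eta> g nab \<and>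
     (\<forall>W X. open W \<longrightarrow> vector_field_on A W X \<longrightarrow>
        (\<forall>p\<in>W. X p \<noteq> tzero \<longrightarrow> g p (X p) (\<xi> p) = 0 \<longrightarrow>
           sectional_curvature A g nab X (\<lambda>q. \<phi> q (X q)) p = c))"

end

(*
  Along the immersion the Kenmotsu identity gives nabla_X xi = X - eta(X) xi, and since M is totally
  geodesic and xi is tangent to M, the same formula holds on M itself.  Both factors are
  one-dimensional; let T be the unit field of B and S the unit field of F, lifted to M, and put
  a = g(xi,T), b = g(xi,S), k = (T f)/f.  The Levi-Civita connection of the warped product turns the
  formula into the first order system
    T a = 1 - a^2,  S a = T b = b (k - a),  S b = f^2 a (a - k),  f^2 a^2 + b^2 = f^2.
  Because [T,S] = 0, equating the mixed derivatives of a and of b yields b (T k + k^2 - 1) = 0 and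
  a (T k + k^2 - 1) = 0.  As a and b do not vanish simultaneously, T k = 1 - k^2, that is T(T f) = f,
  and the Laplacian of f on the curve B is - T(T f).
*)

theory Submission
  imports Defs
begin

section \<open>Calculus of smooth functions on open sets\<close>

text \<open>Behind the mixed derivatives stands curvature. The formula for nabla xi forces curvature
  -1 on every plane containing \<xi>, while the warped product of two curves has curvature - T (T f)
  / f; comparing T S with S T on a and b equates the two. S is the lift of the unit field of F, so
  its length in M is f: leaving it unnormalised is what makes [T,S] vanish, and it is the source of
  the factors f^2 in the system. The main burden is foundational. Tangent vectors are bare
  derivations, so even the one-dimensionality of the tangent spaces of a curve rests on Hadamard's
  lemma, and this on differentiation under the integral sign. Two further facts about M are drawn
  from the immersion: the bilinearity and definiteness of g are pulled back from the ambient metric,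
  and the smoothness of a and b comes from the induced connection, because the derivative of \<xi>
  \<circ> \<psi> along a field is again smooth and contains \<eta> as a coefficient.\<close>

lemma Ck_on_has_derivative:
  assumes "Ck_on (Suc k) S f" "x \<in> S"
  shows "(f has_derivative frechet_derivative f (at x)) (at x)"
  using assms by (simp add: frechet_derivative_works)

lemma Ck_on_cong:
  assumes "open S" "\<And>x. x \<in> S \<Longrightarrow> f x = g x" "Ck_on k S f"
  shows "Ck_on k S g"
  using assms
proof (induction k arbitrary: f g)
  case 0
  then show ?case by (simp cong: continuous_on_cong)
next
  case (Suc k)
  have d: "(g has_derivative frechet_derivative f (at x)) (at x)" if "x \<in> S" for x
    by (rule has_derivative_transform_within_open[OF Ck_on_has_derivative[OF Suc.prems(3) that] Suc.prems(1) that Suc.prems(2)])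
  have "Ck_on k S (\<lambda>x. frechet_derivative g (at x) v)" for v
  proof (rule Suc.IH[OF Suc.prems(1)])
    show "frechet_derivative f (at x) v = frechet_derivative g (at x) v" if "x \<in> S" for x
      by (simp only: frechet_derivative_at[OF d[OF that]])
    show "Ck_on k S (\<lambda>x. frechet_derivative f (at x) v)"
      using Suc.prems(3) by simp
  qed
  moreover have "g differentiable (at x)" if "x \<in> S" for x
    using d[OF that] by (auto simp: differentiable_def)
  ultimately show ?case by simp
qed

text \<open>\<open>Ck_on\<close> recurses through \<open>frechet_derivative\<close>, which is a
  choice term. Uniqueness of derivatives lets any explicitly known derivative \<open>f'\<close>
  stand in for it, so that the algebraic closure properties below become inductions on k over the
  usual differentiation rules.\<close>

lemma Ck_onI:
  assumes "open S" and "\<And>x. x \<in> S \<Longrightarrow> (f has_derivative f' x) (at x)"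
    and "\<And>v. Ck_on k S (\<lambda>x. f' x v)"
  shows "Ck_on (Suc k) S f"
proof -
  have "f differentiable (at x)" if "x \<in> S" for x
    using assms(2)[OF that] by (auto simp: differentiable_def)
  moreover have "Ck_on k S (\<lambda>x. frechet_derivative f (at x) v)" for v
    by (rule Ck_on_cong[OF assms(1) _ assms(3)[of v]]) (simp add: frechet_derivative_at[OF assms(2), symmetric])
  ultimately show ?thesis by simp
qed

lemma Ck_on_SucD: "Ck_on (Suc k) S f \<Longrightarrow> Ck_on k S f"
proof (induction k arbitrary: f)
  case 0
  then show ?case
    by (auto intro!: continuous_at_imp_continuous_on differentiable_imp_continuous_within)
next
  case (Suc k)
  then show ?case by simp
qed

lemma Ck_on_subset: "Ck_on k S f \<Longrightarrow> T \<subseteq> S \<Longrightarrow> Ck_on k T f"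
  by (induction k arbitrary: f) (auto intro: continuous_on_subset)

lemma Ck_on_locally:
  assumes "\<And>x. x \<in> S \<Longrightarrow> \<exists>T. open T \<and> x \<in> T \<and> Ck_on k T f"
  shows "Ck_on k S f"
  using assms
proof (induction k arbitrary: f)
  case 0
  show ?case
    unfolding Ck_on.simps
  proof (intro continuous_at_imp_continuous_on ballI)
    fix x assume "x \<in> S"
    then obtain T where "open T" "x \<in> T" "continuous_on T f" using 0 by auto
    then show "continuous (at x) f" by (simp add: continuous_on_eq_continuous_at)
  qed
next
  case (Suc k)
  have "f differentiable (at x)" if "x \<in> S" for x
    using Suc.prems[OF that] by auto
  moreover have "Ck_on k S (\<lambda>x. frechet_derivative f (at x) v)" for v
  proof (rule Suc.IH)
    fix x assume "x \<in> S"
    then obtain T where "open T" "x \<in> T" "Ck_on (Suc k) T f" using Suc.prems by blast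
    then show "\<exists>T. open T \<and> x \<in> T \<and> Ck_on k T (\<lambda>x. frechet_derivative f (at x) v)" by auto
  qed
  ultimately show ?case by simp
qed

lemma Ck_on_const: "open S \<Longrightarrow> Ck_on k S (\<lambda>x. c)"
proof (induction k arbitrary: c)
  case (Suc k)
  then show ?case by (intro Ck_onI[where f' = "\<lambda>x v. 0"]) simp_all
qed simp

lemma Ck_on_id: "open S \<Longrightarrow> Ck_on k S (\<lambda>x. x)"
proof (cases k)
  case (Suc n)
  then show "open S \<Longrightarrow> ?thesis"
    unfolding Suc by (intro Ck_onI[where f' = "\<lambda>x v. v"] Ck_on_const) simp_all
qed simp

lemma Ck_on_bounded_linear:
  assumes "bounded_linear L" "open S" "Ck_on k S f"
  shows "Ck_on k S (\<lambda>x. L (f x))"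
  using assms(3)
proof (induction k arbitrary: f)
  case 0
  then show ?case using assms(1) by (simp add: linear_continuous_on_compose bounded_linear.continuous_on)
next
  case (Suc k)
  show ?case
  proof (rule Ck_onI[OF assms(2)])
    show "((\<lambda>x. L (f x)) has_derivative (\<lambda>v. L (frechet_derivative f (at x) v))) (at x)" if "x \<in> S" for x
      by (rule bounded_linear.has_derivative[OF assms(1) Ck_on_has_derivative[OF Suc.prems that]])
    show "Ck_on k S (\<lambda>x. L (frechet_derivative f (at x) v))" for v
      using Suc by simp
  qed
qed

lemma Ck_on_add:
  assumes "open S" "Ck_on k S f" "Ck_on k S g"
  shows "Ck_on k S (\<lambda>x. f x + g x)"
  using assms(2,3)
proof (induction k arbitrary: f g)
  case 0
  then show ?case by (simp add: continuous_on_add)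
next
  case (Suc k)
  show ?case
  proof (rule Ck_onI[OF assms(1)])
    show "((\<lambda>x. f x + g x) has_derivative (\<lambda>v. frechet_derivative f (at x) v + frechet_derivative g (at x) v)) (at x)"
      if "x \<in> S" for x
      by (intro has_derivative_add Suc.prems[THEN Ck_on_has_derivative] that)
    show "Ck_on k S (\<lambda>x. frechet_derivative f (at x) v + frechet_derivative g (at x) v)" for v
      using Suc by simp
  qed
qed

text \<open>The Leibniz rule pairs each undifferentiated factor with a derivative of the other one,
  so the induction hypothesis needs the factors themselves at the lower order;
  \<open>Ck_on_SucD\<close> supplies that.\<close>

lemma Ck_on_bilinear:
  assumes "bounded_bilinear B" "open S" "Ck_on k S f" "Ck_on k S g"
  shows "Ck_on k S (\<lambda>x. B (f x) (g x))"
  using assms(3,4)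
proof (induction k arbitrary: f g)
  case 0
  then show ?case using assms(1) by (simp add: bounded_bilinear.continuous_on)
next
  case (Suc k)
  show ?case
  proof (rule Ck_onI[OF assms(2)])
    show "((\<lambda>x. B (f x) (g x)) has_derivative
        (\<lambda>v. B (f x) (frechet_derivative g (at x) v) + B (frechet_derivative f (at x) v) (g x))) (at x)"
      if "x \<in> S" for x
      by (intro bounded_bilinear.FDERIV[OF assms(1)] Suc.prems[THEN Ck_on_has_derivative] that)
    fix v
    show "Ck_on k S (\<lambda>x. B (f x) (frechet_derivative g (at x) v) + B (frechet_derivative f (at x) v) (g x))"
      using Suc.prems[THEN Ck_on_SucD] Suc.prems by (intro Ck_on_add[OF assms(2)] Suc.IH) simp_all
  qed
qed

lemmas Ck_on_mult = Ck_on_bilinear[OF bounded_bilinear_mult]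
lemmas Ck_on_scaleR = Ck_on_bilinear[OF bounded_bilinear_scaleR]

lemma Ck_on_sum:
  assumes "open S" "\<And>i. i \<in> I \<Longrightarrow> Ck_on k S (f i)"
  shows "Ck_on k S (\<lambda>x. \<Sum>i\<in>I. f i x)"
  using assms(2)
  by (induction I rule: infinite_finite_induct) (auto intro!: Ck_on_add Ck_on_const assms(1))

lemma Ck_on_Pair:
  assumes "open S" "Ck_on k S f" "Ck_on k S g"
  shows "Ck_on k S (\<lambda>x. (f x, g x))"
  using assms(2,3)
proof (induction k arbitrary: f g)
  case 0
  then show ?case by (simp add: continuous_on_Pair)
next
  case (Suc k)
  show ?case
  proof (rule Ck_onI[OF assms(1)])
    show "((\<lambda>x. (f x, g x)) has_derivative (\<lambda>v. (frechet_derivative f (at x) v, frechet_derivative g (at x) v))) (at x)"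
      if "x \<in> S" for x
      by (intro has_derivative_Pair Suc.prems[THEN Ck_on_has_derivative] that)
    show "Ck_on k S (\<lambda>x. (frechet_derivative f (at x) v, frechet_derivative g (at x) v))" for v
      using Suc by simp
  qed
qed

lemma Ck_on_compose:
  fixes f :: "'a::euclidean_space \<Rightarrow> 'b::euclidean_space"
  assumes "open S" "open T" "f ` S \<subseteq> T" "Ck_on k S f" "Ck_on k T g"
  shows "Ck_on k S (\<lambda>x. g (f x))"
  using assms(3-5)
proof (induction k arbitrary: g)
  case 0
  then show ?case by (simp add: continuous_on_compose2)
next
  case (Suc k)
  let ?f = "\<lambda>x. frechet_derivative f (at x)" and ?g = "\<lambda>x. frechet_derivative g (at x)"
  have g: "(g has_derivative ?g (f x)) (at (f x))" if "x \<in> S" for x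
    using Ck_on_has_derivative[OF Suc.prems(3)] Suc.prems(1) that by blast
  show ?case
  proof (rule Ck_onI[OF assms(1)])
    fix x assume x: "x \<in> S"
    have "((\<lambda>x. g (f x)) has_derivative (\<lambda>v. ?g (f x) (?f x v))) (at x)"
      using diff_chain_at[OF Ck_on_has_derivative[OF Suc.prems(2) x] g[OF x]] by (simp add: o_def)
    \<comment> \<open>The direction fed into the derivative of g moves with x, whereas the induction
      hypothesis is about fixed directions. Expansion in the basis separates the two: the
      coefficients come from the derivative of f alone, and what remains are derivatives of g in
      fixed directions, composed with f.\<close>
    moreover have "?g (f x) w = (\<Sum>b\<in>Basis. (w \<bullet> b) *\<^sub>R ?g (f x) b)" for w
    proof -
      have "linear (?g (f x))" using g[OF x] has_derivative_linear by blast
      then show ?thesis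
        using linear_sum[of "?g (f x)" "\<lambda>b. (w \<bullet> b) *\<^sub>R b" Basis]
        by (simp add: euclidean_representation linear_cmul)
    qed
    ultimately show "((\<lambda>x. g (f x)) has_derivative (\<lambda>v. \<Sum>b\<in>Basis. (?f x v \<bullet> b) *\<^sub>R ?g (f x) b)) (at x)"
      by (rule has_derivative_eq_rhs[OF _ ext])
  next
    fix v
    show "Ck_on k S (\<lambda>x. \<Sum>b\<in>Basis. (?f x v \<bullet> b) *\<^sub>R ?g (f x) b)"
      using Suc.prems Ck_on_SucD[OF Suc.prems(2)]
      by (intro Ck_on_sum Ck_on_scaleR assms(1) Ck_on_bounded_linear[OF bounded_linear_inner_left] Suc.IH) simp_all
  qed
qed

text \<open>The derivative of the inverse is a polynomial in the inverse itself, so order k of the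
  function yields order k of its derivative.\<close>

lemma Ck_on_inverse: "Ck_on k (- {0::real}) inverse"
proof (induction k)
  case 0
  then show ?case by (auto intro!: continuous_intros)
next
  case (Suc k)
  have "open (- {0::real})" by auto
  then show ?case
  proof (rule Ck_onI)
    show "(inverse has_derivative (\<lambda>h. (- 1) * (inverse x * h * inverse x))) (at x)" if "x \<in> - {0}" for x :: real
      using has_derivative_inverse'[of x UNIV] that by simp
  qed (intro Ck_on_mult Suc Ck_on_const; auto)
qed

text \<open>The same bootstrapping, since r = \<open>inverse (sqrt x)\<close> has the derivative -
  r^3 / 2. The function serves to normalise vector fields.\<close>

lemma Ck_on_inverse_sqrt: "Ck_on k {0<..} (\<lambda>x::real. inverse (sqrt x))"
proof (induction k)
  case 0
  then show ?case by (auto intro!: continuous_intros)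
next
  case (Suc k)
  let ?r = "\<lambda>x::real. inverse (sqrt x)"
  have "open {0::real<..}" by auto
  then show ?case
  proof (rule Ck_onI[where f' = "\<lambda>x h. (- 1 / 2) * h * (?r x * (?r x * ?r x))"])
    fix x :: real assume "x \<in> {0<..}"
    then have "(?r has_real_derivative (- 1 / 2) * (?r x * (?r x * ?r x))) (at x)"
      by (auto intro!: derivative_eq_intros simp: field_simps power2_eq_square)
    then show "(?r has_derivative (\<lambda>h. (- 1 / 2) * h * (?r x * (?r x * ?r x)))) (at x)"
      unfolding has_field_derivative_def by (rule has_derivative_eq_rhs) (simp add: fun_eq_iff)
  qed (intro Ck_on_mult Suc Ck_on_const; simp)
qed

section \<open>Smooth functions as functions of every finite order\<close>

lemma smooth_onD: "smooth_on S f \<Longrightarrow> Ck_on k S f"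
  by (simp add: smooth_on_def)

lemma smooth_on_has_derivative:
  "smooth_on S f \<Longrightarrow> x \<in> S \<Longrightarrow> (f has_derivative frechet_derivative f (at x)) (at x)"
  by (blast intro: Ck_on_has_derivative smooth_onD)

lemma smooth_on_frechet_derivative:
  "smooth_on S f \<Longrightarrow> smooth_on S (\<lambda>x. frechet_derivative f (at x) v)"
  unfolding smooth_on_def using Ck_on.simps(2) by blast

lemma smooth_on_imp_continuous_on: "smooth_on S f \<Longrightarrow> continuous_on S f"
  using smooth_onD[of S f 0] by simp

lemma smooth_on_cong:
  "open S \<Longrightarrow> (\<And>x. x \<in> S \<Longrightarrow> f x = g x) \<Longrightarrow> smooth_on S f \<Longrightarrow> smooth_on S g"
  unfolding smooth_on_def using Ck_on_cong by blast

lemma smooth_on_subset: "smooth_on S f \<Longrightarrow> T \<subseteq> S \<Longrightarrow> smooth_on T f"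
  unfolding smooth_on_def using Ck_on_subset by blast

lemma smooth_on_locally:
  assumes "\<And>x. x \<in> S \<Longrightarrow> \<exists>T. open T \<and> x \<in> T \<and> smooth_on T f"
  shows "smooth_on S f"
  unfolding smooth_on_def
proof (intro allI Ck_on_locally)
  fix k x assume "x \<in> S"
  then show "\<exists>T. open T \<and> x \<in> T \<and> Ck_on k T f"
    using assms smooth_onD by meson
qed

lemma smooth_on_const: "open S \<Longrightarrow> smooth_on S (\<lambda>x. c)"
  by (simp add: smooth_on_def Ck_on_const)

lemma smooth_on_id: "open S \<Longrightarrow> smooth_on S (\<lambda>x. x)"
  by (simp add: smooth_on_def Ck_on_id)

lemma smooth_on_bounded_linear:
  "bounded_linear L \<Longrightarrow> open S \<Longrightarrow> smooth_on S f \<Longrightarrow> smooth_on S (\<lambda>x. L (f x))"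
  by (simp add: smooth_on_def Ck_on_bounded_linear)

lemma smooth_on_add:
  "open S \<Longrightarrow> smooth_on S f \<Longrightarrow> smooth_on S g \<Longrightarrow> smooth_on S (\<lambda>x. f x + g x)"
  by (simp add: smooth_on_def Ck_on_add)

lemma smooth_on_mult:
  fixes f g :: "'a::euclidean_space \<Rightarrow> 'b::real_normed_algebra"
  shows "open S \<Longrightarrow> smooth_on S f \<Longrightarrow> smooth_on S g \<Longrightarrow> smooth_on S (\<lambda>x. f x * g x)"
  by (simp add: smooth_on_def Ck_on_mult)

lemma smooth_on_Pair:
  "open S \<Longrightarrow> smooth_on S f \<Longrightarrow> smooth_on S g \<Longrightarrow> smooth_on S (\<lambda>x. (f x, g x))"
  by (simp add: smooth_on_def Ck_on_Pair)

lemma smooth_on_compose: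
  fixes f :: "'a::euclidean_space \<Rightarrow> 'b::euclidean_space"
  shows "open S \<Longrightarrow> open T \<Longrightarrow> f ` S \<subseteq> T \<Longrightarrow> smooth_on S f \<Longrightarrow> smooth_on T g \<Longrightarrow> smooth_on S (\<lambda>x. g (f x))"
  by (simp add: smooth_on_def Ck_on_compose)

lemma smooth_on_inverse: "smooth_on (- {0::real}) inverse"
  by (simp add: smooth_on_def Ck_on_inverse)

lemma smooth_on_inverse_sqrt: "smooth_on {0<..} (\<lambda>x::real. inverse (sqrt x))"
  by (simp add: smooth_on_def Ck_on_inverse_sqrt)

section \<open>Hadamard's lemma on a ball\<close>

context
  fixes x0 :: "'e::euclidean_space" and r :: real
begin

lemma ray_in_ball:
  assumes "x \<in> ball x0 r" "0 \<le> t" "t \<le> 1"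
  shows "x0 + t *\<^sub>R (x - x0) \<in> ball x0 r"
proof -
  have "\<bar>t\<bar> * norm (x - x0) \<le> 1 * norm (x - x0)"
    using assms by (intro mult_right_mono) auto
  then show ?thesis using assms(1) by (simp add: dist_norm norm_minus_commute)
qed

lemma ray_integrand_continuous:
  fixes h :: "'e \<Rightarrow> real"
  assumes "continuous_on (ball x0 r) h"
  shows "continuous_on (ball x0 r \<times> {0..1}) (\<lambda>(x, t). t ^ n * h (x0 + t *\<^sub>R (x - x0)))"
  unfolding case_prod_beta
  by (intro continuous_intros continuous_on_compose2[OF assms]) (auto intro!: ray_in_ball simp del: mem_ball)

lemma ray_integrand_integrable:
  fixes h :: "'e \<Rightarrow> real"
  assumes "continuous_on (ball x0 r) h" "x \<in> ball x0 r"
  shows "(\<lambda>t. t ^ n * h (x0 + t *\<^sub>R (x - x0))) integrable_on {0..1}"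
  by (intro integrable_continuous_real continuous_intros continuous_on_compose2[OF assms(1)])
    (use assms(2) in \<open>auto intro!: ray_in_ball simp del: mem_ball\<close>)

text \<open>Differentiation under the integral sign. The weight \<open>t ^ n\<close> is carried
  along because the chain rule on the ray x0 + t (x - x0) brings out one more factor t: the family
  of these integrals is thereby closed under directional derivatives, which
  \<open>Ck_on_ray_integral\<close> iterates.\<close>

lemma ray_integral_has_derivative:
  fixes h :: "'e \<Rightarrow> real"
  assumes h: "smooth_on (ball x0 r) h" and x: "x \<in> ball x0 r"
  shows "((\<lambda>x. integral {0..1} (\<lambda>t. t ^ n * h (x0 + t *\<^sub>R (x - x0)))) has_derivative
    (\<lambda>v. integral {0..1} (\<lambda>t. t ^ Suc n * frechet_derivative h (at (x0 + t *\<^sub>R (x - x0))) v))) (at x)"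
proof -
  let ?y = "\<lambda>x t. x0 + t *\<^sub>R (x - x0)"
  let ?d = "\<lambda>x t v. t ^ Suc n * frechet_derivative h (at (?y x t)) v"
  \<comment> \<open>\<open>leibniz_rule\<close> wants the derivative as a bounded operator that is
    continuous in (x, t) for the operator norm. \<open>Blinfun\<close> packages it, and in finite
    dimension continuity can be tested vector by vector.\<close>
  define d where "d x t = Blinfun (?d x t)" for x t
  have lin: "bounded_linear (?d x t)" if "x \<in> ball x0 r" "t \<in> {0..1}" for x t
    using smooth_on_has_derivative[OF h ray_in_ball] that
    by (intro bounded_linear_const_mult has_derivative_bounded_linear) auto
  have d: "blinfun_apply (d x t) = ?d x t" if "x \<in> ball x0 r" "t \<in> {0..1}" for x t
    unfolding d_def using lin[OF that] by (rule bounded_linear_Blinfun_apply)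
  have cd: "continuous_on (ball x0 r \<times> cbox 0 1) (\<lambda>(x, t). d x t)"
  proof (rule continuous_on_blinfun_componentwise)
    fix b :: 'e
    have "continuous_on (ball x0 r \<times> {0..1}) (\<lambda>(x, t). ?d x t b)"
      by (intro ray_integrand_continuous smooth_on_imp_continuous_on smooth_on_frechet_derivative h)
    then show "continuous_on (ball x0 r \<times> cbox 0 1) (\<lambda>p. blinfun_apply (case p of (x, t) \<Rightarrow> d x t) b)"
      unfolding box_real by (rule continuous_on_eq) (auto simp: d simp del: mem_ball)
  qed
  have "((\<lambda>x. integral (cbox 0 1) (\<lambda>t. t ^ n * h (?y x t))) has_derivative
      blinfun_apply (integral (cbox 0 1) (d x))) (at x within ball x0 r)"
  proof (rule leibniz_rule[OF _ _ cd x convex_ball])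
    fix x and t :: real assume xt: "x \<in> ball x0 r" "t \<in> cbox 0 1"
    have y: "((\<lambda>x. ?y x t) has_derivative (\<lambda>v. t *\<^sub>R v)) (at x)"
      by (auto intro!: derivative_eq_intros)
    have dh: "(h has_derivative frechet_derivative h (at (?y x t))) (at (?y x t))"
      using xt by (intro smooth_on_has_derivative[OF h] ray_in_ball) auto
    have "((\<lambda>x. t ^ n * h (?y x t)) has_derivative (\<lambda>v. t ^ n * frechet_derivative h (at (?y x t)) (t *\<^sub>R v))) (at x)"
      using diff_chain_at[OF y dh] by (intro has_derivative_mult_right) (simp add: o_def)
    moreover have "frechet_derivative h (at (?y x t)) (t *\<^sub>R v) = t *\<^sub>R frechet_derivative h (at (?y x t)) v" for v
      using linear_cmul[OF has_derivative_linear[OF dh]] by simp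
    ultimately have "((\<lambda>x. t ^ n * h (?y x t)) has_derivative d x t) (at x)"
      using xt by (simp add: d mult_ac)
    then show "((\<lambda>x. t ^ n * h (?y x t)) has_derivative d x t) (at x within ball x0 r)"
      by (rule has_derivative_at_withinI)
  next
    show "(\<lambda>t. t ^ n * h (?y x t)) integrable_on cbox 0 1" if "x \<in> ball x0 r" for x
      using ray_integrand_integrable[OF smooth_on_imp_continuous_on[OF h] that] by simp
  qed
  moreover have "blinfun_apply (integral (cbox 0 1) (d x)) = (\<lambda>v. integral {0..1} (\<lambda>t. ?d x t v))"
  proof
    fix v
    have "continuous_on (cbox 0 1) (d x)"
      using continuous_on_compose2[OF cd continuous_on_Pair[OF continuous_on_const[of _ x] continuous_on_id], of "cbox 0 1"] x
      by (simp add: image_subset_iff)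
    then have "blinfun_apply (integral (cbox 0 1) (d x)) v = integral (cbox 0 1) (\<lambda>t. blinfun_apply (d x t) v)"
      by (intro blinfun_apply_integral integrable_continuous)
    then show "blinfun_apply (integral (cbox 0 1) (d x)) v = integral {0..1} (\<lambda>t. ?d x t v)"
      using integral_cong[of "{0..1}" "\<lambda>t. blinfun_apply (d x t) v" "\<lambda>t. ?d x t v"] d[OF x] by simp
  qed
  ultimately show ?thesis
    unfolding at_within_open[OF x open_ball] box_real by (simp only:)
qed

lemma Ck_on_ray_integral:
  fixes h :: "'e \<Rightarrow> real"
  assumes "smooth_on (ball x0 r) h"
  shows "Ck_on k (ball x0 r) (\<lambda>x. integral {0..1} (\<lambda>t. t ^ n * h (x0 + t *\<^sub>R (x - x0))))"
  using assms
proof (induction k arbitrary: n h)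
  case 0
  show ?case
    unfolding Ck_on.simps
    by (intro continuous_at_imp_continuous_on ballI has_derivative_continuous[OF ray_integral_has_derivative[OF 0]])
next
  case (Suc k)
  show ?case
    by (rule Ck_onI[OF open_ball ray_integral_has_derivative[OF Suc.prems] Suc.IH])
      (assumption, rule smooth_on_frechet_derivative[OF Suc.prems])
qed

text \<open>\<open>G b\<close> averages the partial derivative in direction b over the segment from
  x0 to x, and the expansion is the fundamental theorem of calculus along that segment. Every
  non-constant term is a smooth function times a factor vanishing at x0, the shape on which the
  product rule of a derivation can be evaluated at x0.\<close>

lemma hadamard:
  fixes h :: "'e \<Rightarrow> real"
  assumes h: "smooth_on (ball x0 r) h" and r: "r > 0"
  obtains G where "\<And>b. smooth_on (ball x0 r) (G b)"
    and "\<And>b. G b x0 = frechet_derivative h (at x0) b"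
    and "\<And>x. x \<in> ball x0 r \<Longrightarrow> h x = h x0 + (\<Sum>b\<in>Basis. ((x - x0) \<bullet> b) * G b x)"
proof
  \<comment> \<open>The factor \<open>t ^ 0\<close> brings the integrand into the form of the
    weighted ray integrals.\<close>
  define G where "G b x = integral {0..1} (\<lambda>t. t ^ 0 * frechet_derivative h (at (x0 + t *\<^sub>R (x - x0))) b)" for b x
  show "smooth_on (ball x0 r) (G b)" for b
    unfolding smooth_on_def G_def by (intro allI Ck_on_ray_integral smooth_on_frechet_derivative h)
  show "G b x0 = frechet_derivative h (at x0) b" for b
    by (simp add: G_def)
  fix x assume x: "x \<in> ball x0 r"
  let ?y = "\<lambda>t. x0 + t *\<^sub>R (x - x0)" and ?h = "\<lambda>t. frechet_derivative h (at (x0 + t *\<^sub>R (x - x0)))"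
  have int: "((\<lambda>t. ?h t b) has_integral G b x) {0..1}" for b
    using ray_integrand_integrable[OF smooth_on_imp_continuous_on[OF smooth_on_frechet_derivative[OF h, of b]] x, of 0]
    by (simp add: G_def has_integral_integral)
  have dh: "(h has_derivative ?h t) (at (?y t))" if "t \<in> {0..1}" for t
    using that by (intro smooth_on_has_derivative[OF h] ray_in_ball x) auto
  have "((\<lambda>t. ?h t (x - x0)) has_integral (h (?y 1) - h (?y 0))) {0..1}"
  proof (rule fundamental_theorem_of_calculus)
    fix t :: real assume t: "t \<in> {0..1}"
    have y: "(?y has_derivative (\<lambda>s. s *\<^sub>R (x - x0))) (at t within {0..1})"
      by (auto intro!: derivative_eq_intros)
    have "((\<lambda>t. h (?y t)) has_derivative (\<lambda>s. ?h t (s *\<^sub>R (x - x0)))) (at t within {0..1})"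
      using diff_chain_within[OF y has_derivative_at_withinI[OF dh[OF t]]] by (simp add: o_def)
    then show "((\<lambda>t. h (?y t)) has_vector_derivative ?h t (x - x0)) (at t within {0..1})"
      using linear_cmul[OF has_derivative_linear[OF dh[OF t]]] by (simp add: has_vector_derivative_def)
  qed simp
  moreover have "?h t (x - x0) = (\<Sum>b\<in>Basis. ((x - x0) \<bullet> b) * ?h t b)" if "t \<in> {0..1}" for t
  proof -
    have l: "linear (?h t)" by (rule has_derivative_linear[OF dh[OF that]])
    have "?h t (x - x0) = ?h t (\<Sum>b\<in>Basis. ((x - x0) \<bullet> b) *\<^sub>R b)"
      by (simp only: euclidean_representation)
    also have "\<dots> = (\<Sum>b\<in>Basis. ((x - x0) \<bullet> b) * ?h t b)"
      by (simp only: linear_sum[OF l] linear_cmul[OF l] real_scaleR_def)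
    finally show ?thesis .
  qed
  ultimately have "((\<lambda>t. \<Sum>b\<in>Basis. ((x - x0) \<bullet> b) * ?h t b) has_integral (h (?y 1) - h (?y 0))) {0..1}"
    by (rule has_integral_eq[rotated])
  moreover have "((\<lambda>t. \<Sum>b\<in>Basis. ((x - x0) \<bullet> b) * ?h t b) has_integral (\<Sum>b\<in>Basis. ((x - x0) \<bullet> b) * G b x)) {0..1}"
    by (intro has_integral_sum has_integral_mult_right int) auto
  ultimately have "h (?y 1) - h (?y 0) = (\<Sum>b\<in>Basis. ((x - x0) \<bullet> b) * G b x)"
    by (rule has_integral_unique)
  then show "h x = h x0 + (\<Sum>b\<in>Basis. ((x - x0) \<bullet> b) * G b x)" by simp
qed

end

section \<open>Smooth functions and tangent vectors in charts\<close>

lemma smooth_atlas_chart: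
  assumes "smooth_atlas A" "(U, \<phi>) \<in> A"
  shows "open U" "open (\<phi> ` U)" "inj_on \<phi> U" "continuous_on U \<phi>"
    "continuous_on (\<phi> ` U) (inv_into U \<phi>)"
    and "x \<in> U \<Longrightarrow> inv_into U \<phi> (\<phi> x) = x"
proof -
  have c: "open U" "open (\<phi> ` U)" "homeomorphism U (\<phi> ` U) \<phi> (inv_into U \<phi>)"
    using assms unfolding smooth_atlas_def is_chart_def by auto
  then show "open U" "open (\<phi> ` U)" "continuous_on U \<phi>" "continuous_on (\<phi> ` U) (inv_into U \<phi>)"
    by (auto simp: homeomorphism_def)
  show inj: "inj_on \<phi> U"
    using c(3) by (intro inj_onI) (metis homeomorphism_apply1)
  show "x \<in> U \<Longrightarrow> inv_into U \<phi> (\<phi> x) = x"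
    using inj by simp
qed

lemma smooth_atlas_open_image:
  assumes "smooth_atlas A" "(U, \<phi>) \<in> A" "open W"
  shows "open (\<phi> ` (U \<inter> W))"
proof -
  note c = smooth_atlas_chart[OF assms(1,2)]
  have "\<phi> ` (U \<inter> W) = inv_into U \<phi> -` W \<inter> \<phi> ` U"
    using c(6) by force
  then show ?thesis
    using c(2,5) \<open>open W\<close> by (simp add: continuous_on_open_vimage)
qed

lemma smooth_atlas_cover:
  assumes "smooth_atlas A"
  obtains U \<phi> where "(U, \<phi>) \<in> A" "p \<in> U"
proof -
  have "p \<in> \<Union>(fst ` A)" using assms by (auto simp: smooth_atlas_def)
  then show ?thesis using that by auto
qed

lemma smooth_fun_onD:
  "smooth_fun_on A W h \<Longrightarrow> (U, \<phi>) \<in> A \<Longrightarrow> smooth_on (\<phi> ` (U \<inter> W)) (h \<circ> inv_into U \<phi>)"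
  by (auto simp: smooth_fun_on_def)

lemma smooth_fun_on_subset: "smooth_fun_on A W h \<Longrightarrow> W' \<subseteq> W \<Longrightarrow> smooth_fun_on A W' h"
  unfolding smooth_fun_on_def
  by clarify (drule bspec, assumption, auto elim!: smooth_on_subset)

context
  fixes A :: "('a::{t2_space, second_countable_topology}, 'e::euclidean_space) chart set"
  assumes A: "smooth_atlas A"
begin

text \<open>\<open>smooth_fun_on\<close> quantifies over all charts; the transition maps carry
  smoothness from the one given chart to every other.\<close>

lemma smooth_fun_on_chartI:
  assumes "(U, \<phi>) \<in> A" "open W" "W \<subseteq> U" "smooth_on (\<phi> ` W) (h \<circ> inv_into U \<phi>)"
  shows "smooth_fun_on A W h"
  unfolding smooth_fun_on_def
proof clarify
  fix V \<theta> assume V: "(V, \<theta>) \<in> A"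
  note U = smooth_atlas_chart[OF A assms(1)] and V' = smooth_atlas_chart[OF A V]
  have op: "open (\<theta> ` (V \<inter> W))" "open (\<phi> ` W)"
    using smooth_atlas_open_image[OF A V assms(2)] smooth_atlas_open_image[OF A assms(1,2)] assms(3)
    by (auto simp: Int_absorb1)
  have "smooth_on (\<theta> ` (V \<inter> U)) (\<phi> \<circ> inv_into V \<theta>)"
    using A V assms(1) unfolding smooth_atlas_def by fastforce
  then have s: "smooth_on (\<theta> ` (V \<inter> W)) (\<phi> \<circ> inv_into V \<theta>)"
    by (rule smooth_on_subset) (use assms(3) in auto)
  have "smooth_on (\<theta> ` (V \<inter> W)) (\<lambda>x. (h \<circ> inv_into U \<phi>) ((\<phi> \<circ> inv_into V \<theta>) x))"
    by (rule smooth_on_compose[OF op _ s assms(4)]) (auto simp: V')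
  then show "smooth_on (\<theta> ` (V \<inter> W)) (h \<circ> inv_into V \<theta>)"
    by (rule smooth_on_cong[OF op(1), rotated]) (use U(6) V'(6) assms(3) in auto)
qed

lemma smooth_fun_on_cong:
  assumes "open W" "\<And>x. x \<in> W \<Longrightarrow> h x = k x" "smooth_fun_on A W h"
  shows "smooth_fun_on A W k"
  unfolding smooth_fun_on_def
proof clarify
  fix U \<phi> assume U: "(U, \<phi>) \<in> A"
  show "smooth_on (\<phi> ` (U \<inter> W)) (k \<circ> inv_into U \<phi>)"
    by (rule smooth_on_cong[OF smooth_atlas_open_image[OF A U assms(1)] _ smooth_fun_onD[OF assms(3) U]])
      (use assms(2) smooth_atlas_chart[OF A U] in auto)
qed

lemma smooth_fun_on_locally:
  assumes "\<And>p. p \<in> W \<Longrightarrow> \<exists>V. open V \<and> p \<in> V \<and> smooth_fun_on A V h"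
  shows "smooth_fun_on A W h"
  unfolding smooth_fun_on_def
proof clarify
  fix U \<phi> assume U: "(U, \<phi>) \<in> A"
  show "smooth_on (\<phi> ` (U \<inter> W)) (h \<circ> inv_into U \<phi>)"
  proof (rule smooth_on_locally)
    fix y assume "y \<in> \<phi> ` (U \<inter> W)"
    then obtain p where p: "y = \<phi> p" "p \<in> U" "p \<in> W" by auto
    obtain V where V: "open V" "p \<in> V" "smooth_fun_on A V h" using assms[OF p(3)] by blast
    show "\<exists>T. open T \<and> y \<in> T \<and> smooth_on T (h \<circ> inv_into U \<phi>)"
      using smooth_atlas_open_image[OF A U V(1)] smooth_fun_onD[OF V(3) U] p V(2) by blast
  qed
qed

lemma smooth_fun_on_const: "open W \<Longrightarrow> smooth_fun_on A W (\<lambda>x. c)"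
  unfolding smooth_fun_on_def
  by (auto simp: o_def intro!: smooth_on_const smooth_atlas_open_image[OF A])

lemma smooth_fun_on_add:
  assumes "open W" "smooth_fun_on A W h" "smooth_fun_on A W k"
  shows "smooth_fun_on A W (\<lambda>x. h x + k x)"
  unfolding smooth_fun_on_def
proof clarify
  fix U \<phi> assume U: "(U, \<phi>) \<in> A"
  show "smooth_on (\<phi> ` (U \<inter> W)) ((\<lambda>x. h x + k x) \<circ> inv_into U \<phi>)"
    using smooth_on_add[OF smooth_atlas_open_image[OF A U assms(1)] smooth_fun_onD[OF assms(2) U] smooth_fun_onD[OF assms(3) U]]
    by (simp add: o_def)
qed

lemma smooth_fun_on_mult:
  assumes "open W" "smooth_fun_on A W h" "smooth_fun_on A W k"
  shows "smooth_fun_on A W (\<lambda>x. h x * k x)"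
  unfolding smooth_fun_on_def
proof clarify
  fix U \<phi> assume U: "(U, \<phi>) \<in> A"
  show "smooth_on (\<phi> ` (U \<inter> W)) ((\<lambda>x. h x * k x) \<circ> inv_into U \<phi>)"
    using smooth_on_mult[OF smooth_atlas_open_image[OF A U assms(1)] smooth_fun_onD[OF assms(2) U] smooth_fun_onD[OF assms(3) U]]
    by (simp add: o_def)
qed

lemma smooth_fun_on_sum:
  assumes "open W" "\<And>i. i \<in> I \<Longrightarrow> smooth_fun_on A W (h i)"
  shows "smooth_fun_on A W (\<lambda>x. \<Sum>i\<in>I. h i x)"
  using assms(2)
  by (induction I rule: infinite_finite_induct)
    (simp_all add: smooth_fun_on_const smooth_fun_on_add assms(1))

lemma smooth_fun_on_compose_real:
  fixes g :: "real \<Rightarrow> real"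
  assumes "open W" "smooth_fun_on A W h" "open T" "smooth_on T g" "h ` W \<subseteq> T"
  shows "smooth_fun_on A W (\<lambda>x. g (h x))"
  unfolding smooth_fun_on_def
proof clarify
  fix U \<phi> assume U: "(U, \<phi>) \<in> A"
  have "smooth_on (\<phi> ` (U \<inter> W)) (\<lambda>y. g ((h \<circ> inv_into U \<phi>) y))"
    by (rule smooth_on_compose[OF smooth_atlas_open_image[OF A U assms(1)] assms(3) _ smooth_fun_onD[OF assms(2) U] assms(4)])
      (use assms(5) smooth_atlas_chart[OF A U] in auto)
  then show "smooth_on (\<phi> ` (U \<inter> W)) ((\<lambda>x. g (h x)) \<circ> inv_into U \<phi>)"
    by (simp add: o_def)
qed

lemma smooth_fun_on_inverse:
  assumes "open W" "smooth_fun_on A W h" "\<And>x. x \<in> W \<Longrightarrow> h x \<noteq> 0"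
  shows "smooth_fun_on A W (\<lambda>x. inverse (h x))"
  by (rule smooth_fun_on_compose_real[OF assms(1,2) _ smooth_on_inverse]) (use assms(3) in auto)

lemma smooth_fun_on_inverse_sqrt:
  assumes "open W" "smooth_fun_on A W h" "\<And>x. x \<in> W \<Longrightarrow> h x > 0"
  shows "smooth_fun_on A W (\<lambda>x. inverse (sqrt (h x)))"
  by (rule smooth_fun_on_compose_real[OF assms(1,2) _ smooth_on_inverse_sqrt]) (use assms(3) in auto)

lemma smooth_fun_on_chart_function:
  assumes U: "(U, \<phi>) \<in> A" "open W" "W \<subseteq> U" and g: "smooth_on (\<phi> ` W) g"
  shows "smooth_fun_on A W (\<lambda>x. g (\<phi> x))"
proof (rule smooth_fun_on_chartI[OF U])
  have "open (\<phi> ` W)"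
    using smooth_atlas_open_image[OF A U(1,2)] U(3) by (simp add: Int_absorb1)
  then show "smooth_on (\<phi> ` W) ((\<lambda>x. g (\<phi> x)) \<circ> inv_into U \<phi>)"
    by (rule smooth_on_cong[OF _ _ g]) (use U(3) smooth_atlas_chart[OF A U(1)] in auto)
qed

lemma smooth_fun_on_coordinate:
  assumes "(U, \<phi>) \<in> A"
  shows "smooth_fun_on A U (\<lambda>x. \<phi> x \<bullet> b)"
  using smooth_atlas_chart[OF A assms]
  by (intro smooth_fun_on_chart_function[OF assms] smooth_on_bounded_linear[OF bounded_linear_inner_left] smooth_on_id) auto

lemma smooth_fun_on_chart_derivative:
  assumes "(U, \<phi>) \<in> A" "open V" "smooth_fun_on A V h"
  shows "smooth_fun_on A (U \<inter> V) (\<lambda>p. frechet_derivative (h \<circ> inv_into U \<phi>) (at (\<phi> p)) u)"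
  using smooth_atlas_chart[OF A assms(1)] assms(2)
  by (intro smooth_fun_on_chart_function[OF assms(1)] smooth_on_frechet_derivative smooth_fun_onD[OF assms(3,1)]) auto

lemma smooth_nearI: "open W \<Longrightarrow> p \<in> W \<Longrightarrow> smooth_fun_on A W h \<Longrightarrow> smooth_near A p h"
  unfolding smooth_near_def by blast

lemma smooth_near_const: "smooth_near A p (\<lambda>x. c)"
  by (rule smooth_nearI[OF open_UNIV _ smooth_fun_on_const]) auto

lemma smooth_near2:
  assumes "smooth_near A p h" "smooth_near A p k"
  obtains W where "open W" "p \<in> W" "smooth_fun_on A W h" "smooth_fun_on A W k"
proof -
  obtain V V' where "open V" "p \<in> V" "smooth_fun_on A V h" "open V'" "p \<in> V'" "smooth_fun_on A V' k"
    using assms unfolding smooth_near_def by blast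
  then show ?thesis
    using that[of "V \<inter> V'"] smooth_fun_on_subset[of A] by (metis IntI Int_lower1 Int_lower2 open_Int)
qed

lemma smooth_near_add:
  assumes "smooth_near A p h" "smooth_near A p k"
  shows "smooth_near A p (\<lambda>x. h x + k x)"
  by (rule smooth_near2[OF assms]) (rule smooth_nearI[OF _ _ smooth_fun_on_add])

lemma smooth_near_mult:
  assumes "smooth_near A p h" "smooth_near A p k"
  shows "smooth_near A p (\<lambda>x. h x * k x)"
  by (rule smooth_near2[OF assms]) (rule smooth_nearI[OF _ _ smooth_fun_on_mult])

lemma smooth_near_local:
  assumes "open W" "p \<in> W" "\<And>x. x \<in> W \<Longrightarrow> h x = k x" "smooth_near A p h"
  shows "smooth_near A p k"
proof -
  obtain V where V: "open V" "p \<in> V" "smooth_fun_on A V h"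
    using assms(4) unfolding smooth_near_def by blast
  have "smooth_fun_on A (V \<inter> W) k"
    by (rule smooth_fun_on_cong[of _ h]) (use V assms(1,3) smooth_fun_on_subset[OF V(3)] in auto)
  then show ?thesis by (rule smooth_nearI[rotated 2]) (use V assms in auto)
qed

lemma smooth_near_sum:
  assumes "\<And>i. i \<in> I \<Longrightarrow> smooth_near A p (h i)"
  shows "smooth_near A p (\<lambda>x. \<Sum>i\<in>I. h i x)"
  using assms
  by (induction I rule: infinite_finite_induct) (simp_all add: smooth_near_const smooth_near_add)

section \<open>Derivations: algebra, locality and coordinates\<close>

lemma tangent_add:
  "v \<in> tangent_space A p \<Longrightarrow> smooth_near A p h \<Longrightarrow> smooth_near A p k \<Longrightarrow> v (\<lambda>x. h x + k x) = v h + v k"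
  by (simp add: tangent_space_def)

lemma tangent_mult:
  "v \<in> tangent_space A p \<Longrightarrow> smooth_near A p h \<Longrightarrow> smooth_near A p k \<Longrightarrow>
    v (\<lambda>x. h x * k x) = h p * v k + k p * v h"
  by (simp add: tangent_space_def)

lemma tangent_cmult:
  "v \<in> tangent_space A p \<Longrightarrow> smooth_near A p h \<Longrightarrow> v (\<lambda>x. a * h x) = a * v h"
  by (simp add: tangent_space_def)

lemma tangent_not_smooth: "v \<in> tangent_space A p \<Longrightarrow> \<not> smooth_near A p h \<Longrightarrow> v h = 0"
  by (simp add: tangent_space_def)

lemma tangent_const:
  assumes "v \<in> tangent_space A p"
  shows "v (\<lambda>x. c) = 0"
proof -
  have "v (\<lambda>x. 1) = 0"
    using tangent_mult[OF assms smooth_near_const smooth_near_const, of 1 1] by simp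
  then show ?thesis
    using tangent_cmult[OF assms smooth_near_const, of c 1] by simp
qed

lemma tangent_local:
  assumes v: "v \<in> tangent_space A p" and W: "open W" "p \<in> W" "\<And>x. x \<in> W \<Longrightarrow> h x = k x"
  shows "v h = v k"
proof (cases "smooth_near A p h")
  case True
  have k: "smooth_near A p k" by (rule smooth_near_local[OF W True])
  let ?d = "\<lambda>x. k x + (- 1) * h x" and ?i = "\<lambda>x. if x \<in> W then 0 else 1 :: real"
  have d: "smooth_near A p ?d" by (intro smooth_near_add k smooth_near_mult smooth_near_const True)
  have i: "smooth_near A p ?i"
    by (rule smooth_near_local[OF W(1,2) _ smooth_near_const[of p 0]]) auto
  have "?d = (\<lambda>x. ?i x * ?d x)" using W(3) by auto
  then have "v ?d = ?i p * v ?d + ?d p * v ?i" using tangent_mult[OF v i d] by metis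
  then have "v ?d = 0" using W by simp
  moreover have "v k = v (\<lambda>x. h x + ?d x)" by simp
  then have "v k = v h + v ?d" using tangent_add[OF v True d] by simp
  ultimately show ?thesis by simp
next
  case False
  \<comment> \<open>Smoothness near p is itself a local property, so neither function has it and v
    takes the default value 0 on both.\<close>
  then have "\<not> smooth_near A p k" using smooth_near_local[OF W(1,2), of k h] W(3) by auto
  then show ?thesis using False tangent_not_smooth[OF v] by simp
qed

lemma tangent_sum:
  assumes "v \<in> tangent_space A p" "\<And>i. i \<in> I \<Longrightarrow> smooth_near A p (h i)"
  shows "v (\<lambda>x. \<Sum>i\<in>I. h i x) = (\<Sum>i\<in>I. v (h i))"
  using assms(2)
  by (induction I rule: infinite_finite_induct)
    (simp_all add: tangent_const[OF assms(1)] tangent_add[OF assms(1)] smooth_near_sum)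

text \<open>Apply v to Hadamard's expansion in the chart. The constant term is killed, and in each
  product the coordinate difference vanishes at p, so the product rule leaves the value of v on the
  coordinate times \<open>G b\<close> at p, which is the partial derivative. Thus finitely many
  numbers determine a derivation.\<close>

lemma tangent_coordinates:
  assumes v: "v \<in> tangent_space A p" and U: "(U, \<phi>) \<in> A" "p \<in> U" and h: "smooth_near A p h"
  shows "v h = (\<Sum>b\<in>Basis. v (\<lambda>x. \<phi> x \<bullet> b) * frechet_derivative (h \<circ> inv_into U \<phi>) (at (\<phi> p)) b)"
proof -
  note c = smooth_atlas_chart[OF A U(1)]
  let ?H = "h \<circ> inv_into U \<phi>"
  obtain W where W: "open W" "p \<in> W" "smooth_fun_on A W h"
    using h unfolding smooth_near_def by blast
  have "open (\<phi> ` (U \<inter> W))" "\<phi> p \<in> \<phi> ` (U \<inter> W)"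
    using smooth_atlas_open_image[OF A U(1) W(1)] U W by auto
  then obtain r where r: "r > 0" "ball (\<phi> p) r \<subseteq> \<phi> ` (U \<inter> W)"
    using open_contains_ball by blast
  then have H: "smooth_on (ball (\<phi> p) r) ?H"
    using smooth_on_subset[OF smooth_fun_onD[OF W(3) U(1)]] by blast
  obtain G where G: "\<And>b. smooth_on (ball (\<phi> p) r) (G b)"
      "\<And>b. G b (\<phi> p) = frechet_derivative ?H (at (\<phi> p)) b"
      "\<And>x. x \<in> ball (\<phi> p) r \<Longrightarrow> ?H x = ?H (\<phi> p) + (\<Sum>b\<in>Basis. ((x - \<phi> p) \<bullet> b) * G b x)"
    using hadamard[OF H r(1)] by blast
  define B where "B = U \<inter> \<phi> -` ball (\<phi> p) r"
  have B: "open B" "p \<in> B" "B \<subseteq> U"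
    using continuous_on_open_vimage[OF c(1)] c(4) r(1) U(2) by (auto simp: B_def Int_commute)
  have sub: "\<phi> ` B \<subseteq> ball (\<phi> p) r" by (auto simp: B_def)
  have Gs: "smooth_near A p (\<lambda>q. G b (\<phi> q))" for b
    by (rule smooth_nearI[OF B(1,2) smooth_fun_on_chart_function[OF U(1) B(1,3) smooth_on_subset[OF G(1) sub]]])
  have xs: "smooth_near A p (\<lambda>q. \<phi> q \<bullet> b)" for b
    by (rule smooth_nearI[OF c(1) U(2) smooth_fun_on_coordinate[OF U(1)]])
  have xs': "smooth_near A p (\<lambda>q. \<phi> q \<bullet> b + - (\<phi> p \<bullet> b))" for b
    by (intro smooth_near_add xs smooth_near_const)
  have "v h = v (\<lambda>q. h p + (\<Sum>b\<in>Basis. (\<phi> q \<bullet> b + - (\<phi> p \<bullet> b)) * G b (\<phi> q)))"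
  proof (rule tangent_local[OF v B(1,2)])
    fix q assume "q \<in> B"
    then have "q \<in> U" "\<phi> q \<in> ball (\<phi> p) r" by (auto simp: B_def)
    then show "h q = h p + (\<Sum>b\<in>Basis. (\<phi> q \<bullet> b + - (\<phi> p \<bullet> b)) * G b (\<phi> q))"
      using G(3)[of "\<phi> q"] c(6) U(2) by (simp add: inner_diff_left)
  qed
  also have "\<dots> = (\<Sum>b\<in>Basis. v (\<lambda>q. (\<phi> q \<bullet> b + - (\<phi> p \<bullet> b)) * G b (\<phi> q)))"
    by (simp add: tangent_add[OF v smooth_near_const smooth_near_sum[OF smooth_near_mult[OF xs' Gs]]]
        tangent_const[OF v] tangent_sum[OF v smooth_near_mult[OF xs' Gs]] del: add_uminus_conv_diff)
  also have "\<dots> = (\<Sum>b\<in>Basis. v (\<lambda>x. \<phi> x \<bullet> b) * frechet_derivative ?H (at (\<phi> p)) b)"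
    by (rule sum.cong[OF refl], subst tangent_mult[OF v xs' Gs])
      (simp add: tangent_add[OF v xs smooth_near_const] tangent_const[OF v] G(2) del: add_uminus_conv_diff)
  finally show ?thesis .
qed

end

lemma smooth_fun_on_imp_continuous_on:
  assumes A: "smooth_atlas A" and W: "open W" and h: "smooth_fun_on A W h"
  shows "continuous_on W h"
proof (intro continuous_at_imp_continuous_on ballI)
  fix p assume "p \<in> W"
  obtain U \<phi> where U: "(U, \<phi>) \<in> A" "p \<in> U" using smooth_atlas_cover[OF A] .
  note c = smooth_atlas_chart[OF A U(1)]
  have "continuous_on (U \<inter> W) (\<lambda>x. (h \<circ> inv_into U \<phi>) (\<phi> x))"
    by (intro continuous_on_compose2[OF smooth_on_imp_continuous_on[OF smooth_fun_onD[OF h U(1)]]]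
        continuous_on_subset[OF c(4)]) auto
  then have "continuous_on (U \<inter> W) h"
    by (rule continuous_on_eq) (simp add: c(6))
  then show "continuous (at p) h"
    using c(1) W U(2) \<open>p \<in> W\<close> continuous_on_eq_continuous_at[of "U \<inter> W" h] by blast
qed

section \<open>Coordinate fields and pushforwards\<close>

text \<open>The coordinate derivation in a direction u of the model space. Admitting every u, and
  not only basis vectors, keeps linear combinations at a point in the same form. The guard gives the
  value 0 that \<open>tangent_space\<close> prescribes on functions not smooth near p.\<close>

definition coord_field ::
    "('a::topological_space, 'e::euclidean_space) chart set \<Rightarrow> ('a, 'e) chart \<Rightarrow> 'e \<Rightarrow> 'a field" where
  "coord_field A c u p = (\<lambda>h. if smooth_near A p h
     then frechet_derivative (h \<circ> inv_into (fst c) (snd c)) (at (snd c p)) u else 0)"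

lemma tplus_apply [simp]: "(v +\<^sub>t w) h = v h + w h"
  and tminus_apply [simp]: "(v -\<^sub>t w) h = v h - w h"
  and tscale_apply [simp]: "(a *\<^sub>t v) h = a * v h"
  and tzero_apply [simp]: "tzero h = 0"
  by (simp_all add: tplus_def tminus_def tscale_def tzero_def)

lemma tscale_one [simp]: "1 *\<^sub>t v = v"
  and tscale_zero_left [simp]: "0 *\<^sub>t v = tzero"
  and tscale_tzero [simp]: "a *\<^sub>t tzero = tzero"
  and tplus_tzero [simp]: "v +\<^sub>t tzero = v"
  by (simp_all add: fun_eq_iff)

lemma tangent_space_tplus:
  assumes "v \<in> tangent_space A p" "w \<in> tangent_space A p"
  shows "v +\<^sub>t w \<in> tangent_space A p"
  using assms by (auto simp: tangent_space_def algebra_simps)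

lemma tangent_space_tscale:
  assumes "v \<in> tangent_space A p"
  shows "a *\<^sub>t v \<in> tangent_space A p"
  using assms by (auto simp: tangent_space_def algebra_simps)

lemma tangent_space_tzero: "tzero \<in> tangent_space A p"
  by (auto simp: tangent_space_def)

lemma tminus_conv: "v -\<^sub>t w = v +\<^sub>t (- 1) *\<^sub>t w"
  by (auto simp: fun_eq_iff)

lemma tangent_space_tminus:
  assumes "v \<in> tangent_space A p" "w \<in> tangent_space A p"
  shows "v -\<^sub>t w \<in> tangent_space A p"
  unfolding tminus_conv by (intro tangent_space_tplus tangent_space_tscale assms)

lemma linear_form_tplus:
  assumes "linear_form A p L" "v \<in> tangent_space A p" "w \<in> tangent_space A p"
  shows "L (v +\<^sub>t w) = L v + L w"
proof -
  have "L (1 *\<^sub>t v +\<^sub>t 1 *\<^sub>t w) = 1 * L v + 1 * L w"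
    using assms unfolding linear_form_def by blast
  then show ?thesis by simp
qed

lemma linear_form_tscale:
  assumes "linear_form A p L" "v \<in> tangent_space A p"
  shows "L (a *\<^sub>t v) = a * L v"
proof -
  have "L (a *\<^sub>t v +\<^sub>t 0 *\<^sub>t v) = a * L v + 0 * L v"
    using assms unfolding linear_form_def by blast
  then show ?thesis by simp
qed

lemma linear_form_tzero: "linear_form A p L \<Longrightarrow> L tzero = 0"
  using linear_form_tscale[OF _ tangent_space_tzero, of A p L 0] by simp

lemma linear_form_tminus:
  assumes "linear_form A p L" "v \<in> tangent_space A p" "w \<in> tangent_space A p"
  shows "L (v -\<^sub>t w) = L v - L w"
  unfolding tminus_conv
  by (simp add: linear_form_tplus[OF assms(1)] linear_form_tscale[OF assms(1)] tangent_space_tscale assms)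

lemma linear_to_tangent_tplus:
  assumes "linear_to_tangent A p B q L" "v \<in> tangent_space A p" "w \<in> tangent_space A p"
  shows "L (v +\<^sub>t w) = L v +\<^sub>t L w"
proof -
  have "L (1 *\<^sub>t v +\<^sub>t 1 *\<^sub>t w) = 1 *\<^sub>t L v +\<^sub>t 1 *\<^sub>t L w"
    using assms unfolding linear_to_tangent_def by blast
  then show ?thesis by simp
qed

lemma linear_to_tangent_tscale:
  assumes "linear_to_tangent A p B q L" "v \<in> tangent_space A p"
  shows "L (a *\<^sub>t v) = a *\<^sub>t L v"
proof -
  have "L (a *\<^sub>t v +\<^sub>t 0 *\<^sub>t v) = a *\<^sub>t L v +\<^sub>t 0 *\<^sub>t L v"
    using assms unfolding linear_to_tangent_def by blast
  then show ?thesis by simp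
qed

lemma linear_to_tangent_in:
  "linear_to_tangent A p B q L \<Longrightarrow> v \<in> tangent_space A p \<Longrightarrow> L v \<in> tangent_space B q"
  unfolding linear_to_tangent_def by blast

lemma linear_to_tangent_tzero: "linear_to_tangent A p B q L \<Longrightarrow> L tzero = tzero"
  using linear_to_tangent_tscale[OF _ tangent_space_tzero, of A p B q L 0] by simp

lemma linear_to_tangent_tminus:
  assumes "linear_to_tangent A p B q L" "v \<in> tangent_space A p" "w \<in> tangent_space A p"
  shows "L (v -\<^sub>t w) = L v -\<^sub>t L w"
  unfolding tminus_conv
  by (simp add: linear_to_tangent_tplus[OF assms(1)] linear_to_tangent_tscale[OF assms(1)] tangent_space_tscale assms)

lemma vector_field_on_in: "vector_field_on A W X \<Longrightarrow> p \<in> W \<Longrightarrow> X p \<in> tangent_space A p"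
  by (simp add: vector_field_on_def)

lemma vector_field_on_apply:
  "vector_field_on A W X \<Longrightarrow> open V \<Longrightarrow> smooth_fun_on A V h \<Longrightarrow> smooth_fun_on A (W \<inter> V) (\<lambda>p. X p h)"
  by (simp add: vector_field_on_def)

lemma vector_field_on_subset:
  assumes "vector_field_on A W X" "W' \<subseteq> W"
  shows "vector_field_on A W' X"
  unfolding vector_field_on_def
proof (intro conjI ballI allI impI)
  show "X p \<in> tangent_space A p" if "p \<in> W'" for p
    using assms that by (auto simp: vector_field_on_def)
  show "smooth_fun_on A (W' \<inter> V) (\<lambda>p. X p h)" if "open V" "smooth_fun_on A V h" for V h
    by (rule smooth_fun_on_subset[OF vector_field_on_apply[OF assms(1) that]]) (use assms(2) in auto)
qed

context
  fixes A :: "('a::{t2_space, second_countable_topology}, 'e::euclidean_space) chart set"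
  assumes A: "smooth_atlas A"
begin

lemma vector_field_on_tplus:
  assumes "open W" "vector_field_on A W X" "vector_field_on A W Y"
  shows "vector_field_on A W (\<lambda>p. X p +\<^sub>t Y p)"
  using assms unfolding vector_field_on_def
  by (auto intro!: tangent_space_tplus smooth_fun_on_add[OF A])

lemma vector_field_on_tscale:
  assumes "open W" "smooth_fun_on A W h" "vector_field_on A W X"
  shows "vector_field_on A W (\<lambda>p. h p *\<^sub>t X p)"
  unfolding vector_field_on_def
proof (intro conjI ballI allI impI)
  show "h p *\<^sub>t X p \<in> tangent_space A p" if "p \<in> W" for p
    by (intro tangent_space_tscale vector_field_on_in[OF assms(3) that])
  show "smooth_fun_on A (W \<inter> V) (\<lambda>p. (h p *\<^sub>t X p) k)" if "open V" "smooth_fun_on A V k" for V k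
    using smooth_fun_on_mult[OF A, of "W \<inter> V" h "\<lambda>p. X p k"] vector_field_on_apply[OF assms(3) that]
      smooth_fun_on_subset[OF assms(2), of "W \<inter> V"] assms(1) that by (simp add: open_Int)
qed

lemma vector_field_on_cong:
  assumes "open W" "\<And>p. p \<in> W \<Longrightarrow> X p = Y p" "vector_field_on A W X"
  shows "vector_field_on A W Y"
  unfolding vector_field_on_def
proof (intro conjI ballI allI impI)
  show "Y p \<in> tangent_space A p" if "p \<in> W" for p
    using vector_field_on_in[OF assms(3) that] assms(2)[OF that] by simp
  show "smooth_fun_on A (W \<inter> V) (\<lambda>p. Y p h)" if "open V" "smooth_fun_on A V h" for V h
    by (rule smooth_fun_on_cong[OF A _ _ vector_field_on_apply[OF assms(3) that]]) (use assms that in auto)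
qed

lemma chart_has_derivative:
  assumes "(U, \<phi>) \<in> A" "p \<in> U" "smooth_near A p h"
  shows "(h \<circ> inv_into U \<phi> has_derivative frechet_derivative (h \<circ> inv_into U \<phi>) (at (\<phi> p))) (at (\<phi> p))"
proof -
  obtain W where "open W" "p \<in> W" "smooth_fun_on A W h"
    using assms(3) unfolding smooth_near_def by blast
  then show ?thesis
    using smooth_on_has_derivative[OF smooth_fun_onD[of A W h U \<phi>], of "\<phi> p"] assms by auto
qed

lemma coord_field_eq:
  assumes "(U, \<phi>) \<in> A" "p \<in> U" "smooth_near A p h"
    and "(h \<circ> inv_into U \<phi> has_derivative D) (at (\<phi> p))"
  shows "coord_field A (U, \<phi>) u p h = D u"
  using assms frechet_derivative_at[OF assms(4)] by (simp add: coord_field_def)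

lemma coord_field_tangent:
  assumes U: "(U, \<phi>) \<in> A" "p \<in> U"
  shows "coord_field A (U, \<phi>) u p \<in> tangent_space A p"
proof -
  have i: "inv_into U \<phi> (\<phi> p) = p" using smooth_atlas_chart(6)[OF A U] .
  note d = chart_has_derivative[OF U]
  show ?thesis
    unfolding tangent_space_def
  proof (clarify, intro conjI allI impI)
    fix h k assume h: "smooth_near A p h" and k: "smooth_near A p k"
    have "(((\<lambda>x. h x + k x) \<circ> inv_into U \<phi>) has_derivative
        (\<lambda>v. frechet_derivative (h \<circ> inv_into U \<phi>) (at (\<phi> p)) v + frechet_derivative (k \<circ> inv_into U \<phi>) (at (\<phi> p)) v)) (at (\<phi> p))"
      using has_derivative_add[OF d[OF h] d[OF k]] by (simp add: o_def)
    from coord_field_eq[OF U smooth_near_add[OF A h k] this] coord_field_eq[OF U h d[OF h]] coord_field_eq[OF U k d[OF k]]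
    show "coord_field A (U, \<phi>) u p (\<lambda>x. h x + k x) = coord_field A (U, \<phi>) u p h + coord_field A (U, \<phi>) u p k"
      by simp
    have "(((\<lambda>x. h x * k x) \<circ> inv_into U \<phi>) has_derivative
        (\<lambda>v. h p * frechet_derivative (k \<circ> inv_into U \<phi>) (at (\<phi> p)) v + frechet_derivative (h \<circ> inv_into U \<phi>) (at (\<phi> p)) v * k p)) (at (\<phi> p))"
      using has_derivative_mult[OF d[OF h] d[OF k]] by (simp add: o_def i)
    from coord_field_eq[OF U smooth_near_mult[OF A h k] this] coord_field_eq[OF U h d[OF h]] coord_field_eq[OF U k d[OF k]]
    show "coord_field A (U, \<phi>) u p (\<lambda>x. h x * k x) = h p * coord_field A (U, \<phi>) u p k + k p * coord_field A (U, \<phi>) u p h"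
      by simp
  next
    fix a h assume h: "smooth_near A p h"
    have "(((\<lambda>x. a * h x) \<circ> inv_into U \<phi>) has_derivative
        (\<lambda>v. a * frechet_derivative (h \<circ> inv_into U \<phi>) (at (\<phi> p)) v)) (at (\<phi> p))"
      using has_derivative_mult_right[OF d[OF h]] by (simp add: o_def)
    from coord_field_eq[OF U smooth_near_mult[OF A smooth_near_const[OF A] h] this] coord_field_eq[OF U h d[OF h]]
    show "coord_field A (U, \<phi>) u p (\<lambda>x. a * h x) = a * coord_field A (U, \<phi>) u p h"
      by simp
  qed (simp add: coord_field_def)
qed

lemma coord_field_vector_field:
  assumes U: "(U, \<phi>) \<in> A"
  shows "vector_field_on A U (coord_field A (U, \<phi>) u)"
  unfolding vector_field_on_def
proof (intro conjI ballI allI impI)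
  show "coord_field A (U, \<phi>) u p \<in> tangent_space A p" if "p \<in> U" for p
    by (rule coord_field_tangent[OF U that])
  show "smooth_fun_on A (U \<inter> V) (\<lambda>p. coord_field A (U, \<phi>) u p h)" if V: "open V" "smooth_fun_on A V h" for V h
    by (rule smooth_fun_on_cong[OF A _ _ smooth_fun_on_chart_derivative[OF A U V]])
      (use V smooth_atlas_chart[OF A U] smooth_nearI[OF A V(1) _ V(2)] in \<open>auto simp: coord_field_def\<close>)
qed

text \<open>Linearity gathers the sum of \<open>tangent_coordinates\<close> into one direction. The
  extension of vectors to fields, the lifts to products and the dimension count for curves all start
  from this normal form.\<close>

lemma tangent_eq_coord_field:
  assumes "v \<in> tangent_space A p" "(U, \<phi>) \<in> A" "p \<in> U"
  shows "v = coord_field A (U, \<phi>) (\<Sum>b\<in>Basis. v (\<lambda>x. \<phi> x \<bullet> b) *\<^sub>R b) p"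
proof
  fix h
  show "v h = coord_field A (U, \<phi>) (\<Sum>b\<in>Basis. v (\<lambda>x. \<phi> x \<bullet> b) *\<^sub>R b) p h"
  proof (cases "smooth_near A p h")
    case True
    have l: "linear (frechet_derivative (h \<circ> inv_into U \<phi>) (at (\<phi> p)))"
      using chart_has_derivative[OF assms(2,3) True] has_derivative_linear by blast
    show ?thesis
      using tangent_coordinates[OF A assms True] True
      by (simp add: coord_field_def linear_sum[OF l] linear_cmul[OF l])
  next
    case False
    then show ?thesis using tangent_not_smooth[OF A assms(1)] by (simp add: coord_field_def)
  qed
qed

lemma coord_field_coordinate:
  assumes U: "(U, \<phi>) \<in> A" "p \<in> U"
  shows "coord_field A (U, \<phi>) u p (\<lambda>x. \<phi> x \<bullet> b) = u \<bullet> b"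
proof (rule coord_field_eq[OF U])
  note c = smooth_atlas_chart[OF A U(1)]
  show "smooth_near A p (\<lambda>x. \<phi> x \<bullet> b)"
    by (rule smooth_nearI[OF A c(1) U(2) smooth_fun_on_coordinate[OF A U(1)]])
  have "((\<lambda>y. y \<bullet> b) has_derivative (\<lambda>u. u \<bullet> b)) (at (\<phi> p))"
    by (auto intro!: derivative_eq_intros)
  then show "((\<lambda>x. \<phi> x \<bullet> b) \<circ> inv_into U \<phi> has_derivative (\<lambda>u. u \<bullet> b)) (at (\<phi> p))"
    by (rule has_derivative_transform_within_open[OF _ c(2)]) (use U(2) c(6) in auto)
qed

text \<open>The extension keeps the chart components of v constant. It is wanted because the
  Kenmotsu identity is postulated for fields and has to be used for a single tangent vector.\<close>

lemma extend_tangent: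
  assumes "v \<in> tangent_space A p"
  obtains W X where "open W" "p \<in> W" "vector_field_on A W X" "X p = v"
proof -
  obtain U \<phi> where U: "(U, \<phi>) \<in> A" "p \<in> U" using smooth_atlas_cover[OF A] .
  show ?thesis
    by (rule that[OF smooth_atlas_chart(1)[OF A U(1)] U(2) coord_field_vector_field[OF U(1)]
          tangent_eq_coord_field[OF assms U, symmetric]])
qed

end

section \<open>Smooth maps and pushforward\<close>

lemma smooth_fun_on_smooth_map:
  assumes A: "smooth_atlas A" and B: "smooth_atlas B" and s: "smooth_map A B \<psi>"
    and V: "open V" and h: "smooth_fun_on B V h"
  shows "smooth_fun_on A (\<psi> -` V) (h \<circ> \<psi>)"
proof (rule smooth_fun_on_locally[OF A])
  fix p assume p: "p \<in> \<psi> -` V"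
  obtain U \<phi> where U: "(U, \<phi>) \<in> A" "p \<in> U" using smooth_atlas_cover[OF A] .
  obtain U' \<theta> where U': "(U', \<theta>) \<in> B" "\<psi> p \<in> U'" using smooth_atlas_cover[OF B] .
  note c = smooth_atlas_chart[OF A U(1)] and c' = smooth_atlas_chart[OF B U'(1)]
  \<comment> \<open>The points sent into both the target chart and V; the set is open by continuity,
    and on it h and \<psi> can be composed in coordinates.\<close>
  define W where "W = \<psi> -` (U' \<inter> V)"
  have "open W"
    using s V c'(1) unfolding W_def smooth_map_def by (intro open_vimage) auto
  then have op: "open (\<phi> ` (U \<inter> W))" "open (\<theta> ` (U' \<inter> V))" "open (U \<inter> W)"
    using smooth_atlas_open_image[OF A U(1)] smooth_atlas_open_image[OF B U'(1) V] c(1) by auto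
  have "smooth_on (\<phi> ` (U \<inter> \<psi> -` U')) (\<theta> \<circ> \<psi> \<circ> inv_into U \<phi>)"
    using s U U' unfolding smooth_map_def by fastforce
  then have s: "smooth_on (\<phi> ` (U \<inter> W)) (\<theta> \<circ> \<psi> \<circ> inv_into U \<phi>)"
    by (rule smooth_on_subset) (auto simp: W_def)
  have "smooth_on (\<phi> ` (U \<inter> W)) (\<lambda>y. (h \<circ> inv_into U' \<theta>) ((\<theta> \<circ> \<psi> \<circ> inv_into U \<phi>) y))"
    by (rule smooth_on_compose[OF op(1,2) _ s smooth_fun_onD[OF h U'(1)]]) (auto simp: c W_def)
  then have "smooth_on (\<phi> ` (U \<inter> W)) (h \<circ> \<psi> \<circ> inv_into U \<phi>)"
    by (rule smooth_on_cong[OF op(1), rotated]) (auto simp: c c' W_def)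
  then have "smooth_fun_on A (U \<inter> W) (h \<circ> \<psi>)"
    by (intro smooth_fun_on_chartI[OF A U(1) op(3)]) auto
  then show "\<exists>V. open V \<and> p \<in> V \<and> smooth_fun_on A V (h \<circ> \<psi>)"
    using op(3) p U U' by (auto simp: W_def)
qed

context
  fixes A :: "('a::{t2_space, second_countable_topology}, 'd::euclidean_space) chart set"
    and B :: "('b::{t2_space, second_countable_topology}, 'e::euclidean_space) chart set"
    and \<psi> :: "'a \<Rightarrow> 'b"
  assumes A: "smooth_atlas A" and B: "smooth_atlas B" and \<psi>: "smooth_map A B \<psi>"
begin

lemma smooth_map_open_vimage: "open V \<Longrightarrow> open (\<psi> -` V)"
  using \<psi> unfolding smooth_map_def by (intro open_vimage) auto

lemma smooth_near_smooth_map: "smooth_near B (\<psi> p) h \<Longrightarrow> smooth_near A p (h \<circ> \<psi>)"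
  using smooth_fun_on_smooth_map[OF A B \<psi>] smooth_map_open_vimage unfolding smooth_near_def
  by (metis vimageI2)

lemma push_tangent:
  assumes v: "v \<in> tangent_space A p"
  shows "push B \<psi> p v \<in> tangent_space B (\<psi> p)"
proof -
  note n = smooth_near_smooth_map
  show ?thesis
    unfolding tangent_space_def
  proof (clarify, intro conjI allI impI)
    fix h k assume h: "smooth_near B (\<psi> p) h" and k: "smooth_near B (\<psi> p) k"
    show "push B \<psi> p v (\<lambda>x. h x + k x) = push B \<psi> p v h + push B \<psi> p v k"
      using tangent_add[OF A v n[OF h] n[OF k]] h k smooth_near_add[OF B h k] by (simp add: push_def o_def)
    show "push B \<psi> p v (\<lambda>x. h x * k x) = h (\<psi> p) * push B \<psi> p v k + k (\<psi> p) * push B \<psi> p v h"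
      using tangent_mult[OF A v n[OF h] n[OF k]] h k smooth_near_mult[OF B h k] by (simp add: push_def o_def)
  next
    fix a h assume h: "smooth_near B (\<psi> p) h"
    show "push B \<psi> p v (\<lambda>x. a * h x) = a * push B \<psi> p v h"
      using tangent_cmult[OF A v n[OF h], of a] h smooth_near_mult[OF B smooth_near_const[OF B] h]
      by (simp add: push_def o_def)
  qed (simp add: push_def)
qed

lemma push_linear: "linear_to_tangent A p B (\<psi> p) (push B \<psi> p)"
  unfolding linear_to_tangent_def by (auto simp: push_tangent) (auto simp: push_def fun_eq_iff)

lemma field_along_on_push:
  assumes "open W" "vector_field_on A W X"
  shows "field_along_on A B \<psi> W (\<lambda>p. push B \<psi> p (X p))"
  unfolding field_along_on_def
proof (intro conjI ballI allI impI)
  show "push B \<psi> p (X p) \<in> tangent_space B (\<psi> p)" if "p \<in> W" for p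
    by (rule push_tangent[OF vector_field_on_in[OF assms(2) that]])
  fix V h assume V: "open V" "smooth_fun_on B V h"
  show "smooth_fun_on A (W \<inter> \<psi> -` V) (\<lambda>p. push B \<psi> p (X p) h)"
    by (rule smooth_fun_on_cong[OF A _ _ vector_field_on_apply[OF assms(2) smooth_map_open_vimage[OF V(1)] smooth_fun_on_smooth_map[OF A B \<psi> V]]])
      (use assms(1) smooth_map_open_vimage[OF V(1)] smooth_nearI[OF B V(1) _ V(2)] in \<open>auto simp: push_def\<close>)
qed

lemma field_along_on_compose:
  assumes "vector_field_on B UNIV Y"
  shows "field_along_on A B \<psi> UNIV (Y \<circ> \<psi>)"
  unfolding field_along_on_def
proof (intro conjI ballI allI impI)
  show "(Y \<circ> \<psi>) p \<in> tangent_space B (\<psi> p)" for p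
    using vector_field_on_in[OF assms] by simp
  fix V h assume V: "open V" "smooth_fun_on B V h"
  show "smooth_fun_on A (UNIV \<inter> \<psi> -` V) (\<lambda>p. (Y \<circ> \<psi>) p h)"
    using smooth_fun_on_smooth_map[OF A B \<psi> V(1), of "\<lambda>q. Y q h"] vector_field_on_apply[OF assms V]
    by (simp add: o_def)
qed

end

section \<open>Products\<close>

lemma inv_into_map_prod:
  assumes "inj_on \<phi> U" "inj_on \<theta> V" "x \<in> \<phi> ` U" "y \<in> \<theta> ` V"
  shows "inv_into (U \<times> V) (map_prod \<phi> \<theta>) (x, y) = (inv_into U \<phi> x, inv_into V \<theta> y)"
  by (rule inv_into_f_eq) (use assms in \<open>auto simp: map_prod_inj_on inv_into_into f_inv_into_f\<close>)

lemma map_prod_image_Times: "map_prod \<phi> \<theta> ` (U \<times> V) = \<phi> ` U \<times> \<theta> ` V"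
  by force

lemma prod_atlasE:
  assumes "(R, \<rho>) \<in> prod_atlas A B"
  obtains U \<phi> V \<theta> where "R = U \<times> V" "\<rho> = map_prod \<phi> \<theta>" "(U, \<phi>) \<in> A" "(V, \<theta>) \<in> B"
  using assms unfolding prod_atlas_def by blast

lemma prod_atlasI: "(U, \<phi>) \<in> A \<Longrightarrow> (V, \<theta>) \<in> B \<Longrightarrow> (U \<times> V, map_prod \<phi> \<theta>) \<in> prod_atlas A B"
  unfolding prod_atlas_def by blast

lemma smooth_atlas_transition:
  "smooth_atlas A \<Longrightarrow> (U, \<phi>) \<in> A \<Longrightarrow> (V, \<theta>) \<in> A \<Longrightarrow> smooth_on (\<phi> ` (U \<inter> V)) (\<theta> \<circ> inv_into U \<phi>)"
  unfolding smooth_atlas_def by fastforce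

lemma smooth_on_fst:
  fixes f :: "'a::euclidean_space \<Rightarrow> 'c::real_normed_vector"
  assumes "open S" "open (T :: 'b::euclidean_space set)" "smooth_on S f"
  shows "smooth_on (S \<times> T) (\<lambda>z. f (fst z))"
  using assms
  by (intro smooth_on_compose[OF _ assms(1) _ smooth_on_bounded_linear[OF bounded_linear_fst _ smooth_on_id]])
    (auto intro: open_Times)

lemma smooth_on_snd:
  fixes f :: "'b::euclidean_space \<Rightarrow> 'c::real_normed_vector"
  assumes "open (S :: 'a::euclidean_space set)" "open T" "smooth_on T f"
  shows "smooth_on (S \<times> T) (\<lambda>z. f (snd z))"
  using assms
  by (intro smooth_on_compose[OF _ assms(2) _ smooth_on_bounded_linear[OF bounded_linear_snd _ smooth_on_id]])
    (auto intro: open_Times)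

context
  fixes A :: "('a::{t2_space, second_countable_topology}, 'd::euclidean_space) chart set"
    and B :: "('b::{t2_space, second_countable_topology}, 'e::euclidean_space) chart set"
  assumes A: "smooth_atlas A" and B: "smooth_atlas B"
begin

lemma is_chart_prod:
  assumes U: "(U, \<phi>) \<in> A" and V: "(V, \<theta>) \<in> B"
  shows "is_chart (U \<times> V, map_prod \<phi> \<theta>)"
proof -
  note u = smooth_atlas_chart[OF A U] and v = smooth_atlas_chart[OF B V]
  have inv: "inv_into (U \<times> V) (map_prod \<phi> \<theta>) z = (inv_into U \<phi> (fst z), inv_into V \<theta> (snd z))"
    if "z \<in> \<phi> ` U \<times> \<theta> ` V" for z
    using inv_into_map_prod[OF u(3) v(3)] that by (cases z) auto
  have "continuous_on (\<phi> ` U \<times> \<theta> ` V) (\<lambda>z. (inv_into U \<phi> (fst z), inv_into V \<theta> (snd z)))"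
    by (intro continuous_intros continuous_on_compose2[OF u(5)] continuous_on_compose2[OF v(5)]) auto
  then have "continuous_on (\<phi> ` U \<times> \<theta> ` V) (inv_into (U \<times> V) (map_prod \<phi> \<theta>))"
    by (rule continuous_on_eq) (simp add: inv)
  moreover have "continuous_on (U \<times> V) (map_prod \<phi> \<theta>)"
    unfolding map_prod_def case_prod_beta
    by (intro continuous_intros continuous_on_compose2[OF u(4)] continuous_on_compose2[OF v(4)]) auto
  moreover have "inv_into (U \<times> V) (map_prod \<phi> \<theta>) ` (\<phi> ` U \<times> \<theta> ` V) = U \<times> V"
    using inv_into_image_cancel[OF map_prod_inj_on[OF u(3) v(3)] subset_refl] by (simp only: map_prod_image_Times)
  ultimately show ?thesis
    using u v unfolding is_chart_def homeomorphism_def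
    by (auto simp: map_prod_image_Times inv open_Times)
qed

lemma smooth_atlas_prod: "smooth_atlas (prod_atlas A B)"
  unfolding smooth_atlas_def
proof (intro conjI ballI; clarify?)
  fix R \<rho> assume "(R, \<rho>) \<in> prod_atlas A B"
  then show "is_chart (R, \<rho>)" by (auto elim!: prod_atlasE intro: is_chart_prod)
next
  have "\<exists>R\<in>prod_atlas A B. p \<in> fst R" for p
  proof -
    obtain U \<phi> where U: "(U, \<phi>) \<in> A" "fst p \<in> U" using smooth_atlas_cover[OF A] .
    obtain V \<theta> where V: "(V, \<theta>) \<in> B" "snd p \<in> V" using smooth_atlas_cover[OF B] .
    show ?thesis
      by (rule bexI[OF _ prod_atlasI[OF U(1) V(1)]]) (use U V in \<open>auto simp: mem_Times_iff\<close>)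
  qed
  then show "\<Union> (fst ` prod_atlas A B) = UNIV" by auto
next
  fix R \<rho> R' \<rho>' assume "(R, \<rho>) \<in> prod_atlas A B" "(R', \<rho>') \<in> prod_atlas A B"
  then obtain U \<phi> V \<theta> U' \<phi>' V' \<theta>' where
    R: "R = U \<times> V" "\<rho> = map_prod \<phi> \<theta>" "(U, \<phi>) \<in> A" "(V, \<theta>) \<in> B"
    and R': "R' = U' \<times> V'" "\<rho>' = map_prod \<phi>' \<theta>'" "(U', \<phi>') \<in> A" "(V', \<theta>') \<in> B"
    by (elim prod_atlasE)
  note u = smooth_atlas_chart[OF A R(3)] and v = smooth_atlas_chart[OF B R(4)]
  have op: "open (\<phi> ` (U \<inter> U'))" "open (\<theta> ` (V \<inter> V'))"
    using smooth_atlas_open_image[OF A R(3)] smooth_atlas_open_image[OF B R(4)]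
      smooth_atlas_chart(1)[OF A R'(3)] smooth_atlas_chart(1)[OF B R'(4)] by auto
  have "smooth_on (\<phi> ` (U \<inter> U') \<times> \<theta> ` (V \<inter> V'))
      (\<lambda>z. ((\<phi>' \<circ> inv_into U \<phi>) (fst z), (\<theta>' \<circ> inv_into V \<theta>) (snd z)))"
    by (intro smooth_on_Pair smooth_on_fst smooth_on_snd op open_Times
        smooth_atlas_transition[OF A R(3) R'(3)] smooth_atlas_transition[OF B R(4) R'(4)])
  then have "smooth_on (\<phi> ` (U \<inter> U') \<times> \<theta> ` (V \<inter> V')) (\<rho>' \<circ> inv_into R \<rho>)"
    by (rule smooth_on_cong[rotated 2])
      (auto simp: op open_Times R R' inv_into_map_prod[OF u(3) v(3)] u(6) v(6))
  moreover have "\<rho> ` (R \<inter> R') = \<phi> ` (U \<inter> U') \<times> \<theta> ` (V \<inter> V')"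
    by (simp add: R R' Times_Int_Times map_prod_image_Times)
  ultimately show "smooth_on (\<rho> ` (R \<inter> R')) (\<rho>' \<circ> inv_into R \<rho>)" by simp
qed

lemma smooth_map_fst: "smooth_map (prod_atlas A B) A fst"
  unfolding smooth_map_def
proof (intro conjI ballI; clarify?)
  show "continuous_on UNIV fst" by (intro continuous_intros)
  fix R \<rho> U' \<phi>' assume "(R, \<rho>) \<in> prod_atlas A B" and U': "(U', \<phi>') \<in> A"
  then obtain U \<phi> V \<theta> where R: "R = U \<times> V" "\<rho> = map_prod \<phi> \<theta>" "(U, \<phi>) \<in> A" "(V, \<theta>) \<in> B"
    by (elim prod_atlasE)
  note u = smooth_atlas_chart[OF A R(3)] and v = smooth_atlas_chart[OF B R(4)]
  have op: "open (\<phi> ` (U \<inter> U'))" "open (\<theta> ` V)"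
    using smooth_atlas_open_image[OF A R(3)] v smooth_atlas_chart(1)[OF A U'] by auto
  have "smooth_on (\<phi> ` (U \<inter> U') \<times> \<theta> ` V) (\<lambda>z. (\<phi>' \<circ> inv_into U \<phi>) (fst z))"
    by (intro smooth_on_fst op smooth_atlas_transition[OF A R(3) U'])
  then have "smooth_on (\<phi> ` (U \<inter> U') \<times> \<theta> ` V) (\<phi>' \<circ> fst \<circ> inv_into R \<rho>)"
    by (rule smooth_on_cong[rotated 2])
      (auto simp: op open_Times R inv_into_map_prod[OF u(3) v(3)])
  moreover have "R \<inter> fst -` U' = (U \<inter> U') \<times> V" using R(1) by auto
  ultimately show "smooth_on (\<rho> ` (R \<inter> fst -` U')) (\<phi>' \<circ> fst \<circ> inv_into R \<rho>)"
    by (simp add: R(2) map_prod_image_Times)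
qed

lemma smooth_map_snd: "smooth_map (prod_atlas A B) B snd"
  unfolding smooth_map_def
proof (intro conjI ballI; clarify?)
  show "continuous_on UNIV snd" by (intro continuous_intros)
  fix R \<rho> V' \<theta>' assume "(R, \<rho>) \<in> prod_atlas A B" and V': "(V', \<theta>') \<in> B"
  then obtain U \<phi> V \<theta> where R: "R = U \<times> V" "\<rho> = map_prod \<phi> \<theta>" "(U, \<phi>) \<in> A" "(V, \<theta>) \<in> B"
    by (elim prod_atlasE)
  note u = smooth_atlas_chart[OF A R(3)] and v = smooth_atlas_chart[OF B R(4)]
  have op: "open (\<phi> ` U)" "open (\<theta> ` (V \<inter> V'))"
    using smooth_atlas_open_image[OF B R(4)] u smooth_atlas_chart(1)[OF B V'] by auto
  have "smooth_on (\<phi> ` U \<times> \<theta> ` (V \<inter> V')) (\<lambda>z. (\<theta>' \<circ> inv_into V \<theta>) (snd z))"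
    by (intro smooth_on_snd op smooth_atlas_transition[OF B R(4) V'])
  then have "smooth_on (\<phi> ` U \<times> \<theta> ` (V \<inter> V')) (\<theta>' \<circ> snd \<circ> inv_into R \<rho>)"
    by (rule smooth_on_cong[rotated 2])
      (auto simp: op open_Times R inv_into_map_prod[OF u(3) v(3)])
  moreover have "R \<inter> snd -` V' = U \<times> (V \<inter> V')" using R(1) by auto
  ultimately show "smooth_on (\<rho> ` (R \<inter> snd -` V')) (\<theta>' \<circ> snd \<circ> inv_into R \<rho>)"
    by (simp add: R(2) map_prod_image_Times)
qed

context
  fixes U \<phi> V \<theta>
  assumes U: "(U, \<phi>) \<in> A" and V: "(V, \<theta>) \<in> B"
begin

text \<open>In the product chart \<open>h \<circ> fst\<close> is the coordinate form of h preceded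
  by the projection of the model spaces, so its derivative sees only the component u of the
  direction.\<close>

lemma push_fst_coord_field:
  assumes p: "p \<in> U \<times> V"
  shows "push A fst p (coord_field (prod_atlas A B) (U \<times> V, map_prod \<phi> \<theta>) (u, w) p) = coord_field A (U, \<phi>) u (fst p)"
proof
  fix h
  note u = smooth_atlas_chart[OF A U] and v = smooth_atlas_chart[OF B V]
  show "push A fst p (coord_field (prod_atlas A B) (U \<times> V, map_prod \<phi> \<theta>) (u, w) p) h = coord_field A (U, \<phi>) u (fst p) h"
  proof (cases "smooth_near A (fst p) h")
    case h: True
    let ?D = "frechet_derivative (h \<circ> inv_into U \<phi>) (at (\<phi> (fst p)))"
    have d: "(h \<circ> inv_into U \<phi> has_derivative ?D) (at (\<phi> (fst p)))"
      using p by (intro chart_has_derivative[OF A U _ h]) auto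
    have "(((h \<circ> inv_into U \<phi>) \<circ> fst) has_derivative ?D \<circ> fst) (at (map_prod \<phi> \<theta> p))"
      by (rule diff_chain_at) (use d p in \<open>auto intro!: derivative_eq_intros\<close>)
    then have "((h \<circ> fst) \<circ> inv_into (U \<times> V) (map_prod \<phi> \<theta>) has_derivative ?D \<circ> fst) (at (map_prod \<phi> \<theta> p))"
      by (rule has_derivative_transform_within_open[of _ _ _ "UNIV" "\<phi> ` U \<times> \<theta> ` V"])
        (use p u(2) v(2) in \<open>auto simp: open_Times inv_into_map_prod[OF u(3) v(3)]\<close>)
    from coord_field_eq[OF smooth_atlas_prod prod_atlasI[OF U V] p smooth_near_smooth_map[OF smooth_atlas_prod A smooth_map_fst h] this]
      coord_field_eq[OF A U _ h d] p
    show ?thesis by (auto simp: push_def h)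
  qed (simp add: push_def coord_field_def)
qed

lemma push_snd_coord_field:
  assumes p: "p \<in> U \<times> V"
  shows "push B snd p (coord_field (prod_atlas A B) (U \<times> V, map_prod \<phi> \<theta>) (u, w) p) = coord_field B (V, \<theta>) w (snd p)"
proof
  fix h
  note u = smooth_atlas_chart[OF A U] and v = smooth_atlas_chart[OF B V]
  show "push B snd p (coord_field (prod_atlas A B) (U \<times> V, map_prod \<phi> \<theta>) (u, w) p) h = coord_field B (V, \<theta>) w (snd p) h"
  proof (cases "smooth_near B (snd p) h")
    case h: True
    let ?D = "frechet_derivative (h \<circ> inv_into V \<theta>) (at (\<theta> (snd p)))"
    have d: "(h \<circ> inv_into V \<theta> has_derivative ?D) (at (\<theta> (snd p)))"
      using p by (intro chart_has_derivative[OF B V _ h]) auto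
    have "(((h \<circ> inv_into V \<theta>) \<circ> snd) has_derivative ?D \<circ> snd) (at (map_prod \<phi> \<theta> p))"
      by (rule diff_chain_at) (use d p in \<open>auto intro!: derivative_eq_intros\<close>)
    then have "((h \<circ> snd) \<circ> inv_into (U \<times> V) (map_prod \<phi> \<theta>) has_derivative ?D \<circ> snd) (at (map_prod \<phi> \<theta> p))"
      by (rule has_derivative_transform_within_open[of _ _ _ "UNIV" "\<phi> ` U \<times> \<theta> ` V"])
        (use p u(2) v(2) in \<open>auto simp: open_Times inv_into_map_prod[OF u(3) v(3)]\<close>)
    from coord_field_eq[OF smooth_atlas_prod prod_atlasI[OF U V] p smooth_near_smooth_map[OF smooth_atlas_prod B smooth_map_snd h] this]
      coord_field_eq[OF B V _ h d] p
    show ?thesis by (auto simp: push_def h)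
  qed (simp add: push_def coord_field_def)
qed

end

end

context
  fixes A :: "('a::{t2_space, second_countable_topology}, 'e::euclidean_space) chart set" and U \<phi>
  assumes A: "smooth_atlas A" and U: "(U, \<phi>) \<in> A"
begin

lemma coord_field_linear:
  assumes "p \<in> U"
  shows "linear (\<lambda>u. coord_field A (U, \<phi>) u p h)"
proof (cases "smooth_near A p h")
  case True
  then show ?thesis
    using has_derivative_linear[OF chart_has_derivative[OF A U assms True]] by (simp add: coord_field_def)
next
  case False
  then show ?thesis by (simp add: coord_field_def linear_zero)
qed

text \<open>Here the direction varies from point to point. Expanding it in the basis gives a
  combination of coordinate fields of fixed direction with smooth coefficients.\<close>

lemma vector_field_on_coordinates:
  assumes W: "open W" "W \<subseteq> U" and w: "\<And>b. b \<in> Basis \<Longrightarrow> smooth_fun_on A W (\<lambda>p. w p \<bullet> b)"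
  shows "vector_field_on A W (\<lambda>p. coord_field A (U, \<phi>) (w p) p)"
  unfolding vector_field_on_def
proof (intro conjI ballI allI impI)
  show "coord_field A (U, \<phi>) (w p) p \<in> tangent_space A p" if "p \<in> W" for p
    using coord_field_tangent[OF A U] W that by blast
  fix V h assume V: "open V" "smooth_fun_on A V h"
  have op: "open (W \<inter> V)" using W V by blast
  have c: "smooth_fun_on A (W \<inter> V) (\<lambda>p. coord_field A (U, \<phi>) b p h)" for b
    by (rule smooth_fun_on_subset[OF vector_field_on_apply[OF coord_field_vector_field[OF A U] V]]) (use W in auto)
  have "smooth_fun_on A (W \<inter> V) (\<lambda>p. \<Sum>b\<in>Basis. (w p \<bullet> b) * coord_field A (U, \<phi>) b p h)"
    by (intro smooth_fun_on_sum[OF A op] smooth_fun_on_mult[OF A op] c smooth_fun_on_subset[OF w]) auto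
  then show "smooth_fun_on A (W \<inter> V) (\<lambda>p. coord_field A (U, \<phi>) (w p) p h)"
  proof (rule smooth_fun_on_cong[OF A op, rotated])
    fix p assume "p \<in> W \<inter> V"
    then have l: "linear (\<lambda>u. coord_field A (U, \<phi>) u p h)" using coord_field_linear W by blast
    have "coord_field A (U, \<phi>) (w p) p h = coord_field A (U, \<phi>) (\<Sum>b\<in>Basis. (w p \<bullet> b) *\<^sub>R b) p h"
      by (simp only: euclidean_representation)
    then show "(\<Sum>b\<in>Basis. (w p \<bullet> b) * coord_field A (U, \<phi>) b p h) = coord_field A (U, \<phi>) (w p) p h"
      by (simp add: linear_sum[OF l] linear_cmul[OF l])
  qed
qed

end

context
  fixes A :: "('a::{t2_space, second_countable_topology}, 'd::euclidean_space) chart set"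
    and B :: "('b::{t2_space, second_countable_topology}, 'e::euclidean_space) chart set"
    and U \<phi> V \<theta>
  assumes A: "smooth_atlas A" and B: "smooth_atlas B" and U: "(U, \<phi>) \<in> A" and V: "(V, \<theta>) \<in> B"
begin

text \<open>The chart components of X are padded by 0 in the directions of the second factor, and
  the pushforward rules for coordinate fields read off the two projections. The construction lives
  in one product chart, hence the domain W \<times> V.\<close>

lemma lift_fst:
  assumes W: "open W" "W \<subseteq> U" and X: "vector_field_on A W X"
  obtains X' where "vector_field_on (prod_atlas A B) (W \<times> V) X'"
    and "\<And>p. p \<in> W \<times> V \<Longrightarrow> push A fst p (X' p) = X (fst p)"
    and "\<And>p. p \<in> W \<times> V \<Longrightarrow> push B snd p (X' p) = tzero"
proof
  let ?x = "\<lambda>q. \<Sum>b\<in>Basis. X q (\<lambda>x. \<phi> x \<bullet> b) *\<^sub>R b"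
  let ?X = "\<lambda>p. coord_field (prod_atlas A B) (U \<times> V, map_prod \<phi> \<theta>) (?x (fst p), 0) p"
  have M: "smooth_atlas (prod_atlas A B)" by (rule smooth_atlas_prod[OF A B])
  have op: "open (W \<times> V)" using W(1) smooth_atlas_chart(1)[OF B V] by (rule open_Times)
  have "smooth_fun_on A (W \<inter> U) (\<lambda>q. X q (\<lambda>x. \<phi> x \<bullet> b))" for b
    by (rule vector_field_on_apply[OF X smooth_atlas_chart(1)[OF A U] smooth_fun_on_coordinate[OF A U]])
  then have "smooth_fun_on A W (\<lambda>q. X q (\<lambda>x. \<phi> x \<bullet> b))" for b
    using W(2) by (simp add: Int_absorb2)
  then have c: "smooth_fun_on (prod_atlas A B) (W \<times> V) (\<lambda>p. X (fst p) (\<lambda>x. \<phi> x \<bullet> b))" for b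
    using smooth_fun_on_smooth_map[OF M A smooth_map_fst[OF A B] W(1), of "\<lambda>q. X q (\<lambda>x. \<phi> x \<bullet> b)"]
    by (auto simp: o_def elim!: smooth_fun_on_subset)
  show "vector_field_on (prod_atlas A B) (W \<times> V) ?X"
  proof (rule vector_field_on_coordinates[OF M prod_atlasI[OF U V] op])
    show "W \<times> V \<subseteq> U \<times> V" using W by auto
    have "smooth_fun_on (prod_atlas A B) (W \<times> V) (\<lambda>p. \<Sum>b\<in>Basis. X (fst p) (\<lambda>x. \<phi> x \<bullet> b) * (b \<bullet> i))" for i
      by (intro smooth_fun_on_sum[OF M op] smooth_fun_on_mult[OF M op] c smooth_fun_on_const[OF M op])
    then show "smooth_fun_on (prod_atlas A B) (W \<times> V) (\<lambda>p. (?x (fst p), 0) \<bullet> i)" for i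
      by (simp add: inner_prod_def inner_sum_left)
  qed
  fix p assume p: "p \<in> W \<times> V"
  then have pU: "p \<in> U \<times> V" using W by auto
  show "push A fst p (?X p) = X (fst p)"
    unfolding push_fst_coord_field[OF A B U V pU]
    by (rule tangent_eq_coord_field[OF A _ U, symmetric]) (use vector_field_on_in[OF X] p W in auto)
  show "push B snd p (?X p) = tzero"
    unfolding push_snd_coord_field[OF A B U V pU]
    using linear_0[OF coord_field_linear[OF B V]] pU by (auto simp: fun_eq_iff)
qed

lemma lift_snd:
  assumes W: "open W" "W \<subseteq> V" and X: "vector_field_on B W X"
  obtains X' where "vector_field_on (prod_atlas A B) (U \<times> W) X'"
    and "\<And>p. p \<in> U \<times> W \<Longrightarrow> push A fst p (X' p) = tzero"
    and "\<And>p. p \<in> U \<times> W \<Longrightarrow> push B snd p (X' p) = X (snd p)"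
proof
  let ?x = "\<lambda>q. \<Sum>b\<in>Basis. X q (\<lambda>x. \<theta> x \<bullet> b) *\<^sub>R b"
  let ?X = "\<lambda>p. coord_field (prod_atlas A B) (U \<times> V, map_prod \<phi> \<theta>) (0, ?x (snd p)) p"
  have M: "smooth_atlas (prod_atlas A B)" by (rule smooth_atlas_prod[OF A B])
  have op: "open (U \<times> W)" using smooth_atlas_chart(1)[OF A U] W(1) by (rule open_Times)
  have "smooth_fun_on B (W \<inter> V) (\<lambda>q. X q (\<lambda>x. \<theta> x \<bullet> b))" for b
    by (rule vector_field_on_apply[OF X smooth_atlas_chart(1)[OF B V] smooth_fun_on_coordinate[OF B V]])
  then have "smooth_fun_on B W (\<lambda>q. X q (\<lambda>x. \<theta> x \<bullet> b))" for b
    using W(2) by (simp add: Int_absorb2)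
  then have c: "smooth_fun_on (prod_atlas A B) (U \<times> W) (\<lambda>p. X (snd p) (\<lambda>x. \<theta> x \<bullet> b))" for b
    using smooth_fun_on_smooth_map[OF M B smooth_map_snd[OF A B] W(1), of "\<lambda>q. X q (\<lambda>x. \<theta> x \<bullet> b)"]
    by (auto simp: o_def elim!: smooth_fun_on_subset)
  show "vector_field_on (prod_atlas A B) (U \<times> W) ?X"
  proof (rule vector_field_on_coordinates[OF M prod_atlasI[OF U V] op])
    show "U \<times> W \<subseteq> U \<times> V" using W by auto
    have "smooth_fun_on (prod_atlas A B) (U \<times> W) (\<lambda>p. \<Sum>b\<in>Basis. X (snd p) (\<lambda>x. \<theta> x \<bullet> b) * (b \<bullet> i))" for i
      by (intro smooth_fun_on_sum[OF M op] smooth_fun_on_mult[OF M op] c smooth_fun_on_const[OF M op])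
    then show "smooth_fun_on (prod_atlas A B) (U \<times> W) (\<lambda>p. (0, ?x (snd p)) \<bullet> i)" for i
      by (simp add: inner_prod_def inner_sum_left)
  qed
  fix p assume p: "p \<in> U \<times> W"
  then have pU: "p \<in> U \<times> V" using W by auto
  show "push A fst p (?X p) = tzero"
    unfolding push_fst_coord_field[OF A B U V pU]
    using linear_0[OF coord_field_linear[OF A U]] pU by (auto simp: fun_eq_iff)
  show "push B snd p (?X p) = X (snd p)"
    unfolding push_snd_coord_field[OF A B U V pU]
    by (rule tangent_eq_coord_field[OF B _ V, symmetric]) (use vector_field_on_in[OF X] p W in auto)
qed

end

section \<open>Riemannian metrics and the Levi-Civita connection\<close>

lemma riemannian_metricD:
  assumes "riemannian_metric A g"
  shows riemannian_linear_form: "v \<in> tangent_space A p \<Longrightarrow> linear_form A p (g p v)"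
    and riemannian_sym: "v \<in> tangent_space A p \<Longrightarrow> w \<in> tangent_space A p \<Longrightarrow> g p v w = g p w v"
    and riemannian_pos: "v \<in> tangent_space A p \<Longrightarrow> v \<noteq> tzero \<Longrightarrow> g p v v > 0"
    and riemannian_smooth: "open W \<Longrightarrow> vector_field_on A W X \<Longrightarrow> vector_field_on A W Y \<Longrightarrow>
      smooth_fun_on A W (\<lambda>p. g p (X p) (Y p))"
  using assms by (simp_all add: riemannian_metric_def)

lemma levi_civita_metric:
  assumes "levi_civita A g nab" "open W" "vector_field_on A W X" "vector_field_on A W Y" "p \<in> W" "v \<in> tangent_space A p"
  shows "v (\<lambda>q. g q (X q) (Y q)) = g p (nab p v X) (Y p) + g p (X p) (nab p v Y)"
  by (rule assms(1)[unfolded levi_civita_def, THEN conjunct2, rule_format, OF assms(2-5), THEN conjunct1,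
        rule_format, OF assms(6)])

lemma levi_civita_torsion_free:
  assumes "levi_civita A g nab" "open W" "vector_field_on A W X" "vector_field_on A W Y" "p \<in> W"
  shows "nab p (X p) Y -\<^sub>t nab p (Y p) X = lie_bracket A X Y p"
  by (rule assms(1)[unfolded levi_civita_def, THEN conjunct2, rule_format, OF assms(2-5), THEN conjunct2])

lemma levi_civita_in:
  assumes "levi_civita A g nab" "open W" "vector_field_on A W Y" "p \<in> W" "v \<in> tangent_space A p"
  shows "nab p v Y \<in> tangent_space A p"
proof -
  have "linear_to_tangent A p A p (\<lambda>v. nab p v Y)"
    by (rule assms(1)[unfolded levi_civita_def, THEN conjunct1, unfolded affine_connection_def, rule_format,
          OF assms(2,3), THEN conjunct1, rule_format, OF assms(4)])
  then show ?thesis using assms(5) by (rule linear_to_tangent_in)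
qed

lemma levi_civita_scale:
  assumes "levi_civita A g nab" "open W" "vector_field_on A W Y" "smooth_fun_on A W h" "p \<in> W" "v \<in> tangent_space A p"
  shows "nab p v (\<lambda>q. h q *\<^sub>t Y q) = v h *\<^sub>t Y p +\<^sub>t h p *\<^sub>t nab p v Y"
  by (rule assms(1)[unfolded levi_civita_def, THEN conjunct1, unfolded affine_connection_def, rule_format,
        OF assms(2,3), THEN conjunct2, THEN conjunct2, THEN conjunct1, rule_format, OF assms(4-6)])

section \<open>One-dimensional Riemannian manifolds\<close>

context
  fixes A :: "('a::{t2_space, second_countable_topology}, 'e::euclidean_space) chart set"
  assumes A: "smooth_atlas A" and dim: "DIM('e) = 1"
begin

text \<open>Relative to a single basis vector, v and w are both multiples of the same coordinate
  vector; the component of v is nonzero because v is, and a is the quotient of the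
  components.\<close>

lemma tangent_space_one_dim:
  assumes v: "v \<in> tangent_space A p" "v \<noteq> tzero" and w: "w \<in> tangent_space A p"
  obtains a where "w = a *\<^sub>t v"
proof -
  obtain U \<phi> where U: "(U, \<phi>) \<in> A" "p \<in> U" using smooth_atlas_cover[OF A] .
  obtain b :: 'e where b: "Basis = {b}" using dim card_1_singletonE by blast
  note l = coord_field_linear[OF A U]
  let ?c = "\<lambda>v. v (\<lambda>x. \<phi> x \<bullet> b)"
  have eq: "v h = ?c v * coord_field A (U, \<phi>) b p h" if "v \<in> tangent_space A p" for v h
    using fun_cong[OF tangent_eq_coord_field[OF A that U], of h] linear_cmul[OF l[of h]] by (simp add: b)
  have "?c v \<noteq> 0"
  proof
    assume "?c v = 0"
    then have "v h = tzero h" for h using eq[OF v(1), of h] by simp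
    then show False using v(2) by blast
  qed
  then have "w h = ((?c w / ?c v) *\<^sub>t v) h" for h
    using eq[OF v(1), of h] eq[OF w, of h] by simp
  then show ?thesis using that by blast
qed

context
  fixes g :: "'a metric"
  assumes g: "riemannian_metric A g"
begin

text \<open>A coordinate field in a basis direction has the value 1 on its own coordinate function,
  so it vanishes nowhere on the chart domain and may be divided by its smooth positive
  length.\<close>

lemma unit_field_exists:
  obtains W E where "open W" "p \<in> W" "vector_field_on A W E" "\<And>q. q \<in> W \<Longrightarrow> g q (E q) (E q) = 1"
proof -
  obtain U \<phi> where U: "(U, \<phi>) \<in> A" "p \<in> U" using smooth_atlas_cover[OF A] .
  obtain b :: 'e where b: "b \<in> Basis" using nonempty_Basis by blast
  define X where "X = coord_field A (U, \<phi>) b"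
  have U_open: "open U" by (rule smooth_atlas_chart(1)[OF A U(1)])
  have X: "vector_field_on A U X" unfolding X_def by (rule coord_field_vector_field[OF A U(1)])
  have t: "X q \<in> tangent_space A q" if "q \<in> U" for q by (rule vector_field_on_in[OF X that])
  have pos: "g q (X q) (X q) > 0" if "q \<in> U" for q
  proof (rule riemannian_pos[OF g t[OF that]])
    have "X q (\<lambda>x. \<phi> x \<bullet> b) = 1"
      unfolding X_def using coord_field_coordinate[OF A U(1) that, of b b] b by simp
    then show "X q \<noteq> tzero" by auto
  qed
  let ?r = "\<lambda>q. inverse (sqrt (g q (X q) (X q)))"
  have "smooth_fun_on A U ?r"
    by (rule smooth_fun_on_inverse_sqrt[OF A U_open riemannian_smooth[OF g U_open X X] pos])
  then have "vector_field_on A U (\<lambda>q. ?r q *\<^sub>t X q)"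
    by (rule vector_field_on_tscale[OF A U_open _ X])
  moreover have "g q (?r q *\<^sub>t X q) (?r q *\<^sub>t X q) = 1" if "q \<in> U" for q
  proof -
    note tq = t[OF that] and l = linear_form_tscale[OF riemannian_linear_form[OF g]]
    have "g q (?r q *\<^sub>t X q) (?r q *\<^sub>t X q) = ?r q * (?r q * g q (X q) (X q))"
      using l[OF tangent_space_tscale[OF tq] tq] riemannian_sym[OF g tangent_space_tscale[OF tq] tq] l[OF tq tq] by simp
    then show ?thesis using pos[OF that] by (simp add: field_simps)
  qed
  ultimately show ?thesis using that[OF U_open U(2)] by blast
qed

text \<open>In dimension one the only index is 0, and the spanning clause follows from
  \<open>tangent_space_one_dim\<close> because a unit vector is nonzero.\<close>

lemma orthonormal_frame_on_iff:
  "orthonormal_frame_on A g W E \<longleftrightarrow> vector_field_on A W (E 0) \<and> (\<forall>q\<in>W. g q (E 0 q) (E 0 q) = 1)"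
proof -
  have "\<exists>a. v = (\<lambda>h. a 0 * E 0 q h)"
    if E: "vector_field_on A W (E 0)" "\<forall>q\<in>W. g q (E 0 q) (E 0 q) = 1" and q: "q \<in> W"
      and v: "v \<in> tangent_space A q" for q v
  proof -
    have t: "E 0 q \<in> tangent_space A q" using E q by (simp add: vector_field_on_in)
    have "E 0 q \<noteq> tzero"
      using linear_form_tzero[OF riemannian_linear_form[OF g t]] E(2) q by auto
    then obtain a where "v = a *\<^sub>t E 0 q" using tangent_space_one_dim[OF t _ v] by blast
    then show ?thesis by (intro exI[of _ "\<lambda>i. a"]) (simp add: tscale_def)
  qed
  then show ?thesis unfolding orthonormal_frame_on_def dim by auto
qed

text \<open>\<open>laplacian\<close> picks its frame by \<open>SOME\<close>, so the field T handed
  out is whichever frame was picked at p, and \<open>unit_field_exists\<close> ensures that there is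
  one to pick. Differentiating g(T, T) = 1 makes nabla_T T orthogonal to T, hence zero on a curve,
  and of the summand only - T (T h) is left.\<close>

lemma laplacian_one_dim:
  assumes nab: "levi_civita A g nab"
  obtains W T where "open W" "p \<in> W" "vector_field_on A W T" "\<And>q. q \<in> W \<Longrightarrow> g q (T q) (T q) = 1"
    and "\<And>h. laplacian A g nab h p = - T p (\<lambda>q. T q h)"
proof -
  define E where "E = (SOME E. \<exists>W. open W \<and> p \<in> W \<and> orthonormal_frame_on A g W E)"
  obtain W0 E0 where "open W0" "p \<in> W0" "vector_field_on A W0 E0" "\<And>q. q \<in> W0 \<Longrightarrow> g q (E0 q) (E0 q) = 1"
    using unit_field_exists[of p] by blast
  then have "\<exists>W. open W \<and> p \<in> W \<and> orthonormal_frame_on A g W (\<lambda>i. E0)"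
    unfolding orthonormal_frame_on_iff by blast
  then have "\<exists>E W. open W \<and> p \<in> W \<and> orthonormal_frame_on A g W E" by blast
  then have "\<exists>W. open W \<and> p \<in> W \<and> orthonormal_frame_on A g W E"
    unfolding E_def by (rule someI_ex)
  then obtain W where W: "open W" "p \<in> W" "vector_field_on A W (E 0)"
    and unit: "\<And>q. q \<in> W \<Longrightarrow> g q (E 0 q) (E 0 q) = 1"
    unfolding orthonormal_frame_on_iff by blast
  have t: "E 0 p \<in> tangent_space A p" by (rule vector_field_on_in[OF W(3,2)])
  let ?n = "nab p (E 0 p) (E 0)"
  have n: "?n \<in> tangent_space A p" by (rule levi_civita_in[OF nab W(1,3,2) t])
  have "E 0 p \<noteq> tzero"
    using linear_form_tzero[OF riemannian_linear_form[OF g t]] unit[OF W(2)] by auto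
  then obtain a where a: "?n = a *\<^sub>t E 0 p" using tangent_space_one_dim[OF t _ n] by blast
  have "E 0 p (\<lambda>q. g q (E 0 q) (E 0 q)) = E 0 p (\<lambda>q. 1)"
    by (rule tangent_local[OF A t W(1,2) unit])
  then have "g p ?n (E 0 p) + g p (E 0 p) ?n = 0"
    using levi_civita_metric[OF nab W(1,3,3,2) t] tangent_const[OF A t] by simp
  then have "g p (E 0 p) ?n = 0" using riemannian_sym[OF g n t] by simp
  then have "a = 0"
    using linear_form_tscale[OF riemannian_linear_form[OF g t] t] unit[OF W(2)] by (simp add: a)
  then have "laplacian A g nab h p = - E 0 p (\<lambda>q. E 0 q h)" for h
    unfolding laplacian_def E_def[symmetric] dim using a by simp
  then show ?thesis using that W unit by blast
qed

end

end

section \<open>The structure vector field of a Kenmotsu manifold\<close>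

context
  fixes A :: "('n::{t2_space, second_countable_topology}, 'e::euclidean_space) chart set"
    and \<phi> \<xi> \<eta> g nab
  assumes K: "kenmotsu A \<phi> \<xi> \<eta> g nab"
begin

lemma kenmotsu_almost_contact: "almost_contact_metric A \<phi> \<xi> \<eta> g"
  and kenmotsu_levi_civita: "levi_civita A g nab"
  using K by (simp_all add: kenmotsu_def)

lemma kenmotsu_smooth_atlas: "smooth_atlas A"
  and kenmotsu_metric: "riemannian_metric A g"
  and kenmotsu_xi_field: "vector_field_on A UNIV \<xi>"
  and kenmotsu_phi_linear: "linear_to_tangent A q A q (\<phi> q)"
  and kenmotsu_eta_linear: "linear_form A q (\<eta> q)"
  and kenmotsu_eta_xi: "\<eta> q (\<xi> q) = 1"
  using kenmotsu_almost_contact by (simp_all add: almost_contact_metric_def riemannian_manifold_def)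

lemma kenmotsu_phi_phi: "v \<in> tangent_space A q \<Longrightarrow> \<phi> q (\<phi> q v) = \<eta> q v *\<^sub>t \<xi> q -\<^sub>t v"
  and kenmotsu_metric_phi: "v \<in> tangent_space A q \<Longrightarrow> w \<in> tangent_space A q \<Longrightarrow>
    g q (\<phi> q v) (\<phi> q w) = g q v w - \<eta> q v * \<eta> q w"
  using kenmotsu_almost_contact by (simp_all add: almost_contact_metric_def)

lemma kenmotsu_xi_in: "\<xi> q \<in> tangent_space A q"
  by (rule vector_field_on_in[OF kenmotsu_xi_field UNIV_I])

text \<open>Let z = phi xi. Then phi z = eta(xi) xi - xi = 0, and applying the formula for phi^2 to
  z gives z = eta(z) xi. One more phi yields 0 = phi z = eta(z) z. So either z = 0 at once, or
  eta(z) = 0 and z = eta(z) xi = 0.\<close>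

lemma kenmotsu_phi_xi: "\<phi> q (\<xi> q) = tzero"
proof -
  note l = kenmotsu_phi_linear[of q]
  let ?z = "\<phi> q (\<xi> q)"
  have z: "?z \<in> tangent_space A q" by (rule linear_to_tangent_in[OF l kenmotsu_xi_in])
  have 1: "\<phi> q ?z = tzero"
    using kenmotsu_phi_phi[OF kenmotsu_xi_in, of q] kenmotsu_eta_xi[of q] by (simp add: fun_eq_iff)
  have 2: "?z = \<eta> q ?z *\<^sub>t \<xi> q"
    using kenmotsu_phi_phi[OF z] 1 linear_to_tangent_tzero[OF l] by (simp add: fun_eq_iff)
  have "\<eta> q ?z *\<^sub>t ?z = \<phi> q (\<eta> q ?z *\<^sub>t \<xi> q)"
    by (rule linear_to_tangent_tscale[OF l kenmotsu_xi_in, symmetric])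
  also have "\<dots> = \<phi> q ?z" by (rule arg_cong[OF 2[symmetric]])
  finally have 3: "\<eta> q ?z *\<^sub>t ?z = tzero" unfolding 1 .
  show ?thesis
  proof (cases "\<eta> q ?z = 0")
    case True
    then show ?thesis using 2[unfolded True] by simp
  next
    case False
    then show ?thesis using 3 by (simp add: fun_eq_iff)
  qed
qed

text \<open>Reading phi^3 v as phi^2 applied to phi v and as phi applied to phi^2 v, with phi xi =
  0, leaves eta(phi v) xi = 0; then \<eta> is applied.\<close>

lemma kenmotsu_eta_phi:
  assumes v: "v \<in> tangent_space A q"
  shows "\<eta> q (\<phi> q v) = 0"
proof -
  note l = kenmotsu_phi_linear[of q]
  have pv: "\<phi> q v \<in> tangent_space A q" by (rule linear_to_tangent_in[OF l v])
  have "\<phi> q (\<phi> q (\<phi> q v)) = \<phi> q (\<eta> q v *\<^sub>t \<xi> q -\<^sub>t v)" by (simp add: kenmotsu_phi_phi[OF v])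
  also have "\<dots> = \<eta> q v *\<^sub>t \<phi> q (\<xi> q) -\<^sub>t \<phi> q v"
    by (simp add: linear_to_tangent_tminus[OF l tangent_space_tscale v] linear_to_tangent_tscale[OF l] kenmotsu_xi_in)
  finally have "\<eta> q (\<phi> q v) *\<^sub>t \<xi> q = tzero"
    using kenmotsu_phi_phi[OF pv] by (simp add: kenmotsu_phi_xi fun_eq_iff)
  then show ?thesis
    using linear_form_tscale[OF kenmotsu_eta_linear kenmotsu_xi_in, of q "\<eta> q (\<phi> q v)"]
      linear_form_tzero[OF kenmotsu_eta_linear, of q] kenmotsu_eta_xi[of q] by simp
qed

text \<open>Compatibility of the metric with phi, taken at w = xi, where phi xi = 0 makes the left
  side vanish.\<close>

lemma kenmotsu_metric_xi:
  assumes v: "v \<in> tangent_space A q"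
  shows "g q v (\<xi> q) = \<eta> q v"
  using kenmotsu_metric_phi[OF v kenmotsu_xi_in] kenmotsu_eta_xi[of q]
    linear_form_tzero[OF riemannian_linear_form[OF kenmotsu_metric linear_to_tangent_in[OF kenmotsu_phi_linear v]]]
  by (simp add: kenmotsu_phi_xi)

text \<open>The Kenmotsu identity with Y = xi reduces to phi (nabla_u xi) = phi u. Applying phi
  again fixes nabla_u xi up to a multiple of \<xi>, and g(xi, xi) = 1 fixes that multiple through
  eta(nabla_u xi) = 0.\<close>

lemma kenmotsu_nabla_xi:
  assumes u: "u \<in> tangent_space A q"
  shows "nab q u \<xi> = u -\<^sub>t \<eta> q u *\<^sub>t \<xi> q"
proof -
  let ?n = "nab q u \<xi>"
  note at = kenmotsu_smooth_atlas and L = kenmotsu_levi_civita and l = kenmotsu_phi_linear[of q]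
  have n: "?n \<in> tangent_space A q"
    by (rule levi_civita_in[OF L open_UNIV kenmotsu_xi_field UNIV_I u])
  have pu: "\<phi> q u \<in> tangent_space A q" by (rule linear_to_tangent_in[OF l u])
  obtain W X where X: "open W" "q \<in> W" "vector_field_on A W X" "X q = u"
    using extend_tangent[OF at u] .
  have "nab q (X q) (\<lambda>q. \<phi> q (\<xi> q)) -\<^sub>t \<phi> q (nab q (X q) \<xi>)
      = g q (\<phi> q (X q)) (\<xi> q) *\<^sub>t \<xi> q -\<^sub>t \<eta> q (\<xi> q) *\<^sub>t \<phi> q (X q)"
    using K[unfolded kenmotsu_def, THEN conjunct2, THEN conjunct2] X
      vector_field_on_subset[OF kenmotsu_xi_field subset_UNIV] by blast
  \<comment> \<open>The field phi xi is identically zero; writing it as 0 times \<xi>, the product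
    rule shows that its derivative is zero.\<close>
  moreover have "nab q u (\<lambda>q. \<phi> q (\<xi> q)) = tzero"
    using levi_civita_scale[OF L open_UNIV kenmotsu_xi_field smooth_fun_on_const[OF at open_UNIV, of 0] UNIV_I u]
      tangent_const[OF at u] by (simp add: kenmotsu_phi_xi)
  ultimately have "\<phi> q ?n = \<phi> q u"
    using X(4) kenmotsu_metric_xi[OF pu] kenmotsu_eta_phi[OF u] kenmotsu_eta_xi[of q] by (simp add: fun_eq_iff)
  then have "\<eta> q ?n *\<^sub>t \<xi> q -\<^sub>t ?n = \<eta> q u *\<^sub>t \<xi> q -\<^sub>t u"
    using kenmotsu_phi_phi[OF n] kenmotsu_phi_phi[OF u] by simp
  moreover have "\<eta> q ?n = 0"
  proof -
    have "(\<lambda>q. g q (\<xi> q) (\<xi> q)) = (\<lambda>q. 1)"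
      using kenmotsu_metric_xi[OF kenmotsu_xi_in] kenmotsu_eta_xi by simp
    then have "g q ?n (\<xi> q) + g q (\<xi> q) ?n = 0"
      using levi_civita_metric[OF L open_UNIV kenmotsu_xi_field kenmotsu_xi_field UNIV_I u] tangent_const[OF at u] by simp
    then show ?thesis
      using riemannian_sym[OF kenmotsu_metric n kenmotsu_xi_in] kenmotsu_metric_xi[OF n] by simp
  qed
  ultimately show ?thesis by (simp add: fun_eq_iff algebra_simps)
qed

end

section \<open>The differential system for the components of the structure vector field\<close>

text \<open>The integrability argument isolated from the geometry: F is the lifted warping function
  and b is the pairing of \<xi> with S. The four equations for a and b are assumed on a
  neighbourhood because they are differentiated once more, whereas the facts about F and k and the
  unit relation enter at p alone.\<close>

lemma warped_surface_ode:
  fixes A :: "('a::{t2_space, second_countable_topology}, 'e::euclidean_space) chart set"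
  assumes A: "smooth_atlas A" and W: "open W" "p \<in> W"
    and T: "T p \<in> tangent_space A p" and S: "S p \<in> tangent_space A p"
    and F: "smooth_near A p F" and k: "smooth_near A p k" and a: "smooth_near A p a" and b: "smooth_near A p b"
    and Fpos: "F p > 0" and TF: "T p F = F p * k p" and Sk: "S p k = 0"
    and Ta: "\<And>q. q \<in> W \<Longrightarrow> T q a = 1 - (a q)\<^sup>2"
    and Sa: "\<And>q. q \<in> W \<Longrightarrow> S q a = b q * (k q - a q)"
    and Tb: "\<And>q. q \<in> W \<Longrightarrow> T q b = b q * (k q - a q)"
    and Sb: "\<And>q. q \<in> W \<Longrightarrow> S q b = (F q)\<^sup>2 * (a q * (a q - k q))"
    and unit: "(F p)\<^sup>2 * (a p)\<^sup>2 + (b p)\<^sup>2 = (F p)\<^sup>2"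
    and TSa: "T p (\<lambda>q. S q a) = S p (\<lambda>q. T q a)" and TSb: "T p (\<lambda>q. S q b) = S p (\<lambda>q. T q b)"
  shows "T p k = 1 - (k p)\<^sup>2"
proof -
  note c = smooth_near_const[OF A] and n = smooth_near_mult[OF A] smooth_near_add[OF A] smooth_near_const[OF A] F k a b
  \<comment> \<open>The right-hand sides of the system, expanded once for an arbitrary derivation.
    Differences and squares are spelled as sums and products, to which the rules for derivations
    apply.\<close>
  have d: "v (\<lambda>q. b q * (k q + - 1 * a q)) = b p * (v k - v a) + (k p - a p) * v b"
    "v (\<lambda>q. 1 + - 1 * (a q * a q)) = - 2 * (a p * v a)"
    "v (\<lambda>q. F q * F q * (a q * (a q + - 1 * k q))) =
      (F p)\<^sup>2 * (a p * (v a - v k) + (a p - k p) * v a) + a p * (a p - k p) * (2 * F p * v F)"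
    if v: "v \<in> tangent_space A p" for v
    by (simp_all only: tangent_mult[OF A v] tangent_add[OF A v] tangent_cmult[OF A v] tangent_const[OF A v] n)
      (simp_all add: algebra_simps power2_eq_square)
  have "T p (\<lambda>q. S q a) = T p (\<lambda>q. b q * (k q + - 1 * a q))"
    by (rule tangent_local[OF A T W]) (simp add: Sa)
  moreover have "S p (\<lambda>q. T q a) = S p (\<lambda>q. 1 + - 1 * (a q * a q))"
    by (rule tangent_local[OF A S W]) (simp add: Ta power2_eq_square)
  ultimately have 1: "b p * (T p k - (1 - (a p)\<^sup>2)) + (k p - a p) * (b p * (k p - a p)) = - 2 * (a p * (b p * (k p - a p)))"
    using TSa d(1)[OF T] d(2)[OF S] Ta[OF W(2)] Tb[OF W(2)] Sa[OF W(2)] by simp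
  \<comment> \<open>In T S a = S T a all terms in a cancel, and the common factor b
    survives.\<close>
  have "b p * (T p k - (1 - (k p)\<^sup>2)) = 0"
    using 1 by (simp add: algebra_simps power2_eq_square)
  moreover have "T p (\<lambda>q. S q b) = T p (\<lambda>q. F q * F q * (a q * (a q + - 1 * k q)))"
    by (rule tangent_local[OF A T W]) (simp add: Sb power2_eq_square)
  moreover have "S p (\<lambda>q. T q b) = S p (\<lambda>q. b q * (k q + - 1 * a q))"
    by (rule tangent_local[OF A S W]) (simp add: Tb)
  ultimately have b0: "b p * (T p k - (1 - (k p)\<^sup>2)) = 0"
    and 2: "(F p)\<^sup>2 * (a p * ((1 - (a p)\<^sup>2) - T p k) + (a p - k p) * (1 - (a p)\<^sup>2)) + a p * (a p - k p) * (2 * F p * (F p * k p))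
      = b p * (0 - b p * (k p - a p)) + (k p - a p) * ((F p)\<^sup>2 * (a p * (a p - k p)))"
    using TSb d(1)[OF S] d(3)[OF T] Ta[OF W(2)] Sa[OF W(2)] Sb[OF W(2)] TF Sk by simp_all
  \<comment> \<open>In the equation from T S b = S T b the value of b occurs only squared. The unit
    relation trades the square for F and a, after which the equation carries the common factor F^2
    a.\<close>
  have "b p * (0 - b p * (k p - a p)) = - (b p)\<^sup>2 * (k p - a p)"
    by (simp add: power2_eq_square)
  also have "(b p)\<^sup>2 = (F p)\<^sup>2 - (F p)\<^sup>2 * (a p)\<^sup>2" using unit by simp
  finally have "b p * (0 - b p * (k p - a p)) = - ((F p)\<^sup>2 - (F p)\<^sup>2 * (a p)\<^sup>2) * (k p - a p)" .
  with 2 have "(F p)\<^sup>2 * (a p * (T p k - (1 - (k p)\<^sup>2))) = 0"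
    by (simp add: algebra_simps power2_eq_square)
  then have "a p * (T p k - (1 - (k p)\<^sup>2)) = 0" using Fpos by simp
  moreover have "a p \<noteq> 0 \<or> b p \<noteq> 0" using unit Fpos by auto
  ultimately show ?thesis using b0 by auto
qed

section \<open>Totally geodesic immersions tangent to the structure vector field\<close>

lemma isometric_immersion_smooth_map: "isometric_immersion A g B g' \<psi> \<Longrightarrow> smooth_map A B \<psi>"
  by (simp add: isometric_immersion_def)

lemma isometric_immersion_inj: "isometric_immersion A g B g' \<psi> \<Longrightarrow> inj_on (push B \<psi> p) (tangent_space A p)"
  by (simp add: isometric_immersion_def)

lemma isometric_immersion_eq:
  "isometric_immersion A g B g' \<psi> \<Longrightarrow> v \<in> tangent_space A p \<Longrightarrow> w \<in> tangent_space A p \<Longrightarrow>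
    g p v w = g' (\<psi> p) (push B \<psi> p v) (push B \<psi> p w)"
  by (simp add: isometric_immersion_def)

lemma pullback_connection_pulled:
  assumes "pullback_connection A B \<psi> nab D" "open V" "vector_field_on B V Y" "\<psi> p \<in> V" "v \<in> tangent_space A p"
  shows "D p v (Y \<circ> \<psi>) = nab (\<psi> p) (push B \<psi> p v) Y"
  by (rule assms(1)[unfolded pullback_connection_def, THEN conjunct2, rule_format, OF assms(2-5)])

lemma pullback_connection_field:
  assumes "pullback_connection A B \<psi> nab D" "open W" "field_along_on A B \<psi> W Z" "vector_field_on A W X"
  shows "field_along_on A B \<psi> W (\<lambda>p. D p (X p) Z)"
  by (rule assms(1)[unfolded pullback_connection_def, THEN conjunct1, rule_format, OF assms(2,3),
        THEN conjunct2, THEN conjunct2, THEN conjunct2, rule_format, OF assms(4)])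

lemma totally_geodesicD:
  assumes "totally_geodesic A B \<psi> nab D" "open W" "vector_field_on A W X" "vector_field_on A W Y" "p \<in> W"
  shows "D p (X p) (\<lambda>q. push B \<psi> q (Y q)) = push B \<psi> p (nab p (X p) Y)"
proof -
  have "D p (X p) (\<lambda>q. push B \<psi> q (Y q)) -\<^sub>t push B \<psi> p (nab p (X p) Y) = tzero"
    by (rule assms(1)[unfolded totally_geodesic_def second_fundamental_form_def, rule_format, OF assms(2-5)])
  then show ?thesis by (simp add: fun_eq_iff)
qed

lemma vector_field_on_tzero: "smooth_atlas A \<Longrightarrow> open W \<Longrightarrow> vector_field_on A W (\<lambda>q. tzero)"
  by (auto simp: vector_field_on_def tangent_space_tzero smooth_fun_on_const open_Int)

lemma field_along_on_subset:
  assumes "field_along_on A B \<psi> W Z" "W' \<subseteq> W"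
  shows "field_along_on A B \<psi> W' Z"
  unfolding field_along_on_def
proof (intro conjI ballI allI impI)
  show "Z p \<in> tangent_space B (\<psi> p)" if "p \<in> W'" for p
    using assms that by (auto simp: field_along_on_def)
  fix V h assume "open V" "smooth_fun_on B V h"
  then have "smooth_fun_on A (W \<inter> \<psi> -` V) (\<lambda>p. Z p h)"
    using assms(1) by (simp add: field_along_on_def)
  then show "smooth_fun_on A (W' \<inter> \<psi> -` V) (\<lambda>p. Z p h)"
    by (rule smooth_fun_on_subset) (use assms(2) in auto)
qed

lemma field_along_on_apply:
  "field_along_on A B \<psi> W Z \<Longrightarrow> open V \<Longrightarrow> smooth_fun_on B V h \<Longrightarrow> smooth_fun_on A (W \<inter> \<psi> -` V) (\<lambda>p. Z p h)"
  by (simp add: field_along_on_def)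

section \<open>Related fields, and metrics pulled back by an immersion\<close>

context
  fixes A :: "('a::{t2_space, second_countable_topology}, 'd::euclidean_space) chart set"
    and B :: "('b::{t2_space, second_countable_topology}, 'e::euclidean_space) chart set"
    and \<psi> :: "'a \<Rightarrow> 'b"
  assumes A: "smooth_atlas A" and B: "smooth_atlas B" and \<psi>: "smooth_map A B \<psi>"
begin

text \<open>Near q the inner function \<open>Y r (h \<circ> \<psi>)\<close> is the pullback of
  \<open>Y' b h\<close>, so X differentiates a pulled-back function, and this is how
  \<open>push\<close> acts. It is one of the two terms of a bracket of related fields.\<close>

lemma push_related_apply:
  assumes W: "open W" "q \<in> W" and V: "open V" "\<psi> ` W \<subseteq> V"
    and X: "X q \<in> tangent_space A q" "push B \<psi> q (X q) = X' (\<psi> q)"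
    and Y: "\<And>r. r \<in> W \<Longrightarrow> push B \<psi> r (Y r) = Y' (\<psi> r)" "vector_field_on B V Y'"
    and h: "smooth_near B (\<psi> q) h"
  shows "X q (\<lambda>r. Y r (h \<circ> \<psi>)) = X' (\<psi> q) (\<lambda>b. Y' b h)"
proof -
  obtain O' where O': "open O'" "\<psi> q \<in> O'" "smooth_fun_on B O' h"
    using h unfolding smooth_near_def by blast
  have "X q (\<lambda>r. Y r (h \<circ> \<psi>)) = X q ((\<lambda>b. Y' b h) \<circ> \<psi>)"
  proof (rule tangent_local[OF A X(1)])
    show "open (W \<inter> \<psi> -` O')" "q \<in> W \<inter> \<psi> -` O'"
      using W smooth_map_open_vimage[OF A B \<psi> O'(1)] O' by auto
    fix r assume "r \<in> W \<inter> \<psi> -` O'"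
    then show "Y r (h \<circ> \<psi>) = ((\<lambda>b. Y' b h) \<circ> \<psi>) r"
      using fun_cong[OF Y(1), of r h] smooth_nearI[OF B O'(1) _ O'(3)] by (simp add: push_def)
  qed
  also have "\<dots> = push B \<psi> q (X q) (\<lambda>b. Y' b h)"
  proof -
    have "smooth_near B (\<psi> q) (\<lambda>b. Y' b h)"
      by (rule smooth_nearI[OF B _ _ vector_field_on_apply[OF Y(2) O'(1,3)]]) (use W V O' in auto)
    then show ?thesis by (simp add: push_def)
  qed
  finally show ?thesis by (simp add: X(2))
qed

text \<open>Both terms are instances of \<open>push_related_apply\<close>. The intended maps are the
  two projections of a product, under which a lifted field is related to its original in one factor
  and to the zero field in the other.\<close>

lemma push_lie_bracket:
  assumes W: "open W" "q \<in> W" and V: "open V" "\<psi> ` W \<subseteq> V"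
    and X: "\<And>r. r \<in> W \<Longrightarrow> X r \<in> tangent_space A r" "\<And>r. r \<in> W \<Longrightarrow> push B \<psi> r (X r) = X' (\<psi> r)" "vector_field_on B V X'"
    and Y: "\<And>r. r \<in> W \<Longrightarrow> Y r \<in> tangent_space A r" "\<And>r. r \<in> W \<Longrightarrow> push B \<psi> r (Y r) = Y' (\<psi> r)" "vector_field_on B V Y'"
  shows "push B \<psi> q (lie_bracket A X Y q) = lie_bracket B X' Y' (\<psi> q)"
proof
  fix h
  show "push B \<psi> q (lie_bracket A X Y q) h = lie_bracket B X' Y' (\<psi> q) h"
  proof (cases "smooth_near B (\<psi> q) h")
    case True
    then show ?thesis
      using push_related_apply[where X = X and X' = X' and Y = Y and Y' = Y', OF W V X(1,2)[OF W(2)] Y(2,3) True]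
        push_related_apply[where X = Y and X' = Y' and Y = X and Y' = X', OF W V Y(1,2)[OF W(2)] X(2,3) True]
        smooth_near_smooth_map[OF A B \<psi> True]
      by (simp add: push_def lie_bracket_def)
  qed (simp add: push_def lie_bracket_def)
qed

text \<open>Linearity and symmetry pass from the target metric through the linear pushforward,
  positivity through its injectivity. This is how the warped metric acquires these properties in the
  main argument.\<close>

lemma isometric_immersion_metric:
  assumes iso: "isometric_immersion A g B g' \<psi>" and g': "riemannian_metric B g'"
  shows isometric_linear_form: "v \<in> tangent_space A p \<Longrightarrow> linear_form A p (g p v)"
    and isometric_sym: "v \<in> tangent_space A p \<Longrightarrow> w \<in> tangent_space A p \<Longrightarrow> g p v w = g p w v"
    and isometric_pos: "v \<in> tangent_space A p \<Longrightarrow> v \<noteq> tzero \<Longrightarrow> g p v v > 0"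
proof -
  note g = isometric_immersion_eq[OF iso, of _ p]
  note pt = push_tangent[OF A B \<psi>] and pl = push_linear[OF A B \<psi>, of p]
  assume v: "v \<in> tangent_space A p"
  show "linear_form A p (g p v)"
    unfolding linear_form_def
  proof (intro ballI allI)
    fix w w' a b assume w: "w \<in> tangent_space A p" "w' \<in> tangent_space A p"
    note l = riemannian_linear_form[OF g' pt[OF v]]
    show "g p v (a *\<^sub>t w +\<^sub>t b *\<^sub>t w') = a * g p v w + b * g p v w'"
      using v w by (simp add: g tangent_space_tplus tangent_space_tscale linear_to_tangent_tplus[OF pl]
          linear_to_tangent_tscale[OF pl] linear_form_tplus[OF l] linear_form_tscale[OF l] pt)
  qed
  show "g p v w = g p w v" if "w \<in> tangent_space A p"
    using riemannian_sym[OF g' pt[OF v] pt[OF that]] v that by (simp add: g)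
  assume "v \<noteq> tzero"
  then have "push B \<psi> p v \<noteq> tzero"
    using inj_onD[OF isometric_immersion_inj[OF iso], of p v tzero] linear_to_tangent_tzero[OF pl] v tangent_space_tzero by metis
  then show "g p v v > 0"
    using riemannian_pos[OF g' pt[OF v]] v by (simp add: g)
qed

end

context
  fixes A :: "('a::{t2_space, second_countable_topology}, 'd::euclidean_space) chart set"
    and B :: "('b::{t2_space, second_countable_topology}, 'e::euclidean_space) chart set"
    and \<psi> :: "'a \<Rightarrow> 'b" and \<phi> \<xi> \<eta> g' nab' g D
  assumes A: "smooth_atlas A" and K: "kenmotsu B \<phi> \<xi> \<eta> g' nab'"
    and iso: "isometric_immersion A g B g' \<psi>" and D: "pullback_connection A B \<psi> nab' D"
begin

lemmas immersion_smooth_map = isometric_immersion_smooth_map[OF iso]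

lemma pullback_connection_xi:
  assumes v: "v \<in> tangent_space A p"
  shows "D p v (\<xi> \<circ> \<psi>) = push B \<psi> p v -\<^sub>t \<eta> (\<psi> p) (push B \<psi> p v) *\<^sub>t \<xi> (\<psi> p)"
  using pullback_connection_pulled[OF D open_UNIV kenmotsu_xi_field[OF K] UNIV_I v]
    kenmotsu_nabla_xi[OF K push_tangent[OF A kenmotsu_smooth_atlas[OF K] immersion_smooth_map v]] by simp

text \<open>The derivative of \<open>\<xi> \<circ> \<psi>\<close> along \<open>X\<close> is smooth, and it differs from the pushed forward \<open>X\<close> by a
  multiple of \<open>\<xi> \<circ> \<psi>\<close>; the factor is recovered by dividing by some \<open>\<xi> h \<noteq> 0\<close>.\<close>

lemma eta_push_smooth:
  assumes W: "open W" and X: "vector_field_on A W X"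
  shows "smooth_fun_on A W (\<lambda>p. \<eta> (\<psi> p) (push B \<psi> p (X p)))"
proof (rule smooth_fun_on_locally[OF A])
  fix p assume p: "p \<in> W"
  note Bs = kenmotsu_smooth_atlas[OF K] and \<psi> = immersion_smooth_map
  have "\<xi> (\<psi> p) \<noteq> tzero"
    using kenmotsu_eta_xi[OF K, of "\<psi> p"] linear_form_tzero[OF kenmotsu_eta_linear[OF K], of "\<psi> p"] by auto
  then obtain h where h: "\<xi> (\<psi> p) h \<noteq> 0" by (auto simp: fun_eq_iff)
  then have "smooth_near B (\<psi> p) h"
    using tangent_not_smooth[OF Bs kenmotsu_xi_in[OF K]] by blast
  then obtain V where V: "open V" "\<psi> p \<in> V" "smooth_fun_on B V h"
    unfolding smooth_near_def by blast
  let ?R = "W \<inter> \<psi> -` V"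
  have R: "open ?R" using W smooth_map_open_vimage[OF A Bs \<psi> V(1)] by blast
  have xi: "field_along_on A B \<psi> W (\<xi> \<circ> \<psi>)"
    by (rule field_along_on_subset[OF field_along_on_compose[OF A Bs \<psi> kenmotsu_xi_field[OF K]]]) simp
  have s: "smooth_fun_on A ?R (\<lambda>q. (\<xi> \<circ> \<psi>) q h)" "smooth_fun_on A ?R (\<lambda>q. D q (X q) (\<xi> \<circ> \<psi>) h)"
      "smooth_fun_on A ?R (\<lambda>q. push B \<psi> q (X q) h)"
    by (rule field_along_on_apply[OF _ V(1,3)];
        intro xi pullback_connection_field[OF D W xi X] field_along_on_push[OF A Bs \<psi> W X])+
  define Q where "Q = (\<lambda>q. (\<xi> \<circ> \<psi>) q h) -` (- {0}) \<inter> ?R"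
  have Q: "open Q" "p \<in> Q" "Q \<subseteq> ?R"
    using continuous_on_open_vimage[OF R, of "\<lambda>q. (\<xi> \<circ> \<psi>) q h"] smooth_fun_on_imp_continuous_on[OF A R s(1)] p V h
    by (auto simp: Q_def)
  note sQ = s[THEN smooth_fun_on_subset, OF Q(3)]
  have "smooth_fun_on A Q (\<lambda>q. (push B \<psi> q (X q) h + (- 1) * D q (X q) (\<xi> \<circ> \<psi>) h) * inverse ((\<xi> \<circ> \<psi>) q h))"
    by (intro smooth_fun_on_mult[OF A Q(1)] smooth_fun_on_add[OF A Q(1)] smooth_fun_on_inverse[OF A Q(1)]
        smooth_fun_on_const[OF A Q(1)] sQ) (auto simp: Q_def)
  then have "smooth_fun_on A Q (\<lambda>p. \<eta> (\<psi> p) (push B \<psi> p (X p)))"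
  proof (rule smooth_fun_on_cong[OF A Q(1), rotated])
    fix q assume q: "q \<in> Q"
    then have "X q \<in> tangent_space A q" using vector_field_on_in[OF X] Q(3) by auto
    from fun_cong[OF pullback_connection_xi[OF this], of h] q
    show "(push B \<psi> q (X q) h + (- 1) * D q (X q) (\<xi> \<circ> \<psi>) h) * inverse ((\<xi> \<circ> \<psi>) q h) = \<eta> (\<psi> q) (push B \<psi> q (X q))"
      by (simp add: Q_def field_simps)
  qed
  then show "\<exists>V. open V \<and> p \<in> V \<and> smooth_fun_on A V (\<lambda>p. \<eta> (\<psi> p) (push B \<psi> p (X p)))"
    using Q by blast
qed

text \<open>A vanishing second fundamental form makes the pushforward intertwine nab with D, so both
  sides have the derivative of \<xi> \<circ> \<psi> as their image; injectivity of the pushforward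
  cancels it.\<close>

lemma nabla_tangential_xi:
  fixes nab :: "'a connection"
  assumes nab: "levi_civita A g nab" and tg: "totally_geodesic A B \<psi> nab D"
    and W: "open W" "p \<in> W" and X: "vector_field_on A W X" and Z: "vector_field_on A W Z"
    and Zxi: "\<And>q. push B \<psi> q (Z q) = \<xi> (\<psi> q)"
  shows "nab p (X p) Z = X p -\<^sub>t \<eta> (\<psi> p) (push B \<psi> p (X p)) *\<^sub>t Z p"
proof -
  have x: "X p \<in> tangent_space A p" and z: "Z p \<in> tangent_space A p"
    using X Z W(2) by (auto intro: vector_field_on_in)
  note pl = push_linear[OF A kenmotsu_smooth_atlas[OF K] immersion_smooth_map, of p]
  have "push B \<psi> p (nab p (X p) Z) = D p (X p) (\<xi> \<circ> \<psi>)"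
    using totally_geodesicD[OF tg W(1) X Z W(2)] by (simp add: Zxi o_def)
  also have "\<dots> = push B \<psi> p (X p -\<^sub>t \<eta> (\<psi> p) (push B \<psi> p (X p)) *\<^sub>t Z p)"
    by (simp add: pullback_connection_xi[OF x] Zxi[symmetric] linear_to_tangent_tminus[OF pl]
        linear_to_tangent_tscale[OF pl] tangent_space_tscale x z)
  finally have eq: "push B \<psi> p (nab p (X p) Z) = push B \<psi> p (X p -\<^sub>t \<eta> (\<psi> p) (push B \<psi> p (X p)) *\<^sub>t Z p)" .
  have "nab p (X p) Z \<in> tangent_space A p"
    by (rule levi_civita_in[OF nab W(1) Z W(2) x])
  moreover have "X p -\<^sub>t \<eta> (\<psi> p) (push B \<psi> p (X p)) *\<^sub>t Z p \<in> tangent_space A p"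
    by (intro tangent_space_tminus tangent_space_tscale x z)
  ultimately show ?thesis
    using inj_on_eq_iff[OF isometric_immersion_inj[OF iso]] eq by blast
qed

end

section \<open>Warped products of curves\<close>

text \<open>The claim concerns one point b of the base, but the system lives on M. An auxiliary
  point y of the fibre is added, and the equation for k found at (b, y) descends to b because k and
  T k are lifted from the base.\<close>

lemma laplacian_warping_function:
  fixes AB :: "('b::{t2_space, second_countable_topology}, 'd::euclidean_space) chart set"
    and gB :: "'b metric" and nabB :: "'b connection"
    and AF :: "('f::{t2_space, second_countable_topology}, 'k::euclidean_space) chart set"
    and gF :: "'f metric"
    and f :: "'b \<Rightarrow> real"
    and nab :: "('b \<times> 'f) connection"
    and AN :: "('n::{t2_space, second_countable_topology}, 'e::euclidean_space) chart set"
  assumes B: "riemannian_manifold AB gB" and nabB: "levi_civita AB gB nabB"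
    and F: "riemannian_manifold AF gF"
    and f: "smooth_fun_on AB UNIV f" and f_pos: "\<And>b. f b > 0"
    and AM: "AM = prod_atlas AB AF" and g: "g = warped_metric AB gB AF gF f"
    and nab: "levi_civita AM g nab"
    and K: "kenmotsu AN \<phi> \<xi> \<eta> gN nabN"
    and iso: "isometric_immersion AM g AN gN \<psi>"
    and dims: "DIM('d) = 1" "DIM('k) = 1"
    and D: "pullback_connection AM AN \<psi> nabN D" and tg: "totally_geodesic AM AN \<psi> nab D"
    and xi: "\<And>p. \<xi> (\<psi> p) \<in> push AN \<psi> p ` tangent_space AM p"
  shows "laplacian AB gB nabB f b = - f b"
proof -
  have atB: "smooth_atlas AB" and mB: "riemannian_metric AB gB" and atF: "smooth_atlas AF" and mF: "riemannian_metric AF gF"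
    using B F by (simp_all add: riemannian_manifold_def)
  have atM: "smooth_atlas AM" unfolding AM by (rule smooth_atlas_prod[OF atB atF])
  have s1: "smooth_map AM AB fst" and s2: "smooth_map AM AF snd"
    unfolding AM by (rule smooth_map_fst[OF atB atF], rule smooth_map_snd[OF atB atF])
  note atN = kenmotsu_smooth_atlas[OF K] and sN = isometric_immersion_smooth_map[OF iso]
  note mN = kenmotsu_metric[OF K]
  note gform = isometric_linear_form[OF atM atN sN iso mN]
    and gsym = isometric_sym[OF atM atN sN iso mN]
    and gpos = isometric_pos[OF atM atN sN iso mN]
  note l1 = push_linear[OF atM atB s1] and l2 = push_linear[OF atM atF s2] and lN = push_linear[OF atM atN sN]
  note ts = tangent_space_tplus tangent_space_tscale tangent_space_tminus

  obtain WB T0 where WB: "open WB" "b \<in> WB" and T0: "vector_field_on AB WB T0" "\<And>q. q \<in> WB \<Longrightarrow> gB q (T0 q) (T0 q) = 1"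
    and lap: "\<And>h. laplacian AB gB nabB h b = - T0 b (\<lambda>q. T0 q h)"
    using laplacian_one_dim[OF atB dims(1) mB nabB, of b] by blast
  \<comment> \<open>Types are inhabited, so the fibre has a point, and any point will do.\<close>
  obtain y :: 'f where True by blast
  obtain WF S0 where WF: "open WF" "y \<in> WF" and S0: "vector_field_on AF WF S0" "\<And>q. q \<in> WF \<Longrightarrow> gF q (S0 q) (S0 q) = 1"
    using unit_field_exists[OF atF dims(2) mF, of y] by blast
  obtain U \<phi>1 where U: "(U, \<phi>1) \<in> AB" "b \<in> U" using smooth_atlas_cover[OF atB] .
  obtain V \<phi>2 where V: "(V, \<phi>2) \<in> AF" "y \<in> V" using smooth_atlas_cover[OF atF] .
  \<comment> \<open>The domains of the unit fields are cut down to chart domains, as the lifts to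
    the product require.\<close>
  define XB where "XB = WB \<inter> U"
  define XF where "XF = WF \<inter> V"
  define W where "W = XB \<times> XF"
  have XB: "open XB" "b \<in> XB" "XB \<subseteq> U" "XB \<subseteq> WB" and XF: "open XF" "y \<in> XF" "XF \<subseteq> V" "XF \<subseteq> WF"
    using WB WF U(2) V(2) smooth_atlas_chart(1)[OF atB U(1)] smooth_atlas_chart(1)[OF atF V(1)]
    by (auto simp: XB_def XF_def)
  have W: "open W" "(b, y) \<in> W" "fst ` W \<subseteq> XB" "snd ` W \<subseteq> XF"
    using XB XF by (auto simp: W_def open_Times)
  have WXB: "fst q \<in> XB" and WXF: "snd q \<in> XF" if "q \<in> W" for q using W(3,4) that by auto
  have T0': "vector_field_on AB XB T0" and S0': "vector_field_on AF XF S0"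
    using vector_field_on_subset[OF T0(1) XB(4)] vector_field_on_subset[OF S0(1) XF(4)] by auto
  obtain T where "vector_field_on AM (XB \<times> V) T" and T12: "\<And>p. p \<in> XB \<times> V \<Longrightarrow> push AB fst p (T p) = T0 (fst p)"
    "\<And>p. p \<in> XB \<times> V \<Longrightarrow> push AF snd p (T p) = tzero"
    using lift_fst[OF atB atF U(1) V(1) XB(1,3) T0'] unfolding AM by blast
  moreover have WV: "W \<subseteq> XB \<times> V" and WU: "W \<subseteq> U \<times> XF" using XB XF by (auto simp: W_def)
  ultimately have T: "vector_field_on AM W T" by (blast intro: vector_field_on_subset)
  obtain S where "vector_field_on AM (U \<times> XF) S" and S12: "\<And>p. p \<in> U \<times> XF \<Longrightarrow> push AB fst p (S p) = tzero"
    "\<And>p. p \<in> U \<times> XF \<Longrightarrow> push AF snd p (S p) = S0 (snd p)"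
    using lift_snd[OF atB atF U(1) V(1) XF(1,3) S0'] unfolding AM by blast
  then have S: "vector_field_on AM W S" using WU by (blast intro: vector_field_on_subset)
  have T1: "push AB fst q (T q) = T0 (fst q)" and T2: "push AF snd q (T q) = tzero"
    and S1: "push AB fst q (S q) = tzero" and S2: "push AF snd q (S q) = S0 (snd q)" if "q \<in> W" for q
    using T12 S12 that WV WU by blast+
  have tT: "T q \<in> tangent_space AM q" and tS: "S q \<in> tangent_space AM q" if "q \<in> W" for q
    using that T S by (auto intro: vector_field_on_in)
  have tT0: "T0 x \<in> tangent_space AB x" if "x \<in> XB" for x using that T0' by (auto intro: vector_field_on_in)
  have tS0: "S0 x \<in> tangent_space AF x" if "x \<in> XF" for x using that S0' by (auto intro: vector_field_on_in)

  \<comment> \<open>\<open>Fw\<close> is the warping function on M; \<kappa> is its logarithmic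
    derivative along the unit field of the base, and \<open>k\<close> is the lift of
    \<kappa>.\<close>
  define Fw where "Fw q = f (fst q)" for q :: "'b \<times> 'f"
  define \<kappa> where "\<kappa> x = T0 x f * inverse (f x)" for x
  define k where "k q = \<kappa> (fst q)" for q :: "'b \<times> 'f"
  have Fpos: "Fw q > 0" for q by (simp add: Fw_def f_pos)
  have finv: "smooth_fun_on AB UNIV (\<lambda>x. inverse (f x))"
    by (rule smooth_fun_on_inverse[OF atB open_UNIV f]) (use f_pos less_irrefl in metis)
  have T0f: "smooth_fun_on AB XB (\<lambda>x. T0 x f)"
    using vector_field_on_apply[OF T0' open_UNIV f] by simp
  have \<kappa>: "smooth_fun_on AB XB \<kappa>"
    unfolding \<kappa>_def by (rule smooth_fun_on_mult[OF atB XB(1) T0f smooth_fun_on_subset[OF finv]]) simp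
  have n1: "smooth_near AB (fst q) \<kappa>" if "q \<in> W" for q
    by (rule smooth_nearI[OF atB XB(1) WXB[OF that] \<kappa>])
  have nf: "smooth_near AB x f" for x by (rule smooth_nearI[OF atB open_UNIV UNIV_I f])
  have apply_fst: "v (\<lambda>q. h (fst q)) = push AB fst q v h" if "smooth_near AB (fst q) h" for v q h
    using that by (simp add: push_def o_def)
  have nk: "smooth_near AM q k" if "q \<in> W" for q
    using smooth_near_smooth_map[OF atM atB s1 n1[OF that]] by (simp add: k_def[abs_def] o_def)
  have nF: "smooth_near AM q Fw" for q
    using smooth_near_smooth_map[OF atM atB s1 nf] by (simp add: Fw_def[abs_def] o_def)
  have push_F: "v Fw = push AB fst q v f" for v q
    using apply_fst[OF nf, of v q] by (simp add: Fw_def[abs_def])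
  have push_k: "v k = push AB fst q v \<kappa>" if "q \<in> W" for v q
    using apply_fst[OF n1[OF that], of v] by (simp add: k_def[abs_def])
  \<comment> \<open>On functions lifted from the base a vector acts through its projection to the
    base, which is zero for S.\<close>
  have SF: "S q Fw = 0" and Sk: "S q k = 0" and Tk: "T q k = T0 (fst q) \<kappa>" if "q \<in> W" for q
    by (simp_all only: push_F[of _ q] push_k[OF that] T1[OF that] S1[OF that] tzero_apply)
  have TF: "T q Fw = Fw q * k q" if "q \<in> W" for q
    unfolding push_F[of _ q] T1[OF that] using f_pos[of "fst q"] by (simp add: Fw_def k_def \<kappa>_def)

  have geq: "g q v w = gB (fst q) (push AB fst q v) (push AB fst q w)
      + (Fw q)\<^sup>2 * gF (snd q) (push AF snd q v) (push AF snd q w)" for q v w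
    by (simp add: g warped_metric_def Fw_def)
  have zB: "gB x tzero tzero = 0" "u \<in> tangent_space AB x \<Longrightarrow> gB x u tzero = 0" for x u
    using linear_form_tzero[OF riemannian_linear_form[OF mB]] tangent_space_tzero by auto
  have zF: "gF x tzero tzero = 0" "u \<in> tangent_space AF x \<Longrightarrow> gF x tzero u = 0" for x u
    using linear_form_tzero[OF riemannian_linear_form[OF mF]] riemannian_sym[OF mF tangent_space_tzero] tangent_space_tzero
    by (blast, metis)
  have gTT: "g q (T q) (T q) = 1" and gTS: "g q (T q) (S q) = 0" and gSS: "g q (S q) (S q) = Fw q * Fw q" if "q \<in> W" for q
    using that T0(2) S0(2) XB(4) XF(4) WXB WXF tT0[OF WXB] tS0[OF WXF]
    by (auto simp: geq T1 T2 S1 S2 zB zF power2_eq_square subset_iff)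

  \<comment> \<open>Both summands of the warped metric vanish on v, which positivity excludes for a
    nonzero vector. Injectivity of the pair of projections is thus read off from the metric.\<close>
  have null: "v = tzero" if v: "v \<in> tangent_space AM q" and "push AB fst q v = tzero" "push AF snd q v = tzero" for q v
  proof (rule ccontr)
    assume "v \<noteq> tzero"
    from gpos[OF v this] show False using that by (simp add: geq zB zF)
  qed
  note gtp = linear_form_tplus[OF gform] and gtm = linear_form_tminus[OF gform] and gts = linear_form_tscale[OF gform]
  have gST: "g q (S q) (T q) = 0" if "q \<in> W" for q using gTS gsym[OF tT tS] that by simp
  \<comment> \<open>Orthogonal expansion in T and S, where the inverse accounts for the squared
    length \<open>Fw q * Fw q\<close> of S. The multiples of T0 and S0 found in the one-dimensional
    factors turn out to be the metric coefficients.\<close>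
  have decomp: "v = g q v (T q) *\<^sub>t T q +\<^sub>t (g q v (S q) * inverse (Fw q * Fw q)) *\<^sub>t S q"
    if q: "q \<in> W" and v: "v \<in> tangent_space AM q" for q v
  proof -
    note tq = tT[OF q] tS[OF q]
    have "T0 (fst q) \<noteq> tzero" using T0(2) WXB[OF q] XB(4) zB(1)[of "fst q"] by force
    then obtain \<alpha> where \<alpha>: "push AB fst q v = \<alpha> *\<^sub>t T0 (fst q)"
      using tangent_space_one_dim[OF atB dims(1) tT0[OF WXB[OF q]] _ push_tangent[OF atM atB s1 v]] by blast
    have "S0 (snd q) \<noteq> tzero" using S0(2) WXF[OF q] XF(4) zF(1)[of "snd q"] by force
    then obtain \<beta> where \<beta>: "push AF snd q v = \<beta> *\<^sub>t S0 (snd q)"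
      using tangent_space_one_dim[OF atF dims(2) tS0[OF WXF[OF q]] _ push_tangent[OF atM atF s2 v]] by blast
    have c: "\<alpha> *\<^sub>t T q +\<^sub>t \<beta> *\<^sub>t S q \<in> tangent_space AM q" by (intro ts tq)
    have "v -\<^sub>t (\<alpha> *\<^sub>t T q +\<^sub>t \<beta> *\<^sub>t S q) = tzero"
    proof (rule null)
      show "v -\<^sub>t (\<alpha> *\<^sub>t T q +\<^sub>t \<beta> *\<^sub>t S q) \<in> tangent_space AM q" by (intro ts tq v)
      show "push AB fst q (v -\<^sub>t (\<alpha> *\<^sub>t T q +\<^sub>t \<beta> *\<^sub>t S q)) = tzero"
        using q by (simp add: linear_to_tangent_tminus[OF l1 v c] linear_to_tangent_tplus[OF l1] linear_to_tangent_tscale[OF l1]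
            ts tq T1 S1 \<alpha>) (simp add: fun_eq_iff)
      show "push AF snd q (v -\<^sub>t (\<alpha> *\<^sub>t T q +\<^sub>t \<beta> *\<^sub>t S q)) = tzero"
        using q by (simp add: linear_to_tangent_tminus[OF l2 v c] linear_to_tangent_tplus[OF l2] linear_to_tangent_tscale[OF l2]
            ts tq T2 S2 \<beta>) (simp add: fun_eq_iff)
    qed
    then have v_eq: "v = \<alpha> *\<^sub>t T q +\<^sub>t \<beta> *\<^sub>t S q" by (simp add: fun_eq_iff)
    have "g q (T q) v = \<alpha>" "g q (S q) v = \<beta> * (Fw q * Fw q)"
      using q by (simp_all add: v_eq gtp gts ts tq gTT gTS gST gSS)
    then have G: "g q v (T q) = \<alpha>" "g q v (S q) = \<beta> * (Fw q * Fw q)"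
      using gsym[OF v tq(1)] gsym[OF v tq(2)] by simp_all
    have "\<beta> * (Fw q * Fw q) * inverse (Fw q * Fw q) = \<beta>" using Fpos[of q] by (simp add: field_simps)
    then show ?thesis unfolding G by (simp only: v_eq[symmetric])
  qed
  have gexp: "g q v w = g q v (T q) * g q w (T q) + g q v (S q) * g q w (S q) * inverse (Fw q * Fw q)"
    if q: "q \<in> W" and v: "v \<in> tangent_space AM q" and w: "w \<in> tangent_space AM q" for q v w
  proof -
    note tq = tT[OF q] tS[OF q]
    have "g q v w = g q v (g q w (T q) *\<^sub>t T q +\<^sub>t (g q w (S q) * inverse (Fw q * Fw q)) *\<^sub>t S q)"
      using decomp[OF q w] by simp
    also have "\<dots> = g q w (T q) * g q v (T q) + (g q w (S q) * inverse (Fw q * Fw q)) * g q v (S q)"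
      by (simp add: gtp[OF v] gts[OF v] ts tq)
    finally show ?thesis by (simp add: mult_ac)
  qed

  (* The bracket is a tangent vector because the connection is torsion-free, and a tangent vector of M is
     determined by its two projections; so the symmetry of mixed partial derivatives is not needed. *)
  have bracket: "lie_bracket AM T S q = tzero" if q: "q \<in> W" for q
  proof (rule null)
    have "nab q (T q) S -\<^sub>t nab q (S q) T \<in> tangent_space AM q"
      by (intro ts levi_civita_in[OF nab W(1) _ q] S T tT[OF q] tS[OF q])
    then show "lie_bracket AM T S q \<in> tangent_space AM q"
      by (simp add: levi_civita_torsion_free[OF nab W(1) T S q])
    have "push AB fst q (lie_bracket AM T S q) = lie_bracket AB T0 (\<lambda>_. tzero) (fst q)"
      by (rule push_lie_bracket[OF atM atB s1 W(1) q XB(1) W(3) tT T1 T0' tS S1 vector_field_on_tzero[OF atB XB(1)]])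
    also have "\<dots> = tzero"
      using tangent_const[OF atB tT0[OF WXB[OF q]], of 0] by (simp add: lie_bracket_def fun_eq_iff)
    finally show "push AB fst q (lie_bracket AM T S q) = tzero" .
    have "push AF snd q (lie_bracket AM T S q) = lie_bracket AF (\<lambda>_. tzero) S0 (snd q)"
      by (rule push_lie_bracket[OF atM atF s2 W(1) q XF(1) W(4) tT T2 vector_field_on_tzero[OF atF XF(1)] tS S2 S0'])
    also have "\<dots> = tzero"
      using tangent_const[OF atF tS0[OF WXF[OF q]], of 0] by (simp add: lie_bracket_def fun_eq_iff)
    finally show "push AF snd q (lie_bracket AM T S q) = tzero" .
  qed
  have nTS: "nab q (T q) S = nab q (S q) T" if "q \<in> W" for q
    using levi_civita_torsion_free[OF nab W(1) T S that] bracket[OF that] by (simp add: fun_eq_iff)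
  have commute: "T q (\<lambda>r. S r h) = S q (\<lambda>r. T r h)" if "q \<in> W" "smooth_near AM q h" for q h
    using fun_cong[OF bracket[OF that(1)], of h] that(2) by (simp add: lie_bracket_def)

  \<comment> \<open>The tangential preimage Z of \<xi> is picked point by point, so it is at this
    stage an arbitrary function; its smoothness follows below from the decomposition along T and S
    with smooth coefficients.\<close>
  have "\<forall>q. \<exists>v. v \<in> tangent_space AM q \<and> push AN \<psi> q v = \<xi> (\<psi> q)"
  proof
    fix q
    obtain v where "\<xi> (\<psi> q) = push AN \<psi> q v" "v \<in> tangent_space AM q" using xi[of q] by (rule imageE)
    then show "\<exists>v. v \<in> tangent_space AM q \<and> push AN \<psi> q v = \<xi> (\<psi> q)" by auto
  qed
  from choice[OF this] obtain Z where tZ: "\<And>q. Z q \<in> tangent_space AM q" and pZ: "\<And>q. push AN \<psi> q (Z q) = \<xi> (\<psi> q)"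
    by blast
  define a where "a q = g q (Z q) (T q)" for q
  \<comment> \<open>This is the function b of \<open>warped_surface_ode\<close>; in the present
    proof b is the base point.\<close>
  define c where "c q = g q (Z q) (S q)" for q
  \<comment> \<open>Pairing with Z is \<eta> along the immersion, so that
    \<open>eta_push_smooth\<close> yields the smoothness of a and c.\<close>
  have gZ: "g q (Z q) v = \<eta> (\<psi> q) (push AN \<psi> q v)" if v: "v \<in> tangent_space AM q" for q v
  proof -
    have "g q v (Z q) = gN (\<psi> q) (push AN \<psi> q v) (\<xi> (\<psi> q))"
      using isometric_immersion_eq[OF iso v tZ] by (simp add: pZ)
    then show ?thesis
      using gsym[OF v tZ] kenmotsu_metric_xi[OF K push_tangent[OF atM atN sN v]] by simp
  qed
  have a: "smooth_fun_on AM W a"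
    by (rule smooth_fun_on_cong[OF atM W(1) _ eta_push_smooth[OF atM K iso D W(1) T]]) (simp add: a_def gZ tT)
  have c: "smooth_fun_on AM W c"
    by (rule smooth_fun_on_cong[OF atM W(1) _ eta_push_smooth[OF atM K iso D W(1) S]]) (simp add: c_def gZ tS)
  have FF: "smooth_fun_on AM W (\<lambda>q. inverse (Fw q * Fw q))"
  proof -
    have "smooth_fun_on AM UNIV Fw"
      using smooth_fun_on_smooth_map[OF atM atB s1 open_UNIV f] by (simp add: Fw_def[abs_def] o_def)
    from smooth_fun_on_subset[OF this] have "smooth_fun_on AM W Fw" by simp
    then show ?thesis
      using Fpos by (intro smooth_fun_on_inverse[OF atM W(1)] smooth_fun_on_mult[OF atM W(1)]) (auto simp: less_imp_neq[symmetric])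
  qed
  have Z: "vector_field_on AM W Z"
  proof (rule vector_field_on_cong[OF atM W(1)])
    show "vector_field_on AM W (\<lambda>q. a q *\<^sub>t T q +\<^sub>t (c q * inverse (Fw q * Fw q)) *\<^sub>t S q)"
      by (intro vector_field_on_tplus[OF atM W(1)] vector_field_on_tscale[OF atM W(1)] smooth_fun_on_mult[OF atM W(1)] a c FF T S)
    show "a q *\<^sub>t T q +\<^sub>t (c q * inverse (Fw q * Fw q)) *\<^sub>t S q = Z q" if "q \<in> W" for q
      using decomp[OF that tZ] by (simp add: a_def c_def)
  qed
  have nZ: "nab q (X q) Z = X q -\<^sub>t g q (Z q) (X q) *\<^sub>t Z q" if "q \<in> W" "vector_field_on AM W X" for q X
    using nabla_tangential_xi[OF atM K iso D nab tg W(1) that Z pZ] gZ[OF vector_field_on_in[OF that(2,1)]] by simp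

  have unit: "(a q)\<^sup>2 + (c q)\<^sup>2 * inverse (Fw q * Fw q) = 1" if "q \<in> W" for q
    using gexp[OF that tZ tZ] gZ[OF tZ, of q] by (simp add: pZ kenmotsu_eta_xi[OF K] a_def c_def power2_eq_square)
  have components: "T q a = 1 - (a q)\<^sup>2 \<and> S q a = c q * (k q - a q) \<and> T q c = c q * (k q - a q)
      \<and> S q c = Fw q * Fw q - (c q)\<^sup>2 - a q * (Fw q * Fw q * k q)" if q: "q \<in> W" for q
  proof -
    note tq = tT[OF q] tS[OF q] tZ[of q]
    note nin = levi_civita_in[OF nab W(1) _ q]
    note compat = levi_civita_metric[OF nab W(1) _ _ q]
    have flat: "v (\<lambda>r. g r (T r) (T r)) = 0" "v (\<lambda>r. g r (T r) (S r)) = 0" "v (\<lambda>r. g r (S r) (S r)) = 2 * Fw q * v Fw"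
      if v: "v \<in> tangent_space AM q" for v
    proof -
      show "v (\<lambda>r. g r (T r) (T r)) = 0" "v (\<lambda>r. g r (T r) (S r)) = 0"
        using tangent_local[OF atM v W(1) q gTT] tangent_local[OF atM v W(1) q gTS] tangent_const[OF atM v] by simp_all
      show "v (\<lambda>r. g r (S r) (S r)) = 2 * Fw q * v Fw"
        using tangent_local[OF atM v W(1) q gSS] tangent_mult[OF atM v nF nF] by simp
    qed
    let ?TT = "nab q (T q) T" and ?ST = "nab q (S q) T" and ?SS = "nab q (S q) S"
    have tn: "?TT \<in> tangent_space AM q" "?ST \<in> tangent_space AM q" "?SS \<in> tangent_space AM q"
      by (intro nin T S tq)+
    \<comment> \<open>The Levi-Civita connection of the frame, recorded through pairings with T and
      S: nabla_T T = 0, nabla_T S = nabla_S T = k S and nabla_S S = - f^2 k T. The norms of T and S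
      give the pairings here, and their orthogonality gives the remaining two.\<close>
    have 1: "g q ?TT (T q) = 0" "g q ?ST (T q) = 0" "g q ?ST (S q) = Fw q * Fw q * k q" "g q ?SS (S q) = 0"
      using compat[OF T T tq(1)] compat[OF T T tq(2)] compat[OF S S tq(1)] compat[OF S S tq(2)]
        flat[OF tq(1)] flat[OF tq(2)] gsym[OF tn(1) tq(1)] gsym[OF tn(2) tq(1)] gsym[OF tn(2) tq(2)] gsym[OF tn(3) tq(2)]
        TF[OF q] SF[OF q] nTS[OF q] by simp_all
    have 2: "g q ?TT (S q) = 0" "g q ?SS (T q) = - (Fw q * Fw q * k q)"
      using compat[OF T S tq(1)] compat[OF T S tq(2)] flat[OF tq(1)] flat[OF tq(2)]
        gsym[OF tn(2) tq(1)] gsym[OF tn(3) tq(1)] nTS[OF q] 1 by simp_all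
    have gn: "g q (Z q) ?TT = 0" "g q (Z q) ?ST = c q * k q" "g q (Z q) ?SS = - (a q * (Fw q * Fw q * k q))"
      using gexp[OF q tZ tn(1)] gexp[OF q tZ tn(2)] gexp[OF q tZ tn(3)] 1 2 Fpos[of q] by (simp_all add: a_def c_def field_simps)
    \<comment> \<open>\<open>gform\<close> provides linearity in the second argument; symmetry
      carries it over to the first.\<close>
    have gd: "g q (v -\<^sub>t s *\<^sub>t Z q) w = g q v w - s * g q (Z q) w"
      if "v \<in> tangent_space AM q" "w \<in> tangent_space AM q" for v w s
      using that gsym[OF that(2) that(1)] gsym[OF that(2) tq(3)] gsym[OF ts(3)[OF that(1) ts(2)[OF tq(3)]] that(2), of s]
      by (simp add: gtm gts ts tq)
    \<comment> \<open>Metric compatibility for g(Z, T) and g(Z, S), with \<open>nZ\<close> for the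
      derivative of Z; torsion-freeness replaces nabla_T S by nabla_S T.\<close>
    have "T q a = g q (T q -\<^sub>t a q *\<^sub>t Z q) (T q) + g q (Z q) ?TT"
      "S q a = g q (S q -\<^sub>t c q *\<^sub>t Z q) (T q) + g q (Z q) ?ST"
      "T q c = g q (T q -\<^sub>t a q *\<^sub>t Z q) (S q) + g q (Z q) ?ST"
      "S q c = g q (S q -\<^sub>t c q *\<^sub>t Z q) (S q) + g q (Z q) ?SS"
      using compat[OF Z T tq(1)] compat[OF Z T tq(2)] compat[OF Z S tq(1)] compat[OF Z S tq(2)] nZ[OF q T] nZ[OF q S] nTS[OF q]
      by (simp_all add: a_def[abs_def] c_def[abs_def])
    then show ?thesis
      using q by (simp add: gd tq gn gTT gTS gST gSS a_def[symmetric] c_def[symmetric] power2_eq_square algebra_simps)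
  qed
  have unit': "(Fw q)\<^sup>2 * (a q)\<^sup>2 + (c q)\<^sup>2 = (Fw q)\<^sup>2" if "q \<in> W" for q
  proof -
    have "(Fw q)\<^sup>2 * ((a q)\<^sup>2 + (c q)\<^sup>2 * inverse (Fw q * Fw q)) = (Fw q)\<^sup>2" using unit[OF that] by simp
    moreover have "(Fw q)\<^sup>2 * ((c q)\<^sup>2 * inverse (Fw q * Fw q)) = (c q)\<^sup>2"
      using Fpos[of q] by (simp add: power2_eq_square field_simps)
    ultimately show ?thesis by (simp only: distrib_left)
  qed
  \<comment> \<open>The unit relation in the form f^2 - c^2 = f^2 a^2 gives the last equation the
    factor a.\<close>
  have Sc: "S q c = (Fw q)\<^sup>2 * (a q * (a q - k q))" if "q \<in> W" for q
    using components[OF that] unit'[OF that] by (simp add: power2_eq_square algebra_simps)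
  have Ta: "T q a = 1 - (a q)\<^sup>2" and Sa: "S q a = c q * (k q - a q)" and Tb: "T q c = c q * (k q - a q)"
    if "q \<in> W" for q
    using components[OF that] by blast+
  let ?p = "(b, y)"
  have na: "smooth_near AM ?p a" and nc: "smooth_near AM ?p c"
    using smooth_nearI[OF atM W(1,2)] a c by blast+
  have "T ?p k = 1 - (k ?p)\<^sup>2"
    by (rule warped_surface_ode[where A = AM and W = W and p = ?p and T = T and S = S and F = Fw and k = k and a = a and b = c])
      (fact atM W(1,2) tT[OF W(2)] tS[OF W(2)] nF nk[OF W(2)] na nc Fpos TF[OF W(2)] Sk[OF W(2)]
          Ta Sa Tb Sc unit'[OF W(2)] commute[OF W(2) na] commute[OF W(2) nc])+
  then have T\<kappa>: "T0 b \<kappa> = 1 - (\<kappa> b)\<^sup>2" using Tk[OF W(2)] by (simp add: k_def)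
  note tb = tT0[OF XB(2)]
  have ni: "smooth_near AB b (\<lambda>x. inverse (f x))" by (rule smooth_nearI[OF atB open_UNIV UNIV_I finv])
  have nt: "smooth_near AB b (\<lambda>x. T0 x f)" by (rule smooth_nearI[OF atB XB(1,2) T0f])
  have "1 - (\<kappa> b)\<^sup>2 = T0 b f * T0 b (\<lambda>x. inverse (f x)) + inverse (f b) * T0 b (\<lambda>x. T0 x f)"
    using tangent_mult[OF atB tb nt ni] T\<kappa> by (simp add: \<kappa>_def[abs_def])
  \<comment> \<open>The derivative of 1/f is obtained by differentiating f * (1/f) = 1. With it, T
    \<kappa> equals T (T f) / f - \<kappa>^2, so the squares cancel against those in 1 - \<kappa>^2
    and T (T f) = f remains.\<close>
  moreover have "f b * T0 b (\<lambda>x. inverse (f x)) + inverse (f b) * T0 b f = 0"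
  proof -
    have "(\<lambda>x. f x * inverse (f x)) = (\<lambda>x. 1)" using f_pos by (auto simp: less_imp_neq[symmetric])
    then show ?thesis using tangent_mult[OF atB tb nf ni] tangent_const[OF atB tb] by simp
  qed
  then have "T0 b (\<lambda>x. inverse (f x)) = - (inverse (f b) * inverse (f b) * T0 b f)"
    using f_pos[of b] by (simp add: field_simps)
  ultimately have "inverse (f b) * T0 b (\<lambda>x. T0 x f) = 1"
    by (simp add: \<kappa>_def power2_eq_square algebra_simps)
  then have "T0 b (\<lambda>x. T0 x f) = f b" using f_pos[of b] by (simp add: field_simps)
  then show ?thesis by (simp add: lap)
qed

theorem corollary3p25:
  fixes AB :: "('b::{t2_space, second_countable_topology}, 'd::euclidean_space) chart set"
    and gB :: "'b metric" and nabB :: "'b connection"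
    and AF :: "('f::{t2_space, second_countable_topology}, 'k::euclidean_space) chart set"
    and gF :: "'f metric"
    and f :: "'b \<Rightarrow> real"
    and AM :: "('b \<times> 'f, 'd \<times> 'k) chart set"
    and g :: "('b \<times> 'f) metric" and nab :: "('b \<times> 'f) connection"
    and AN :: "('n::{t2_space, second_countable_topology}, 'e::euclidean_space) chart set"
    and \<phi> :: "'n \<Rightarrow> 'n tangent \<Rightarrow> 'n tangent" and \<xi> :: "'n field"
    and \<eta> :: "'n \<Rightarrow> 'n tangent \<Rightarrow> real"
    and gN :: "'n metric" and nabN :: "'n connection" and c :: real
    and \<psi> :: "'b \<times> 'f \<Rightarrow> 'n"
    and D :: "'b \<times> 'f \<Rightarrow> ('b \<times> 'f) tangent \<Rightarrow> ('b \<times> 'f \<Rightarrow> 'n tangent) \<Rightarrow> 'n tangent"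
    and m1 :: nat
  assumes "riemannian_manifold AB gB" and "levi_civita AB gB nabB" and "m1 = DIM('d)"
    and "riemannian_manifold AF gF"
    and "smooth_fun_on AB UNIV f" and "\<And>b. f b > 0"
    and "AM = prod_atlas AB AF" and "g = warped_metric AB gB AF gF f"
    and "levi_civita AM g nab"
    and "kenmotsu_space_form AN \<phi> \<xi> \<eta> gN nabN c"
    and "isometric_immersion AM g AN gN \<psi>"
    and "DIM('d \<times> 'k) = 2"
    and "pullback_connection AM AN \<psi> nabN D" and "totally_geodesic AM AN \<psi> nab D"
    and "\<And>p. \<xi> (\<psi> p) \<in> push AN \<psi> p ` tangent_space AM p"
  shows "\<forall>b. real m1 * (- 1) \<le> laplacian AB gB nabB f b / f b \<and>
             laplacian AB gB nabB f b / f b \<le> real m1 * (- 1)"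
proof
  fix b
  \<comment> \<open>Both model spaces have positive dimension and the dimensions add up to
    2.\<close>
  have dims: "DIM('d) = 1" "DIM('k) = 1"
    using assms(12)[unfolded DIM_prod] DIM_positive[where 'a = 'd] DIM_positive[where 'a = 'k] by linarith+
  have K: "kenmotsu AN \<phi> \<xi> \<eta> gN nabN" using assms(10) by (simp add: kenmotsu_space_form_def)
  have "laplacian AB gB nabB f b = - f b"
    by (rule laplacian_warping_function[OF assms(1,2,4-9) K assms(11) dims assms(13-15)])
  \<comment> \<open>With m1 = 1 the two bounds coincide at -1, the exact value of the
    quotient.\<close>
  then show "real m1 * (- 1) \<le> laplacian AB gB nabB f b / f b \<and> laplacian AB gB nabB f b / f b \<le> real m1 * (- 1)"
    using assms(6)[of b] by (simp add: assms(3) dims)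
qed

end
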